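(* Let $f(X)$, $g(X)$ be automorphisms of $\mathbb{P}^1$ defined over $\mathbb{C}$ and let $c(X)$ be a rational function defined over $\mathbb{C}$. Suppose that the semigroup generated by $f(X)$ and $g(X)$ under composition is free. Then there are only finitely many $\lambda\in\mathbb{C}$ such that $$f^n(\lambda)=g^n(\lambda)=c(\lambda)$$ for some positive integer $n$, unless $f(X)$, $g(X)$ are simultaneously conjugated by an automorphism of $\mathbb{P}^1(\mathbb{C})$ to one of the following: (1) $\alpha X+\beta$, $X/(\gamma X+\delta)$, with some $\alpha,\delta,\gamma,\beta\in\mathbb{C}^*$ such that one of $\alpha/\delta$ and $\alpha\delta$ is a root of unity; (2) $\alpha X+\beta$, $\delta X+\gamma$, with some $\alpha,\delta\in\mathbb{C}^*$ (and $\beta,\gamma\in\mathbb{C}$) such that $\alpha$ and $\delta$ are not roots of unity, $\gamma$ and $\beta$ are not both $0$, and either $\alpha/\delta$ is a root of unity other than $1$ or one of $\alpha^2/\delta$ and $\delta^2/\alpha$ is a root of unity.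
   Context: For a rational function $f$, $f^n$ denotes the $n$-fold composition of $f$ with itself. Rational functions are regarded as maps $\mathbb{P}^1(\mathbb{C})\to\mathbb{P}^1(\mathbb{C})$. "The semigroup generated by $f$ and $g$ under composition is free" means that it is the free semigroup on the two generators $f$ and $g$, i.e. two distinct nonempty words in $f$ and $g$ never give the same map under composition. "Simultaneously conjugated by an automorphism" means that there is a single automorphism $\phi$ of $\mathbb{P}^1(\mathbb{C})$ such that $\phi^{-1}\circ f\circ\phi$ and $\phi^{-1}\circ g\circ\phi$ are the listed maps. *)

theory Defs
  imports
    Complex_Main
    "HOL-Computational_Algebra.Computational_Algebra"
    "HOL-Computational_Algebra.Field_as_Ring"
begin

datatype P1 = Point complex | Infty

type_synonym rational_function = "complex poly fract"

(* quot_of_fract yields coprime p and q with q nonzero. At Infty the value is the quotient of the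
   coefficients of X^m, where m = max (deg p) (deg q). *)
definition rat_map :: "rational_function \<Rightarrow> P1 \<Rightarrow> P1" where
  "rat_map r z =
    (let (p, q) = quot_of_fract r in
      case z of
        Point x \<Rightarrow> if poly q x = 0 then Infty else Point (poly p x / poly q x)
      | Infty \<Rightarrow> if degree p > degree q then Infty
          else Point (coeff p (degree q) / lead_coeff q))"

definition is_automorphism :: "rational_function \<Rightarrow> bool" where
  "is_automorphism f \<longleftrightarrow>
    (\<exists>h. rat_map f \<circ> rat_map h = id \<and> rat_map h \<circ> rat_map f = id)"

fun word_map :: "('a \<Rightarrow> 'a) \<Rightarrow> ('a \<Rightarrow> 'a) \<Rightarrow> bool list \<Rightarrow> 'a \<Rightarrow> 'a" where
  "word_map F G [] = id"
| "word_map F G (b # w) = (if b then F else G) \<circ> word_map F G w"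

(* Free as a semigroup: the empty word is excluded. *)
definition generate_free_semigroup :: "('a \<Rightarrow> 'a) \<Rightarrow> ('a \<Rightarrow> 'a) \<Rightarrow> bool" where
  "generate_free_semigroup F G \<longleftrightarrow> inj_on (word_map F G) {w. w \<noteq> []}"

definition root_of_unity :: "complex \<Rightarrow> bool" where
  "root_of_unity z \<longleftrightarrow> (\<exists>n::nat. n > 0 \<and> z ^ n = 1)"

definition simultaneously_conjugate ::
  "rational_function \<Rightarrow> rational_function \<Rightarrow> rational_function \<Rightarrow> rational_function \<Rightarrow> bool" where
  "simultaneously_conjugate f g f' g' \<longleftrightarrow>
    (\<exists>\<phi>. is_automorphism \<phi> \<and>
      inv (rat_map \<phi>) \<circ> rat_map f \<circ> rat_map \<phi> = rat_map f' \<and>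
      inv (rat_map \<phi>) \<circ> rat_map g \<circ> rat_map \<phi> = rat_map g')"

definition exceptional_1 :: "rational_function \<Rightarrow> rational_function \<Rightarrow> bool" where
  "exceptional_1 f g \<longleftrightarrow>
    (\<exists>\<alpha> \<beta> \<gamma> \<delta>. \<alpha> \<noteq> 0 \<and> \<beta> \<noteq> 0 \<and> \<gamma> \<noteq> 0 \<and> \<delta> \<noteq> 0 \<and>
      (root_of_unity (\<alpha> / \<delta>) \<or> root_of_unity (\<alpha> * \<delta>)) \<and>
      simultaneously_conjugate f g (Fract [:\<beta>, \<alpha>:] 1) (Fract [:0, 1:] [:\<delta>, \<gamma>:]))"

definition exceptional_2 :: "rational_function \<Rightarrow> rational_function \<Rightarrow> bool" where
  "exceptional_2 f g \<longleftrightarrow>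
    (\<exists>\<alpha> \<beta> \<gamma> \<delta>. \<alpha> \<noteq> 0 \<and> \<delta> \<noteq> 0 \<and>
      \<not> root_of_unity \<alpha> \<and> \<not> root_of_unity \<delta> \<and> \<not> (\<gamma> = 0 \<and> \<beta> = 0) \<and>
      ((root_of_unity (\<alpha> / \<delta>) \<and> \<alpha> / \<delta> \<noteq> 1) \<or>
        root_of_unity (\<alpha>\<^sup>2 / \<delta>) \<or> root_of_unity (\<delta>\<^sup>2 / \<alpha>)) \<and>
      simultaneously_conjugate f g (Fract [:\<beta>, \<alpha>:] 1) (Fract [:\<gamma>, \<delta>:] 1))"

end

theory Submission
  imports Defs "HOL-Analysis.Continuum_Not_Denumerable"
begin

text \<open>
Any two Moebius maps can be moved to a simple form by one change of coordinate: a fixed point of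
$f$ goes to $\infty$; if $g$ shares it, then $f = \alpha X + \beta$ and $g = \delta X + \gamma$, and
otherwise a fixed point of $g$ goes to $0$ and $g = X / (\gamma X + \delta)$
(\<open>moebius_pair_normal_form\<close>). Let $u$ be the second fixed point of $f$. If $\alpha \neq 1$, the equation
$f^n(w) = c(w)$ says $\alpha^n = (c(w) - u) / (w - u)$, and if $\alpha = 1$ it says
$n = (c(w) - w) / \beta$; the same holds for $g$. So $\alpha^n$ (or $n$) and $\delta^n$ (or $n$) are the values at
one point $w$ of two fixed rational functions. Since the semigroup is free, $f^n \neq g^n$, and two
different Moebius maps agree at finitely many points only. Infinitely many exceptional $\lambda$
therefore mean that infinitely many $n$ occur, that is, that infinitely many points
$(\alpha^n, \delta^n)$ lie on one rational curve.

Two rational functions of one variable satisfy a polynomial relation, so an exponential polynomial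
with bases $\alpha^i \delta^j$ has infinitely many zeros $n$. The theorem of Skolem, Mahler and Lech, in
the form \<open>skolem_two_generators\<close>, then makes $\alpha$ and $\delta$ multiplicatively dependent
(\<open>two_exponentials_on_rational_curve\<close>). When one of the two maps is a translation up to
conjugation, it makes the other multiplier a root of unity
(\<open>index_and_exponential_on_rational_curve\<close>), so that this map has finite order or is parabolic too.

A relation $\alpha^a \delta^b = 1$ gives an equation between $w$ and $c(w)$ that holds at infinitely many
$w$, hence identically. Unique factorization of polynomials shows that such an identity forces
$c = X$, which is impossible because it would make $\alpha^n = 1$, or a linear relation between $a$ and $b$
(\<open>common_fixed_point_product_identity\<close>, \<open>common_fixed_point_quotient_identity\<close>,
\<open>no_common_fixed_point_identity\<close>). These linear relations are the exceptional families, with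
one addition: for a common fixed point they also allow $\alpha\delta$ to be a root of unity, say of order $m$.
Then $(f \circ g)^m$ and $(g \circ f)^m$ are both translations and commute, so the semigroup
is not free.

The Skolem--Mahler--Lech statement is proved by the elementary $p$-adic method of Hansel, without
completions. It takes place in a subring $A$ of the complex numbers in which no nonzero element
is divisible by all powers of $p$ and in which $\alpha^s$ and $\delta^s$ are congruent to $1$ modulo $p$ for some
$s > 0$; \<open>exists_padic_ring\<close> constructs $A$ for arbitrary nonzero $\alpha$ and $\delta$, algebraic or not. Along a
residue class modulo $s$, an exponential polynomial then becomes a series
$\sum_i \binom{n}{i} p^i d_i$ with $d_i$ in $A$, and such a series vanishes identically as soon as it has
infinitely many zeros (\<open>newton_series_infinitely_many_zeros\<close>).
\<close>

section \<open>Separated rings and series in binomial coefficients\<close>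

text \<open>
This is all that the $p$-adic argument uses of a ring of $p$-adic integers: the other primes are
invertible, and $0$ is the only element divisible by every power of $p$. Divisibility of \<open>x\<close> by
$p^k$ is written as \<open>x / of_nat p ^ k \<in> A\<close>, since \<open>A\<close> lives inside the field of complex numbers. The
bound $p \ge 3$ makes $p^i$ gain on the denominator $i!$ in \<open>power_div_fact_mem\<close>.
\<close>

locale padic_ring =
  fixes A :: "complex set" and p :: nat
  assumes prime_p: "prime p" and p_ge_3: "p \<ge> 3"
    and one_mem: "1 \<in> A"
    and diff_mem: "\<And>x y. x \<in> A \<Longrightarrow> y \<in> A \<Longrightarrow> x - y \<in> A"
    and mult_mem: "\<And>x y. x \<in> A \<Longrightarrow> y \<in> A \<Longrightarrow> x * y \<in> A"
    and inverse_mem: "\<And>q. \<not> p dvd q \<Longrightarrow> 1 / of_nat q \<in> A"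
    and separated: "\<And>x. (\<And>k. x / of_nat p ^ k \<in> A) \<Longrightarrow> x = 0"
begin

lemma p_pos [simp]: "0 < p" "p \<noteq> 0"
  using p_ge_3 by simp_all

lemma zero_mem [simp]: "0 \<in> A"
  using diff_mem[OF one_mem one_mem] by simp

lemma uminus_mem: "x \<in> A \<Longrightarrow> - x \<in> A"
  using diff_mem[OF zero_mem] by simp

lemma add_mem: "x \<in> A \<Longrightarrow> y \<in> A \<Longrightarrow> x + y \<in> A"
  using diff_mem[OF _ uminus_mem] by simp

lemma of_nat_mem [simp]: "of_nat n \<in> A"
  by (induction n) (auto intro: add_mem one_mem)

lemma of_int_mem [simp]: "of_int n \<in> A"
  by (cases n) (auto intro: uminus_mem simp del: of_nat_Suc)

lemma power_mem: "x \<in> A \<Longrightarrow> x ^ n \<in> A"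
  by (induction n) (auto intro: mult_mem one_mem)

lemma sum_mem: "(\<And>i. i \<in> I \<Longrightarrow> f i \<in> A) \<Longrightarrow> sum f I \<in> A"
  by (induction I rule: infinite_finite_induct) (auto intro: add_mem)

lemma prod_mem: "(\<And>i. i \<in> I \<Longrightarrow> f i \<in> A) \<Longrightarrow> prod f I \<in> A"
  by (induction I rule: infinite_finite_induct) (auto intro: mult_mem one_mem)

lemma divisible_mono: "x / of_nat p ^ j \<in> A" if "x / of_nat p ^ k \<in> A" "j \<le> k"
proof -
  have "(of_nat p :: complex) ^ k = of_nat p ^ j * of_nat p ^ (k - j)"
    using that(2) by (simp flip: power_add)
  then have "x / of_nat p ^ j = x / of_nat p ^ k * of_nat p ^ (k - j)"
    by simp
  then show ?thesis
    using mult_mem[OF that(1) power_mem[OF of_nat_mem]] by simp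
qed

lemma divisible_mult: "c \<in> A \<Longrightarrow> x / of_nat p ^ k \<in> A \<Longrightarrow> c * x / of_nat p ^ k \<in> A"
  using mult_mem[of c "x / of_nat p ^ k"] by simp

lemma divisible_add:
  "x / of_nat p ^ k \<in> A \<Longrightarrow> y / of_nat p ^ k \<in> A \<Longrightarrow> (x + y) / of_nat p ^ k \<in> A"
  by (simp add: add_divide_distrib add_mem)

lemma divisible_sum:
  "(\<And>i. i \<in> I \<Longrightarrow> f i / of_nat p ^ k \<in> A) \<Longrightarrow> sum f I / of_nat p ^ k \<in> A"
  by (simp add: sum_divide_distrib sum_mem)

text \<open>
The multiples of $p$ among $1, \dots, n$ contribute $p^m m!$ with $m = \lfloor n / p \rfloor$, and the other
factors are prime to $p$. Iterating this gives a weak form of Legendre's formula, in which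
$v_p(n!) \le n / 2$ follows from $m + m / 2 \le n / 2$ for $m \le n / 3$.
\<close>

lemma fact_block:
  "\<exists>q. fact n = p ^ (n div p) * fact (n div p) * q \<and> \<not> p dvd q"
proof (induction n)
  case 0
  show ?case using p_ge_3 by (intro exI[of _ 1]) auto
next
  case (Suc n)
  then obtain q where q: "fact n = p ^ (n div p) * fact (n div p) * q" "\<not> p dvd q" by blast
  show ?case
  proof (cases "p dvd Suc n")
    case True
    then have d: "Suc n div p = Suc (n div p)"
      by (metis dvd_imp_mod_0 div_Suc)
    have "Suc n = p * Suc (n div p)"
      using True d by (metis dvd_mult_div_cancel)
    then have "fact (Suc n) = (p * Suc (n div p)) * fact n"
      by (metis fact_Suc of_nat_id)
    then show ?thesis
      using q d by (intro exI[of _ q]) (simp add: algebra_simps)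
  next
    case False
    then have d: "Suc n div p = n div p"
      by (simp add: div_Suc mod_eq_0_iff_dvd)
    have "\<not> p dvd Suc n * q"
      using False q(2) prime_p by (simp add: prime_dvd_mult_iff del: mult_Suc)
    then show ?thesis
      using q d by (intro exI[of _ "Suc n * q"]) (simp add: algebra_simps)
  qed
qed

lemma fact_valuation: "\<exists>v q. fact n = p ^ v * q \<and> \<not> p dvd q \<and> v \<le> n div 2"
proof (induction n rule: less_induct)
  case (less n)
  obtain q where q: "fact n = p ^ (n div p) * fact (n div p) * q" "\<not> p dvd q"
    using fact_block by blast
  show ?case
  proof (cases "n = 0")
    case True
    then show ?thesis using p_ge_3 by (rule_tac exI[of _ 0], rule_tac exI[of _ 1]) auto
  next
    case False
    then have "n div p < n" using p_ge_3 by simp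
    from less.IH[OF this] obtain v r
      where v: "fact (n div p) = p ^ v * r" "\<not> p dvd r" "v \<le> n div p div 2" by blast
    have "n div p \<le> n div 3" using p_ge_3 by (simp add: div_le_mono2)
    then have "n div p + v \<le> n div 2" using v(3) by linarith
    moreover have "\<not> p dvd r * q" using v q prime_p by (simp add: prime_dvd_mult_iff)
    ultimately show ?thesis
      using q(1) v(1) by (rule_tac exI[of _ "n div p + v"], rule_tac exI[of _ "r * q"]) (simp add: power_add)
  qed
qed

lemma power_div_fact_mem: "of_nat p ^ (n div 2) / fact n \<in> A"
proof -
  obtain v q where v: "fact n = p ^ v * q" "\<not> p dvd q" "v \<le> n div 2"
    using fact_valuation by blast
  have "q \<noteq> 0" using v(2) by (metis dvd_0_right)
  have "(fact n :: complex) = of_nat (fact n)" by simp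
  also have "\<dots> = of_nat p ^ v * of_nat q" by (simp only: v(1) of_nat_mult of_nat_power)
  finally have "(fact n :: complex) = of_nat p ^ v * of_nat q" .
  moreover have "(of_nat p :: complex) ^ (n div 2) = of_nat p ^ v * of_nat p ^ (n div 2 - v)"
    using v(3) by (simp flip: power_add)
  ultimately have "(of_nat p :: complex) ^ (n div 2) / fact n = of_nat p ^ (n div 2 - v) * (1 / of_nat q)"
    using \<open>q \<noteq> 0\<close> by simp
  then show ?thesis
    using mult_mem[OF power_mem[OF of_nat_mem] inverse_mem[OF v(2)]] by simp
qed

text \<open>
Splitting off a root by synthetic division shifts the coefficients down by one degree and leaves
them integral combinations of the old coefficients of higher degree. If the coefficient of
degree $i$ is divisible by $p^{\lceil (i + k) / 2 \rceil}$, the quotient satisfies the same with $k + 1$ in place of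
$k$. So every root improves the divisibility of all values of the polynomial by half a power of $p$.
\<close>

lemma divisible_at_point_of_roots:
  fixes R :: "complex poly"
  assumes "finite S" and "\<And>n. n \<in> S \<Longrightarrow> poly R (of_nat n) = 0"
    and "\<And>i. coeff R i / of_nat p ^ ((i + k + 1) div 2) \<in> A"
  shows "poly R (of_nat m) / of_nat p ^ ((k + card S + 1) div 2) \<in> A"
  using assms
proof (induction S arbitrary: R k rule: finite_induct)
  case empty
  have "coeff R i * of_nat m ^ i / of_nat p ^ ((k + 1) div 2) \<in> A" for i
  proof -
    have "coeff R i / of_nat p ^ ((k + 1) div 2) \<in> A"
      by (rule divisible_mono[OF empty(2)[of i]]) simp
    from divisible_mult[OF power_mem[OF of_nat_mem] this] show ?thesis
      by (simp add: mult.commute)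
  qed
  then show ?case by (simp add: poly_altdef divisible_sum)
next
  case (insert n S)
  define Q where "Q = synthetic_div R (of_nat n)"
  have R: "R = [:- of_nat n, 1:] * Q"
    using synthetic_div_correct'[of "of_nat n" R] insert.prems(1)[of n] by (simp add: Q_def)
  have "poly Q (of_nat x) = 0" if "x \<in> S" for x
  proof -
    have "poly R (of_nat x) = 0" "x \<noteq> n" using insert that by auto
    then show ?thesis by (simp add: R)
  qed
  moreover have "coeff Q i / of_nat p ^ ((i + Suc k + 1) div 2) \<in> A" for i
  proof (induction "degree Q - i" arbitrary: i rule: less_induct)
    case less
    show ?case
    proof (cases "i > degree Q")
      case True
      then show ?thesis by (simp add: coeff_eq_0)
    next
      case False
      have "coeff R (Suc i) = coeff Q i - of_nat n * coeff Q (Suc i)"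
        by (simp add: R)
      then have Qi: "coeff Q i = coeff R (Suc i) + of_nat n * coeff Q (Suc i)" by simp
      have "coeff Q (Suc i) / of_nat p ^ ((Suc i + Suc k + 1) div 2) \<in> A"
      proof (cases "Suc i > degree Q")
        case True
        then show ?thesis by (simp add: coeff_eq_0)
      next
        case False
        then show ?thesis by (intro less) auto
      qed
      then have 1: "coeff Q (Suc i) / of_nat p ^ ((i + Suc k + 1) div 2) \<in> A"
        by (rule divisible_mono) simp
      have 2: "coeff R (Suc i) / of_nat p ^ ((i + Suc k + 1) div 2) \<in> A"
        using insert.prems(2)[of "Suc i"] by simp
      show ?thesis
        unfolding Qi by (intro divisible_add 2 divisible_mult 1 of_nat_mem)
    qed
  qed
  ultimately have "poly Q (of_nat m) / of_nat p ^ ((Suc k + card S + 1) div 2) \<in> A"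
    by (rule insert.IH)
  from divisible_mult[OF diff_mem[OF of_nat_mem of_nat_mem] this, of m n]
  have "poly R (of_nat m) / of_nat p ^ ((Suc k + card S + 1) div 2) \<in> A"
    by (simp only: R poly_mult) simp
  moreover have "Suc k + card S = k + card (insert n S)"
    using insert.hyps by simp
  ultimately show ?case by (simp only:)
qed

lemma coeff_falling_mem: "coeff (\<Prod>j<i. [:- of_nat j, 1:]) l \<in> A"
proof (induction i arbitrary: l)
  case 0
  then show ?case by (simp add: coeff_1 one_mem)
next
  case (Suc i)
  have "coeff ([:- of_nat i, 1:] * (\<Prod>j<i. [:- of_nat j, 1:])) l \<in> A"
    by (cases l) (auto intro!: add_mem uminus_mem mult_mem diff_mem Suc simp: coeff_pCons)
  then show ?case by (simp only: prod.lessThan_Suc mult.commute)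
qed

lemma poly_falling:
  "poly (\<Prod>j<i. [:- of_nat j, 1:]) (of_nat n) = (fact i * of_nat (n choose i) :: complex)"
  by (simp add: poly_prod binomial_gbinomial gbinomial_prod_rev atLeast0LessThan)

text \<open>
Sequences given by a Mahler (Newton) expansion whose $i$-th coefficient is divisible by $p^i$. They are
$p$-adic analytic functions of $n$; the sum is finite because \<open>n choose i\<close> vanishes for $i > n$.
\<close>

definition newton_series :: "(nat \<Rightarrow> complex) \<Rightarrow> bool" where
  "newton_series b \<longleftrightarrow>
    (\<exists>d. (\<forall>i. d i \<in> A) \<and>
      (\<forall>n. b n = (\<Sum>i\<le>n. of_nat (n choose i) * of_nat p ^ i * d i)))"

lemma newton_series_sum_extend:
  fixes d :: "nat \<Rightarrow> complex"
  assumes "n \<le> M"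
  shows "(\<Sum>i\<le>n. of_nat (n choose i) * of_nat p ^ i * d i) =
    (\<Sum>i\<le>M. of_nat (n choose i) * of_nat p ^ i * d i)"
  using assms by (intro sum.mono_neutral_left) auto

text \<open>
This replaces the fact that a $p$-adic analytic function on a compact disc has finitely many zeros.
Given $2N$ zeros, truncate the series so far out that it agrees with \<open>b\<close> at these zeros and at $m$.
The truncation is a polynomial in $n$ whose coefficient of degree $l$ is divisible by
$p^{\lceil l / 2 \rceil}$, because $p^i / i!$ is divisible by $p^{\lceil i / 2 \rceil}$. By \<open>divisible_at_point_of_roots\<close> the
value at $m$ is divisible by $p^N$, and $N$ is arbitrary.
\<close>

theorem newton_series_infinitely_many_zeros:
  assumes "newton_series b" and inf: "infinite {n. b n = 0}"
  shows "b m = 0"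
proof (rule separated)
  fix N
  obtain d where d: "\<And>i. d i \<in> A"
    and b: "\<And>n. b n = (\<Sum>i\<le>n. of_nat (n choose i) * of_nat p ^ i * d i)"
    using assms(1) unfolding newton_series_def by blast
  \<comment> \<open>every root gains half a power of $p$\<close>
  obtain S where S: "S \<subseteq> {n. b n = 0}" "finite S" "card S = 2 * N"
    using infinite_arbitrarily_large[OF inf] by blast
  define M where "M = Max (insert m S)"
  have M: "n \<le> M" if "n \<in> insert m S" for n
    using S(2) that unfolding M_def by (intro Max_ge) auto
  \<comment> \<open>coefficients with respect to falling factorials, since $\binom{n}{i} i!$ is the $i$-th falling factorial of $n$\<close>
  define e where "e i = d i * of_nat p ^ i / fact i" for i
  define R where "R = (\<Sum>i\<le>M. smult (e i) (\<Prod>j<i. [:- of_nat j, 1:]))"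
  have R: "poly R (of_nat n) = b n" if "n \<in> insert m S" for n
  proof -
    have "poly R (of_nat n) = (\<Sum>i\<le>M. of_nat (n choose i) * of_nat p ^ i * d i)"
      by (simp add: R_def poly_sum poly_falling e_def mult_ac)
    then show ?thesis using newton_series_sum_extend[OF M[OF that]] b by simp
  qed
  have e: "e i / of_nat p ^ ((i + 1) div 2) \<in> A" for i
  proof -
    have i: "i = i div 2 + (i + 1) div 2" by linarith
    have "(of_nat p :: complex) ^ i = of_nat p ^ (i div 2) * of_nat p ^ ((i + 1) div 2)"
      by (metis i power_add)
    then have "e i / of_nat p ^ ((i + 1) div 2) = d i * (of_nat p ^ (i div 2) / fact i)"
      by (simp add: e_def)
    then show ?thesis using mult_mem[OF d power_div_fact_mem] by simp
  qed
  have "coeff R l / of_nat p ^ ((l + 0 + 1) div 2) \<in> A" for l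
  proof -
    have "coeff (smult (e i) (\<Prod>j<i. [:- of_nat j, 1:])) l / of_nat p ^ ((l + 0 + 1) div 2) \<in> A"
      for i
    proof (cases "i < l")
      case True
      have "degree (\<Prod>j<i. [:- of_nat j, 1 :: complex:]) = i"
        by (subst degree_prod_eq_sum_degree) auto
      then show ?thesis using True by (simp add: coeff_eq_0)
    next
      case False
      have "e i / of_nat p ^ ((l + 0 + 1) div 2) \<in> A"
        by (rule divisible_mono[OF e[of i]]) (use False in simp)
      from divisible_mult[OF coeff_falling_mem this, of i l] show ?thesis
        by (simp add: mult.commute)
    qed
    then show ?thesis unfolding R_def coeff_sum by (intro divisible_sum)
  qed
  from divisible_at_point_of_roots[OF S(2) _ this, of m]
  have "poly R (of_nat m) / of_nat p ^ ((0 + card S + 1) div 2) \<in> A"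
    using R S(1) by auto
  then show "b m / of_nat p ^ N \<in> A" using S(3) R[of m] by simp
qed

lemma newton_series_scale: "newton_series b \<Longrightarrow> c \<in> A \<Longrightarrow> newton_series (\<lambda>n. c * b n)"
  unfolding newton_series_def
  by (elim exE, rule_tac x = "\<lambda>i. c * d i" in exI) (auto simp: sum_distrib_left mult_ac mult_mem)

lemma newton_series_add:
  assumes "newton_series b" "newton_series b'"
  shows "newton_series (\<lambda>n. b n + b' n)"
proof -
  obtain d d' where d: "\<And>i. d i \<in> A" "\<And>n. b n = (\<Sum>i\<le>n. of_nat (n choose i) * of_nat p ^ i * d i)"
    and d': "\<And>i. d' i \<in> A" "\<And>n. b' n = (\<Sum>i\<le>n. of_nat (n choose i) * of_nat p ^ i * d' i)"
    using assms unfolding newton_series_def by blast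
  show ?thesis unfolding newton_series_def
    by (rule exI[of _ "\<lambda>i. d i + d' i"])
       (auto simp: d d' algebra_simps sum.distrib intro: add_mem)
qed

lemma newton_series_zero: "newton_series (\<lambda>_. 0)"
  unfolding newton_series_def by (rule exI[of _ "\<lambda>_. 0"]) auto

lemma newton_series_sum:
  "(\<And>j. j \<in> J \<Longrightarrow> newton_series (b j)) \<Longrightarrow> newton_series (\<lambda>n. \<Sum>j\<in>J. b j n)"
  by (induction J rule: infinite_finite_induct) (auto intro: newton_series_add newton_series_zero)

lemma newton_series_power:
  assumes "x \<in> A" shows "newton_series (\<lambda>n. (1 + of_nat p * x) ^ n)"
  unfolding newton_series_def
proof (intro exI[of _ "\<lambda>i. x ^ i"] conjI allI)
  show "x ^ i \<in> A" for i using assms by (rule power_mem)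
  show "(1 + of_nat p * x) ^ n = (\<Sum>i\<le>n. of_nat (n choose i) * of_nat p ^ i * x ^ i)" for n
    using binomial_ring[of "of_nat p * x" 1 n] by (simp add: power_mult_distrib mult_ac add.commute)
qed

text \<open>
The identity $n \binom{n}{i} = i \binom{n}{i} + (i + 1) \binom{n}{i+1}$ raises the index by one, so the factor
$p$ is what keeps the $i$-th coefficient divisible by $p^i$.
\<close>

lemma newton_series_times_index:
  assumes "newton_series b" shows "newton_series (\<lambda>n. of_nat p * of_nat n * b n)"
proof -
  obtain d where d: "\<And>i. d i \<in> A" "\<And>n. b n = (\<Sum>i\<le>n. of_nat (n choose i) * of_nat p ^ i * d i)"
    using assms unfolding newton_series_def by blast
  define d' where "d' i = of_nat p * of_nat i * d i + of_nat i * d (i - 1)" for i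
  have "of_nat p * of_nat n * b n = (\<Sum>i\<le>n. of_nat (n choose i) * of_nat p ^ i * d' i)" for n
  proof -
    \<comment> \<open>the value of \<open>d\<close> at $0 - 1 = 0$ is harmless because of the factor $i$\<close>
    define t where "t i = of_nat (n choose i) * of_nat i * of_nat p ^ i * d (i - 1)" for i
    have absorb: "of_nat n * of_nat (n choose i) =
        (of_nat i * of_nat (n choose i) + of_nat (Suc i) * of_nat (n choose Suc i) :: complex)"
      if "i \<le> n" for i
    proof -
      have "Suc i * (n choose Suc i) = (n - i) * (n choose i)"
        by (simp only: binomial_absorption binomial_absorb_comp)
      then have "n * (n choose i) = i * (n choose i) + Suc i * (n choose Suc i)"
        using that by (metis add_mult_distrib le_add_diff_inverse)
      then show ?thesis by (metis of_nat_add of_nat_mult)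
    qed
    have "of_nat p * of_nat n * b n =
        (\<Sum>i\<le>n. of_nat p ^ Suc i * d i * (of_nat n * of_nat (n choose i)))"
      by (simp add: d(2) sum_distrib_left mult_ac)
    also have "\<dots> = (\<Sum>i\<le>n. of_nat p ^ Suc i * d i *
        (of_nat i * of_nat (n choose i) + of_nat (Suc i) * of_nat (n choose Suc i)))"
      by (intro sum.cong refl) (simp only: absorb atMost_iff)
    also have "\<dots> = (\<Sum>i\<le>n. of_nat p ^ Suc i * d i * (of_nat i * of_nat (n choose i))) +
        (\<Sum>i\<le>n. t (Suc i))"
      unfolding sum.distrib[symmetric]
      by (intro sum.cong refl) (simp only: t_def diff_Suc_1 distrib_left mult_ac)
    also have "(\<Sum>i\<le>n. t (Suc i)) = (\<Sum>i\<le>Suc n. t i)"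
      unfolding sum.atMost_Suc_shift by (simp add: t_def)
    also have "\<dots> = (\<Sum>i\<le>n. t i)"
      by (simp add: t_def)
    also have "(\<Sum>i\<le>n. of_nat p ^ Suc i * d i * (of_nat i * of_nat (n choose i))) +
        (\<Sum>i\<le>n. t i) = (\<Sum>i\<le>n. of_nat (n choose i) * of_nat p ^ i * d' i)"
      unfolding sum.distrib[symmetric]
      by (intro sum.cong refl) (simp add: t_def d'_def algebra_simps)
    finally show ?thesis .
  qed
  moreover have "d' i \<in> A" for i unfolding d'_def by (intro add_mem mult_mem of_nat_mem d)
  ultimately show ?thesis unfolding newton_series_def by blast
qed

text \<open>
Some residue class $r$ modulo $s$ contains infinitely many zeros. On it, $\mu^{r + sn} = \mu^r (1 + p x)^n$ is
expanded by the binomial theorem, so that a multiple of the exponential polynomial is a Newton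
series.
\<close>

theorem exponential_polynomial_zero_on_progression:
  fixes c \<mu> :: "'j \<Rightarrow> complex" and e :: "'j \<Rightarrow> nat"
  assumes "finite J" and "s > 0"
    and c: "\<And>j. j \<in> J \<Longrightarrow> c j \<in> A" and \<mu>: "\<And>j. j \<in> J \<Longrightarrow> \<mu> j \<in> A"
    and \<mu>s: "\<And>j. j \<in> J \<Longrightarrow> (\<mu> j ^ s - 1) / of_nat p \<in> A"
    and inf: "infinite {n. (\<Sum>j\<in>J. c j * of_nat n ^ e j * \<mu> j ^ n) = 0}"
  shows "\<exists>r. \<forall>n. (\<Sum>j\<in>J. c j * of_nat (r + s * n) ^ e j * \<mu> j ^ (r + s * n)) = 0"
proof -
  define u where "u n = (\<Sum>j\<in>J. c j * of_nat n ^ e j * \<mu> j ^ n)" for n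
  obtain r where r: "infinite {n. u n = 0 \<and> n mod s = r}"
  proof -
    have "{n. u n = 0} = (\<Union>r<s. {n. u n = 0 \<and> n mod s = r})"
      using \<open>s > 0\<close> by auto
    moreover have "infinite {n. u n = 0}" using inf by (simp add: u_def)
    ultimately have "\<not> (\<forall>r\<in>{..<s}. finite {n. u n = 0 \<and> n mod s = r})"
      by (metis (no_types, lifting) finite_UN_I finite_lessThan)
    then show ?thesis using that by blast
  qed
  define E where "E = Max (insert 0 (e ` J))"
  have E: "e j \<le> E" if "j \<in> J" for j
    using \<open>finite J\<close> that unfolding E_def by (intro Max_ge) auto
  \<comment> \<open>each factor $n$ costs a factor $p$, which is balanced below by multiplying everything with $p^E$\<close>
  have newton: "newton_series (\<lambda>n. (of_nat p * of_nat (r + s * n)) ^ k * b n)"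
    if "newton_series b" for k b
  proof (induction k)
    case (Suc k)
    let ?b = "\<lambda>n. (of_nat p * of_nat (r + s * n)) ^ k * b n"
    have "newton_series (\<lambda>n. of_nat (p * r) * ?b n + of_nat s * (of_nat p * of_nat n * ?b n))"
      by (intro newton_series_add newton_series_scale newton_series_times_index Suc of_nat_mem)
    then show ?case by (simp add: algebra_simps)
  qed (use that in simp)
  define x where "x j = (\<mu> j ^ s - 1) / of_nat p" for j
  have \<mu>x: "\<mu> j ^ (s * n) = (1 + of_nat p * x j) ^ n" for j n
    by (simp add: x_def power_mult)
  define b where "b n = (\<Sum>j\<in>J. (c j * \<mu> j ^ r * of_nat p ^ (E - e j)) *
      ((of_nat p * of_nat (r + s * n)) ^ e j * (1 + of_nat p * x j) ^ n))" for n
  have "newton_series b" unfolding b_def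
    by (intro newton_series_sum newton_series_scale newton newton_series_power mult_mem power_mem
        of_nat_mem c \<mu>) (auto simp: x_def \<mu>s)
  moreover have b: "b n = of_nat p ^ E * u (r + s * n)" for n
    unfolding b_def u_def sum_distrib_left
  proof (intro sum.cong refl)
    fix j assume "j \<in> J"
    have "of_nat p ^ E = (of_nat p ^ (E - e j) * of_nat p ^ e j :: complex)"
      using E[OF \<open>j \<in> J\<close>] by (simp flip: power_add)
    then show "c j * \<mu> j ^ r * of_nat p ^ (E - e j) *
         ((of_nat p * of_nat (r + s * n)) ^ e j * (1 + of_nat p * x j) ^ n) =
         of_nat p ^ E * (c j * of_nat (r + s * n) ^ e j * \<mu> j ^ (r + s * n))"
      unfolding power_add power_mult_distrib \<mu>x[symmetric] by (simp only: mult_ac)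
  qed
  moreover have "infinite {n. b n = 0}"
  proof
    assume fin: "finite {n. b n = 0}"
    have "{n. u n = 0 \<and> n mod s = r} \<subseteq> (\<lambda>n. r + s * n) ` {n. b n = 0}"
    proof
      fix n assume n: "n \<in> {n. u n = 0 \<and> n mod s = r}"
      then have n': "u n = 0" "n mod s = r" by simp_all
      define m where "m = n div s"
      have m: "n = r + s * m"
        using n'(2) mult_div_mod_eq[of s n] by (metis add.commute m_def)
      moreover have "b m = 0" using n'(1) unfolding m b by simp
      ultimately show "n \<in> (\<lambda>n. r + s * n) ` {n. b n = 0}" by blast
    qed
    then show False using fin r finite_surj by blast
  qed
  ultimately have "b n = 0" for n by (intro newton_series_infinitely_many_zeros)
  then have "u (r + s * n) = 0" for n using b[of n] by simp
  then show ?thesis unfolding u_def by blast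
qed

end

section \<open>The Gauss valuation ring of a transcendental number\<close>

definition int_eval :: "int poly \<Rightarrow> complex \<Rightarrow> complex" where
  "int_eval g x = poly (map_poly of_int g) x"

lemma int_eval_0 [simp]: "int_eval 0 x = 0"
  by (simp add: int_eval_def)

lemma int_eval_pCons [simp]: "int_eval (pCons a g) x = of_int a + x * int_eval g x"
  by (simp add: int_eval_def map_poly_pCons)

lemma int_eval_1 [simp]: "int_eval 1 x = 1"
  by (simp add: one_pCons)

lemma int_eval_add [simp]: "int_eval (f + g) x = int_eval f x + int_eval g x"
  by (induction f g rule: poly_induct2) (auto simp: algebra_simps)

lemma int_eval_smult [simp]: "int_eval (smult a g) x = of_int a * int_eval g x"
  by (induction g) (auto simp: algebra_simps)

lemma int_eval_mult [simp]: "int_eval (f * g) x = int_eval f x * int_eval g x"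
  by (induction f) (auto simp: algebra_simps)

lemma int_eval_minus [simp]: "int_eval (- g) x = - int_eval g x"
  by (induction g) auto

lemma int_eval_diff [simp]: "int_eval (f - g) x = int_eval f x - int_eval g x"
  using int_eval_add[of f "- g"] by simp

lemma int_eval_prod [simp]: "int_eval (\<Prod>i\<in>I. f i) x = (\<Prod>i\<in>I. int_eval (f i) x)"
  by (induction I rule: infinite_finite_induct) auto

lemma int_eval_pcompose [simp]: "int_eval (pcompose g h) x = int_eval g (int_eval h x)"
  by (induction g) (auto simp: pcompose_pCons)

lemma int_eval_nonzero:
  assumes "\<not> algebraic \<tau>" "g \<noteq> 0" shows "int_eval g \<tau> \<noteq> 0"
proof
  assume "int_eval g \<tau> = 0"
  moreover have "map_poly complex_of_int g \<noteq> 0"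
    using assms(2) by (auto simp: map_poly_eq_0_iff)
  ultimately have "algebraic \<tau>"
    by (intro algebraicI[of "map_poly of_int g"]) (auto simp: coeff_map_poly int_eval_def)
  then show False using assms(1) by simp
qed

text \<open>
Algebraic numbers are the roots of countably many polynomials, enumerated by integer lists.
\<close>

lemma exists_not_algebraic: "\<exists>t::complex. \<not> algebraic t"
proof -
  let ?P = "\<lambda>l. map_poly complex_of_int (Poly l)"
  have "{x::complex. algebraic x} \<subseteq> (\<Union>l\<in>{l. ?P l \<noteq> 0}. {x. poly (?P l) x = 0})"
  proof
    fix x :: complex assume "x \<in> {x. algebraic x}"
    then obtain q where q: "\<And>i. coeff q i \<in> \<int>" "q \<noteq> 0" "poly q x = 0"
      by (auto simp: algebraic_def)
    have "map_poly of_int (map_poly floor (map_poly Re q)) = q"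
    proof (rule poly_eqI)
      fix i
      from q(1)[of i] obtain n where "coeff q i = of_int n" by (auto elim: Ints_cases)
      then show "coeff (map_poly of_int (map_poly floor (map_poly Re q))) i = coeff q i"
        by (simp add: coeff_map_poly)
    qed
    then have "?P (coeffs (map_poly floor (map_poly Re q))) = q" by simp
    then show "x \<in> (\<Union>l\<in>{l. ?P l \<noteq> 0}. {x. poly (?P l) x = 0})"
      using q by (intro UN_I[of "coeffs (map_poly floor (map_poly Re q))"]) auto
  qed
  moreover have "countable (\<Union>l\<in>{l. ?P l \<noteq> 0}. {x. poly (?P l) x = 0})"
    by (intro countable_UN) (auto intro!: countable_finite poly_roots_finite)
  ultimately have "countable {x::complex. algebraic x}" by (rule countable_subset)
  then show ?thesis using uncountable_UNIV_complex
    by (metis (mono_tags, lifting) UNIV_eq_I mem_Collect_eq)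
qed

lemma int_eq_0_if_power_dvd:
  fixes c p :: int assumes "p \<ge> 2" "\<And>k. p ^ k dvd c" shows "c = 0"
proof (rule ccontr)
  assume "c \<noteq> 0"
  have "p ^ nat \<bar>c\<bar> \<le> \<bar>c\<bar>"
    using assms(2)[of "nat \<bar>c\<bar>"] \<open>c \<noteq> 0\<close> zdvd_imp_le[of "p ^ nat \<bar>c\<bar>" "\<bar>c\<bar>"] by simp
  moreover have "\<bar>c\<bar> < 2 ^ nat \<bar>c\<bar>"
    using of_nat_less_two_power[of "nat \<bar>c\<bar>", where 'a = int] by simp
  moreover have "(2::int) ^ nat \<bar>c\<bar> \<le> p ^ nat \<bar>c\<bar>"
    using assms(1) by (intro power_mono) auto
  ultimately show False by linarith
qed

text \<open>
The valuation ring in $\mathbb{Q}(\tau)$ of the Gauss valuation: the $p$-adic valuation of $\mathbb{Q}$,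
extended by giving a polynomial in $\tau$ the least valuation of its coefficients. When $\tau$ is
transcendental, polynomials with integer coefficients and their values at $\tau$ may be identified.
\<close>

definition gauss_valuation_ring :: "complex \<Rightarrow> nat \<Rightarrow> complex set" where
  "gauss_valuation_ring \<tau> p =
    {x. \<exists>g h. x = int_eval g \<tau> / int_eval h \<tau> \<and> \<not> [:int p:] dvd h}"

lemma gauss_valuation_ringI:
  "x = int_eval g \<tau> / int_eval h \<tau> \<Longrightarrow> \<not> [:int p:] dvd h \<Longrightarrow> x \<in> gauss_valuation_ring \<tau> p"
  unfolding gauss_valuation_ring_def by blast

text \<open>
Closure under products and separatedness are both Gauss's lemma: $p$ is a prime element of
$\mathbb{Z}[X]$, hence a power of $p$ that divides $g h$ divides $g$ whenever $p$ does not divide $h$.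
\<close>

lemma gauss_valuation_ring_padic_ring:
  assumes \<tau>: "\<not> algebraic \<tau>" and p: "prime p" "p \<ge> 3"
  shows "padic_ring (gauss_valuation_ring \<tau> p) p"
proof
  have pe: "prime_elem [:int p:]"
    using p by (intro lift_prime_elem_poly) simp
  have nz: "int_eval h \<tau> \<noteq> 0" if "\<not> [:int p:] dvd h" for h
    by (rule int_eval_nonzero[OF \<tau>]) (use that in \<open>metis dvd_0_right\<close>)
  have mul: "\<not> [:int p:] dvd h * h'" if "\<not> [:int p:] dvd h" "\<not> [:int p:] dvd h'" for h h'
    using that pe prime_elem_dvd_mult_iff by blast
  have unit: "\<not> [:int p:] dvd 1"
    using pe prime_elem_def by blast
  show "prime p" "3 \<le> p" using p by auto
  show "1 \<in> gauss_valuation_ring \<tau> p"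
    using unit by (intro gauss_valuation_ringI[of _ 1 _ 1]) auto
  show "x - y \<in> gauss_valuation_ring \<tau> p" "x * y \<in> gauss_valuation_ring \<tau> p"
    if xy: "x \<in> gauss_valuation_ring \<tau> p" "y \<in> gauss_valuation_ring \<tau> p" for x y
  proof -
    obtain g h g' h' where x: "x = int_eval g \<tau> / int_eval h \<tau>" "\<not> [:int p:] dvd h"
      and y: "y = int_eval g' \<tau> / int_eval h' \<tau>" "\<not> [:int p:] dvd h'"
      using xy unfolding gauss_valuation_ring_def by blast
    show "x - y \<in> gauss_valuation_ring \<tau> p"
      by (rule gauss_valuation_ringI[OF _ mul[OF x(2) y(2)], of _ "g * h' - g' * h"])
         (use x y nz in \<open>simp add: diff_frac_eq\<close>)
    show "x * y \<in> gauss_valuation_ring \<tau> p"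
      by (rule gauss_valuation_ringI[OF _ mul[OF x(2) y(2)], of _ "g * g'"])
         (use x y in simp)
  qed
  show "1 / of_nat q \<in> gauss_valuation_ring \<tau> p" if "\<not> p dvd q" for q
  proof (rule gauss_valuation_ringI)
    show "1 / of_nat q = int_eval 1 \<tau> / int_eval [:int q:] \<tau>" by simp
    show "\<not> [:int p:] dvd [:int q:]" using that by simp
  qed
  show "x = 0" if x: "\<And>k. x / of_nat p ^ k \<in> gauss_valuation_ring \<tau> p" for x
  proof -
    from x[of 0] obtain g h where gh: "x = int_eval g \<tau> / int_eval h \<tau>" "\<not> [:int p:] dvd h"
      unfolding gauss_valuation_ring_def by auto
    have "int p ^ k dvd coeff g i" for k i
    proof -
      from x[of k] obtain g' h'
        where k: "x / of_nat p ^ k = int_eval g' \<tau> / int_eval h' \<tau>" "\<not> [:int p:] dvd h'"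
        unfolding gauss_valuation_ring_def by auto
      have "int_eval (g * h') \<tau> = of_nat p ^ k * int_eval (g' * h) \<tau>"
        using k(1) gh(1) nz[OF k(2)] nz[OF gh(2)] p by (simp add: field_simps)
      then have "int_eval (g * h' - smult (int p ^ k) (g' * h)) \<tau> = 0" by simp
      then have "g * h' - smult (int p ^ k) (g' * h) = 0"
        using int_eval_nonzero[OF \<tau>] by blast
      then have "g * h' = [:int p:] ^ k * (g' * h)" by (simp add: poly_const_pow)
      then have "[:int p:] ^ k dvd g * h'" by (metis dvd_triv_left)
      moreover have "coprime ([:int p:] ^ k) h'"
        using prime_elem_imp_coprime[OF pe k(2)] by (simp add: coprime_power_left_iff)
      ultimately have "[:int p:] ^ k dvd g" by (simp add: coprime_dvd_mult_left_iff)
      then show ?thesis by (simp add: poly_const_pow const_poly_dvd_iff)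
    qed
    then have "coeff g i = 0" for i
      using int_eq_0_if_power_dvd[of "int p"] p by simp
    then have "g = 0" by (simp add: poly_eq_iff)
    then show ?thesis using gh by simp
  qed
qed

section \<open>Finite and polynomial extensions of separated rings\<close>

text \<open>
The $A$-module generated by the first \<open>m\<close> values of \<open>e\<close>; these need not be independent.
\<close>

definition combinations :: "complex set \<Rightarrow> nat \<Rightarrow> (nat \<Rightarrow> complex) \<Rightarrow> complex set" where
  "combinations A m e = {y. \<exists>c. (\<forall>j. c j \<in> A) \<and> y = (\<Sum>j<m. c j * e j)}"

context padic_ring
begin

lemma combinations_0: "combinations A 0 e = {0}"
  by (auto simp: combinations_def intro: exI[of _ "\<lambda>_. 0"])

lemma combinations_Suc: "y \<in> combinations A (Suc m) e \<longleftrightarrow> (\<exists>z a. z \<in> combinations A m e \<and> a \<in> A \<and> y = z + a * e m)"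
proof
  assume "y \<in> combinations A (Suc m) e"
  then show "\<exists>z a. z \<in> combinations A m e \<and> a \<in> A \<and> y = z + a * e m"
    unfolding combinations_def by auto
next
  assume "\<exists>z a. z \<in> combinations A m e \<and> a \<in> A \<and> y = z + a * e m"
  then obtain c a where "\<forall>j. c j \<in> A" "a \<in> A" "y = (\<Sum>j<m. c j * e j) + a * e m"
    unfolding combinations_def by auto
  then show "y \<in> combinations A (Suc m) e"
    unfolding combinations_def by (auto intro!: exI[of _ "c(m := a)"])
qed

lemma combinations_diff: "y \<in> combinations A m e \<Longrightarrow> z \<in> combinations A m e \<Longrightarrow> y - z \<in> combinations A m e"
  unfolding combinations_def
proof clarify
  fix c c' :: "nat \<Rightarrow> complex" assume "\<forall>j. c j \<in> A" "\<forall>j. c' j \<in> A"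
  then show "\<exists>d. (\<forall>j. d j \<in> A) \<and>
      (\<Sum>j<m. c j * e j) - (\<Sum>j<m. c' j * e j) = (\<Sum>j<m. d j * e j)"
    by (intro exI[of _ "\<lambda>j. c j - c' j"]) (auto simp: algebra_simps sum_subtractf diff_mem)
qed

lemma combinations_scale: "y \<in> combinations A m e \<Longrightarrow> a \<in> A \<Longrightarrow> a * y \<in> combinations A m e"
  unfolding combinations_def
proof clarify
  fix c :: "nat \<Rightarrow> complex" assume "\<forall>j. c j \<in> A" "a \<in> A"
  then show "\<exists>d. (\<forall>j. d j \<in> A) \<and> a * (\<Sum>j<m. c j * e j) = (\<Sum>j<m. d j * e j)"
    by (intro exI[of _ "\<lambda>j. a * c j"]) (auto simp: sum_distrib_left mult_ac mult_mem)
qed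

lemma combinations_zero: "0 \<in> combinations A m e"
  unfolding combinations_def by (auto intro: exI[of _ "\<lambda>_. 0"])

lemma combinations_add: "y \<in> combinations A m e \<Longrightarrow> z \<in> combinations A m e \<Longrightarrow> y + z \<in> combinations A m e"
  using combinations_diff[of y m e "- z"] combinations_diff[OF combinations_zero, of z m e] by simp

lemma combinations_sum: "(\<And>i. i \<in> I \<Longrightarrow> f i \<in> combinations A m e) \<Longrightarrow> sum f I \<in> combinations A m e"
  by (induction I rule: infinite_finite_induct) (auto intro: combinations_add combinations_zero)

lemma combinations_base:
  assumes "j < m" shows "e j \<in> combinations A m e"
proof -
  have "e j = (\<Sum>i<m. (if i = j then 1 else 0) * e i)"
    using assms by (simp add: if_distrib[of "\<lambda>x. x * _"] cong: if_cong)
  then show ?thesis unfolding combinations_def using one_mem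
    by (auto intro!: exI[of _ "\<lambda>i. if i = j then 1 else 0"])
qed

text \<open>
Finitely generated modules inherit separatedness. Either a nonzero multiple $D e_m$ of the last
generator lies in the module of the others, and then multiplication by $D$ reduces to fewer
generators; or the coefficient of $e_m$ is unique, so it is divisible by all powers of $p$, hence $0$.
\<close>

lemma combinations_separated: "(\<And>k. y / of_nat p ^ k \<in> combinations A m e) \<Longrightarrow> y = 0"
proof (induction m arbitrary: y)
  case 0
  from 0[of 0] show ?case by (simp add: combinations_0)
next
  case (Suc m)
  show ?case
  proof (cases "\<exists>D. D \<in> A \<and> D \<noteq> 0 \<and> D * e m \<in> combinations A m e")
    case True
    then obtain D where D: "D \<in> A" "D \<noteq> 0" "D * e m \<in> combinations A m e" by blast
    have "D * y / of_nat p ^ k \<in> combinations A m e" for k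
    proof -
      obtain z a where za: "z \<in> combinations A m e" "a \<in> A" "y / of_nat p ^ k = z + a * e m"
        using Suc.prems[of k] combinations_Suc by blast
      have "D * y / of_nat p ^ k = D * (z + a * e m)"
        by (simp flip: za(3))
      also have "\<dots> = D * z + a * (D * e m)" by (simp add: algebra_simps)
      finally show ?thesis using combinations_add[OF combinations_scale[OF za(1) D(1)] combinations_scale[OF D(3) za(2)]]
        by simp
    qed
    from Suc.IH[OF this] D show ?thesis by simp
  next
    case False
    have "\<forall>k. \<exists>z a. z \<in> combinations A m e \<and> a \<in> A \<and> y / of_nat p ^ k = z + a * e m"
      using Suc.prems combinations_Suc by blast
    then obtain z a where za: "\<And>k. z k \<in> combinations A m e" "\<And>k. a k \<in> A"
      "\<And>k. y / of_nat p ^ k = z k + a k * e m" by metis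
    \<comment> \<open>otherwise the difference would be a nonzero $D$ with $D e_m$ in the smaller module\<close>
    have a: "a l = of_nat p ^ k * a (l + k)" for k l
    proof -
      have "z l + a l * e m = of_nat p ^ k * (z (l + k) + a (l + k) * e m)"
        unfolding za(3)[symmetric] by (simp add: power_add)
      then have "(a l - of_nat p ^ k * a (l + k)) * e m = of_nat p ^ k * z (l + k) - z l"
        by (simp add: algebra_simps)
      moreover have "of_nat p ^ k * z (l + k) - z l \<in> combinations A m e"
        by (intro combinations_diff combinations_scale za power_mem of_nat_mem)
      ultimately have "\<not> (a l - of_nat p ^ k * a (l + k) \<noteq> 0)"
        using False by (metis za(2) diff_mem mult_mem power_mem of_nat_mem)
      then show ?thesis by simp
    qed
    have "a l = 0" for l
    proof (rule separated)
      show "a l / of_nat p ^ k \<in> A" for k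
        using a[of l k] za(2)[of "l + k"] by simp
    qed
    then have "y / of_nat p ^ k \<in> combinations A m e" for k using za(1,3)[of k] by simp
    then show ?thesis by (rule Suc.IH)
  qed
qed

context
  fixes x :: complex and m :: nat
  assumes m: "m > 0" and xm: "x ^ m \<in> combinations A m ((^) x)"
begin

lemma integral_extension_times: "y \<in> combinations A m ((^) x) \<Longrightarrow> x * y \<in> combinations A m ((^) x)"
proof -
  assume "y \<in> combinations A m ((^) x)"
  then obtain c where c: "\<And>j. c j \<in> A" "y = (\<Sum>j<m. c j * x ^ j)"
    unfolding combinations_def by auto
  have "x * y = (\<Sum>j<m. c j * x ^ Suc j)"
    by (simp add: c(2) sum_distrib_left mult_ac)
  moreover have "x ^ Suc j \<in> combinations A m ((^) x)" if "j < m" for j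
  proof (cases "Suc j = m")
    case True then show ?thesis using xm by simp
  next
    case False then show ?thesis using combinations_base[of "Suc j" m "\<lambda>j. x ^ j"] that by simp
  qed
  ultimately show ?thesis using c(1) by (auto intro!: combinations_sum combinations_scale simp del: power_Suc)
qed

lemma integral_extension_power: "y \<in> combinations A m ((^) x) \<Longrightarrow> x ^ k * y \<in> combinations A m ((^) x)"
  by (induction k) (auto simp: mult.assoc integral_extension_times)

lemma integral_extension_const: "a \<in> A \<Longrightarrow> a \<in> combinations A m ((^) x)"
  using combinations_scale[OF combinations_base[OF m], of a "\<lambda>j. x ^ j"] by simp

lemma integral_extension_gen: "x \<in> combinations A m ((^) x)"
  using integral_extension_times[OF integral_extension_const[OF one_mem]] by simp

text \<open>
If $x^m$ is a combination of lower powers, then \<open>A[x]\<close> is the module generated by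
$1, x, \dots, x^{m-1}$, and \<open>combinations_separated\<close> applies.
\<close>

lemma integral_extension_padic_ring: "padic_ring (combinations A m ((^) x)) p"
proof
  show "prime p" "3 \<le> p" by (fact prime_p p_ge_3)+
  show "1 \<in> combinations A m ((^) x)" by (rule integral_extension_const[OF one_mem])
  show "y - z \<in> combinations A m ((^) x)"
    if "y \<in> combinations A m ((^) x)" "z \<in> combinations A m ((^) x)" for y z
    using that by (rule combinations_diff)
  show "y * z \<in> combinations A m ((^) x)"
    if y: "y \<in> combinations A m ((^) x)" and z: "z \<in> combinations A m ((^) x)" for y z
  proof -
    from y obtain c where c: "\<And>j. c j \<in> A" "y = (\<Sum>j<m. c j * x ^ j)"
      unfolding combinations_def by auto
    have "y * z = (\<Sum>j<m. c j * (x ^ j * z))"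
      by (simp add: c(2) sum_distrib_right mult.assoc)
    then show ?thesis using c(1) z
      by (auto intro!: combinations_sum combinations_scale integral_extension_power)
  qed
  show "1 / of_nat q \<in> combinations A m ((^) x)" if "\<not> p dvd q" for q
    using inverse_mem[OF that] by (rule integral_extension_const)
  show "y = 0" if "\<And>k. y / of_nat p ^ k \<in> combinations A m ((^) x)" for y
    using that by (rule combinations_separated)
qed

end

text \<open>
Over a transcendental element, divisibility by $p^k$ can be read off from the coefficients.
\<close>

lemma polynomial_extension_padic_ring:
  assumes "\<And>q. (\<And>i. coeff q i \<in> A) \<Longrightarrow> poly q x = 0 \<Longrightarrow> q = 0"
  shows "padic_ring {poly q x |q. \<forall>i. coeff q i \<in> A} p" (is "padic_ring ?B p")
proof
  have const: "a \<in> ?B" if "a \<in> A" for a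
    using that by (intro CollectI exI[of _ "[:a:]"]) (auto simp: coeff_pCons split: nat.split)
  show "prime p" "3 \<le> p" by (fact prime_p p_ge_3)+
  show "1 \<in> ?B" by (rule const[OF one_mem])
  show "1 / of_nat q \<in> ?B" if "\<not> p dvd q" for q
    by (rule const[OF inverse_mem[OF that]])
  show "y - z \<in> ?B" "y * z \<in> ?B" if "y \<in> ?B" "z \<in> ?B" for y z
  proof -
    from that obtain q q' where "\<forall>i. coeff q i \<in> A" "\<forall>i. coeff q' i \<in> A"
      "y = poly q x" "z = poly q' x" by blast
    moreover from this have "\<forall>i. coeff (q - q') i \<in> A" "\<forall>i. coeff (q * q') i \<in> A"
      by (auto simp: coeff_mult intro!: diff_mem mult_mem sum_mem)
    moreover have "y - z = poly (q - q') x" "y * z = poly (q * q') x"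
      using calculation by simp_all
    ultimately show "y - z \<in> ?B" "y * z \<in> ?B" by blast+
  qed
  show "y = 0" if y: "\<And>k. y / of_nat p ^ k \<in> ?B" for y
  proof -
    from y[of 0] obtain q where q: "y = poly q x" "\<And>i. coeff q i \<in> A" by auto
    have "coeff q i = 0" for i
    proof (rule separated)
      fix k
      from y[of k] obtain q' where q': "y / of_nat p ^ k = poly q' x" "\<And>i. coeff q' i \<in> A" by auto
      have "poly (q - smult (of_nat p ^ k) q') x = 0"
        using q' q by (simp flip: q'(1))
      moreover have "coeff (q - smult (of_nat p ^ k) q') i \<in> A" for i
        by (auto intro!: diff_mem mult_mem power_mem q q')
      ultimately have "q - smult (of_nat p ^ k) q' = 0" using assms by blast
      then have "coeff q i = of_nat p ^ k * coeff q' i"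
        by (metis coeff_smult eq_iff_diff_eq_0)
      then show "coeff q i / of_nat p ^ k \<in> A" using q'(2) by simp
    qed
    then have "q = 0" by (simp add: poly_eq_iff)
    then show ?thesis using q by simp
  qed
qed

lemma unit_power_cong_1_mult:
  assumes "x \<in> A" "(x ^ s - 1) / of_nat p \<in> A"
  shows "(x ^ (s * n) - 1) / of_nat p \<in> A"
proof (induction n)
  case (Suc n)
  have "(x ^ (s * Suc n) - 1) / of_nat p =
      x ^ s * ((x ^ (s * n) - 1) / of_nat p) + (x ^ s - 1) / of_nat p"
    by (simp add: power_add field_simps)
  then show ?case using Suc assms by (simp only:) (intro add_mem mult_mem power_mem)
qed simp

text \<open>
The hypothesis on \<open>x\<close> says that modulo $p$ it satisfies a monic equation with integer coefficients.
Hence every power of \<open>x\<close> is congruent to one of the finitely many sums $\sum_{j < m} w_j x^j$ with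
$0 \le w_j < p$. Two powers must be congruent to the same sum, and \<open>x\<close> is a unit.
\<close>

lemma unit_power_cong_1:
  assumes "m > 0" and xm: "x ^ m = (\<Sum>j<m. (of_int (z j) + of_nat p * b j) * x ^ j)"
    and b: "\<And>j. b j \<in> A" and x: "x \<in> A" "1 / x \<in> A" "x \<noteq> 0"
  shows "\<exists>s>0. (x ^ s - 1) / of_nat p \<in> A"
proof -
  define I where "I = {y. \<exists>w::nat \<Rightarrow> int. (y - (\<Sum>j<m. of_int (w j) * x ^ j)) / of_nat p \<in> A}"
  have I_add: "y + y' \<in> I" if "y \<in> I" "y' \<in> I" for y y'
  proof -
    from that obtain w w' where "(y - (\<Sum>j<m. of_int (w j) * x ^ j)) / of_nat p \<in> A"
       "(y' - (\<Sum>j<m. of_int (w' j) * x ^ j)) / of_nat p \<in> A" unfolding I_def by blast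
    from add_mem[OF this] show ?thesis unfolding I_def
      by (intro CollectI exI[of _ "\<lambda>j. w j + w' j"])
         (simp add: distrib_right sum.distrib algebra_simps diff_divide_distrib add_divide_distrib)
  qed
  have I_scale: "of_int a * y \<in> I" if "y \<in> I" for y a
  proof -
    from that obtain w where "(y - (\<Sum>j<m. of_int (w j) * x ^ j)) / of_nat p \<in> A"
      unfolding I_def by blast
    from mult_mem[OF of_int_mem[of a] this] show ?thesis unfolding I_def
      by (intro CollectI exI[of _ "\<lambda>j. a * w j"])
         (simp add: right_diff_distrib sum_distrib_left mult_ac)
  qed
  have I_p: "of_nat p * y \<in> I" if "y \<in> A" for y
    unfolding I_def using that by (intro CollectI exI[of _ "\<lambda>_. 0"]) simp
  have I_zero: "0 \<in> I" using I_p[of 0] by simp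
  have I_sum: "sum f J \<in> I" if "\<And>j. j \<in> J \<Longrightarrow> f j \<in> I" for f and J :: "nat set"
    using that by (induction J rule: infinite_finite_induct) (auto intro: I_add I_zero)
  have I_base: "x ^ j \<in> I" if "j < m" for j
  proof -
    have "(\<Sum>i<m. of_int (if i = j then 1 else 0) * x ^ i) = x ^ j"
      using that by (simp add: if_distrib[of "\<lambda>x. of_int x * _"] cong: if_cong)
    then show ?thesis unfolding I_def
      by (intro CollectI exI[of _ "\<lambda>i. if i = j then 1 else 0"]) simp
  qed
  have I_m: "x ^ m \<in> I"
    unfolding xm
  proof (rule I_sum)
    fix j assume "j \<in> {..<m}"
    then have "of_int (z j) * x ^ j + of_nat p * (b j * x ^ j) \<in> I"
      using b x by (intro I_add I_scale I_p I_base mult_mem power_mem) auto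
    then show "(of_int (z j) + of_nat p * b j) * x ^ j \<in> I" by (simp add: algebra_simps)
  qed
  have I_times: "x * y \<in> I" if y: "y \<in> I" for y
  proof -
    from y obtain w where w: "(y - (\<Sum>j<m. of_int (w j) * x ^ j)) / of_nat p \<in> A"
      unfolding I_def by blast
    have "x ^ Suc j \<in> I" if "j < m" for j
      using I_base[of "Suc j"] I_m that by (cases "Suc j = m") (auto simp del: power_Suc)
    moreover define d where "d = (y - (\<Sum>j<m. of_int (w j) * x ^ j)) / of_nat p"
    ultimately have "(\<Sum>j<m. of_int (w j) * x ^ Suc j) + of_nat p * (x * d) \<in> I"
      using w by (intro I_add I_sum I_scale I_p mult_mem x) auto
    moreover have "y = (\<Sum>j<m. of_int (w j) * x ^ j) + of_nat p * d"
      by (simp add: d_def)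
    ultimately show ?thesis by (simp add: distrib_left sum_distrib_left mult_ac)
  qed
  have I_power: "x ^ k \<in> I" for k
    by (induction k) (use I_base[of 0] \<open>m > 0\<close> I_times in auto)
  have "\<exists>w. w \<in> {..<m} \<rightarrow>\<^sub>E {0..<int p} \<and>
      (x ^ k - (\<Sum>j<m. of_int (w j) * x ^ j)) / of_nat p \<in> A" for k
  proof -
    from I_power[of k] obtain w where w: "(x ^ k - (\<Sum>j<m. of_int (w j) * x ^ j)) / of_nat p \<in> A"
      unfolding I_def by blast
    define w' where "w' = (\<lambda>j\<in>{..<m}. w j mod int p)"
    have "(\<Sum>j<m. of_int (w j) * x ^ j) =
        (\<Sum>j<m. of_int (w' j) * x ^ j) + of_nat p * (\<Sum>j<m. of_int (w j div int p) * x ^ j)"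
      unfolding sum_distrib_left sum.distrib[symmetric]
    proof (intro sum.cong refl)
      fix j assume "j \<in> {..<m}"
      then have "w j = w' j + int p * (w j div int p)" by (simp add: w'_def)
      then have "(of_int (w j) :: complex) = of_int (w' j + int p * (w j div int p))" by (rule arg_cong)
      also have "\<dots> = of_int (w' j) + of_nat p * of_int (w j div int p)" by simp
      finally show "of_int (w j) * x ^ j =
          of_int (w' j) * x ^ j + of_nat p * (of_int (w j div int p) * x ^ j)"
        by (simp add: algebra_simps)
    qed
    then have "(x ^ k - (\<Sum>j<m. of_int (w' j) * x ^ j)) / of_nat p =
        (x ^ k - (\<Sum>j<m. of_int (w j) * x ^ j)) / of_nat p +
        (\<Sum>j<m. of_int (w j div int p) * x ^ j)"
      by (simp add: field_simps)
    moreover have "\<dots> \<in> A" by (intro add_mem w sum_mem mult_mem power_mem of_int_mem x)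
    moreover have "w' \<in> {..<m} \<rightarrow>\<^sub>E {0..<int p}" by (auto simp: w'_def)
    ultimately show ?thesis by metis
  qed
  then obtain w where w: "\<And>k. w k \<in> {..<m} \<rightarrow>\<^sub>E {0..<int p}"
    "\<And>k. (x ^ k - (\<Sum>j<m. of_int (w k j) * x ^ j)) / of_nat p \<in> A" by metis
  have "finite (w ` UNIV)"
    by (rule finite_subset[of _ "{..<m} \<rightarrow>\<^sub>E {0..<int p}"]) (use w(1) in \<open>auto intro: finite_PiE\<close>)
  then have "\<not> inj w" by (metis finite_imageD infinite_UNIV_nat)
  then obtain i k where ik: "i < k" "w i = w k"
    by (metis inj_on_def linorder_neqE_nat)
  have "(x ^ k - x ^ i) / of_nat p \<in> A"
    using diff_mem[OF w(2)[of k] w(2)[of i]] ik(2) by (simp flip: diff_divide_distrib)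
  moreover have "x ^ k = x ^ (k - i) * x ^ i" using ik(1) by (simp flip: power_add)
  ultimately have "(1 / x) ^ i * ((x ^ (k - i) * x ^ i - x ^ i) / of_nat p) \<in> A"
    using mult_mem[OF power_mem[OF x(2)]] by metis
  also have "(1 / x) ^ i * ((x ^ (k - i) * x ^ i - x ^ i) / of_nat p) = (x ^ (k - i) - 1) / of_nat p"
    using x(3) by (simp add: field_simps power_divide)
  finally show ?thesis using ik(1) by (intro exI[of _ "k - i"]) auto
qed

end

section \<open>A separated ring for two arbitrary numbers\<close>

text \<open>
Leading and constant coefficient are units of \<open>A\<close>, so \<open>x\<close> is an integral unit over \<open>A\<close>. The residues of
the coefficients modulo $p$ are integers, hence so are those of the monic equation, where the
inverse of the leading residue is taken by Bezout. This is the situation of \<open>unit_power_cong_1\<close>.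
\<close>

lemma (in padic_ring) adjoin_algebraic_unit:
  assumes "m > 0" and root: "(\<Sum>j\<le>m. a j * x ^ j) = 0"
    and a: "\<And>j. a j = of_int (z j) + of_nat p * b j" and b: "\<And>j. b j \<in> A"
    and am: "a m \<noteq> 0" "1 / a m \<in> A" "\<not> int p dvd z m" and a0: "a 0 \<noteq> 0" "1 / a 0 \<in> A"
  shows "\<exists>B. padic_ring B p \<and> A \<subseteq> B \<and> x \<in> B \<and> (\<exists>s>0. (x ^ s - 1) / of_nat p \<in> B)"
proof -
  have aA: "a j \<in> A" for j unfolding a by (intro add_mem mult_mem b of_nat_mem of_int_mem)
  have "x \<noteq> 0"
  proof
    assume "x = 0"
    then have "(\<Sum>j\<le>m. a j * x ^ j) = (\<Sum>j\<le>m. if j = 0 then a 0 else 0)"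
      by (intro sum.cong) auto
    then show False using root a0 by simp
  qed
  have "coprime (z m) (int p)"
    using am(3) prime_p by (simp add: coprime_commute prime_imp_coprime)
  then obtain w e where we: "w * z m + e * int p = 1"
    by (metis bezout_int coprime_imp_gcd_eq_1)
  \<comment> \<open>$w$ inverts the leading residue: the monic coefficient $- a_j / a_m$ has residue $- w z_j$, with quotient $b'_j$\<close>
  define b' where "b' j = - ((of_int (z j) * of_int e + b j - of_int (w * z j) * b m) * (1 / a m))" for j
  have b': "b' j \<in> A" for j unfolding b'_def
    by (intro uminus_mem mult_mem add_mem diff_mem b am of_int_mem)
  have coeff: "- a j / a m = of_int (- (w * z j)) + of_nat p * b' j" for j
  proof -
    have "(of_int (w * z m + e * int p) :: complex) = 1" unfolding we by simp
    then have e: "of_nat p * of_int e = 1 - of_int w * (of_int (z m) :: complex)"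
      by (simp add: algebra_simps)
    have "(of_int (- (w * z j)) + of_nat p * b' j) * a m =
      of_int (- (w * z j)) * a m - (of_int (z j) * (of_nat p * of_int e) + of_nat p * b j
        - of_nat p * of_int (w * z j) * b m)"
      using am(1) unfolding b'_def by (simp add: field_simps)
    also have "\<dots> = - a j"
      unfolding e a[of m] a[of j] by (simp add: algebra_simps)
    finally show ?thesis using am(1) by (simp add: field_simps)
  qed
  have "x ^ m = (\<Sum>j<m. (- a j / a m) * x ^ j)"
  proof -
    have "a m * x ^ m = - (\<Sum>j<m. a j * x ^ j)"
      using root by (simp add: lessThan_Suc_atMost[symmetric] add_eq_0_iff)
    then have "x ^ m = - (\<Sum>j<m. a j * x ^ j) / a m"
      using am(1) by (simp add: field_simps)
    then show ?thesis by (simp add: sum_divide_distrib sum_negf)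
  qed
  then have xm: "x ^ m = (\<Sum>j<m. (of_int (- (w * z j)) + of_nat p * b' j) * x ^ j)"
    unfolding coeff .
  then have xm': "x ^ m \<in> combinations A m ((^) x)"
    unfolding combinations_def
    by (intro CollectI exI[of _ "\<lambda>j. of_int (- (w * z j)) + of_nat p * b' j"] conjI allI)
       (intro add_mem mult_mem of_int_mem of_nat_mem b')
  note ext = \<open>m > 0\<close> xm'
  interpret B: padic_ring "combinations A m ((^) x)" p by (rule integral_extension_padic_ring[OF ext])
  have x: "x \<in> combinations A m ((^) x)" by (rule integral_extension_gen[OF ext])
  have "1 / x = (- (1 / a 0)) * (\<Sum>j<m. a (Suc j) * x ^ j)"
  proof -
    obtain m' where m': "m = Suc m'" using \<open>m > 0\<close> by (cases m) auto
    have "a 0 + x * (\<Sum>j<m. a (Suc j) * x ^ j) = (\<Sum>j\<le>m. a j * x ^ j)"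
      unfolding m' sum.atMost_Suc_shift by (simp add: sum_distrib_left mult_ac lessThan_Suc_atMost)
    then have "x * (\<Sum>j<m. a (Suc j) * x ^ j) = - a 0"
      using root by (simp add: add_eq_0_iff)
    then show ?thesis using a0(1) \<open>x \<noteq> 0\<close> by (simp add: field_simps)
  qed
  then have "1 / x \<in> combinations A m ((^) x)"
    using aA by (auto simp only: intro!: combinations_scale combinations_sum uminus_mem a0 combinations_base)
  from B.unit_power_cong_1[OF \<open>m > 0\<close> xm integral_extension_const[OF ext b'] x this \<open>x \<noteq> 0\<close>]
  show ?thesis using x integral_extension_const[OF ext] B.padic_ring_axioms by blast
qed

text \<open>
For transcendental $t$ this is the field $\mathbb{Q}(t)$.
\<close>

definition rational_values :: "complex \<Rightarrow> complex set" where
  "rational_values t = {int_eval g t / int_eval h t |g h. h \<noteq> 0}"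

definition algebraic_over :: "complex \<Rightarrow> complex \<Rightarrow> bool" where
  "algebraic_over t x \<longleftrightarrow> (\<exists>q. q \<noteq> 0 \<and> (\<forall>i. coeff q i \<in> rational_values t) \<and> poly q x = 0)"

lemma rational_valuesI:
  "x = int_eval g t / int_eval h t \<Longrightarrow> h \<noteq> 0 \<Longrightarrow> x \<in> rational_values t"
  unfolding rational_values_def by blast

lemma rational_values_ring:
  assumes t: "\<not> algebraic t"
    and x: "x \<in> rational_values t" and y: "y \<in> rational_values t"
  shows "x + y \<in> rational_values t" "x * y \<in> rational_values t" "x / y \<in> rational_values t"
proof -
  from x y obtain g h g' h' where x: "x = int_eval g t / int_eval h t" "h \<noteq> 0"
    and y: "y = int_eval g' t / int_eval h' t" "h' \<noteq> 0"
    unfolding rational_values_def by blast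
  note nz = int_eval_nonzero[OF t]
  have I: "int_eval g t / int_eval h t \<in> rational_values t" if "h \<noteq> 0" for g h
    using that unfolding rational_values_def by blast
  have "x + y = int_eval (g * h' + g' * h) t / int_eval (h * h') t"
    using nz[OF x(2)] nz[OF y(2)] by (simp add: x y add_frac_eq)
  then show "x + y \<in> rational_values t"
    using I[of "h * h'" "g * h' + g' * h"] x(2) y(2) by simp
  have "x * y = int_eval (g * g') t / int_eval (h * h') t"
    by (simp add: x y)
  then show "x * y \<in> rational_values t"
    using I[of "h * h'" "g * g'"] x(2) y(2) by simp
  show "x / y \<in> rational_values t"
  proof (cases "g' = 0")
    case True
    then show ?thesis using I[of 1 0] by (simp add: y)
  next
    case False
    have "x / y = int_eval (g * h') t / int_eval (h * g') t"
      by (simp add: x y)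
    then show ?thesis using I[of "h * g'" "g * h'"] x(2) False by simp
  qed
qed

lemma rational_values_of_int: "of_int a \<in> rational_values t"
  by (rule rational_valuesI[of _ "[:a:]" _ 1]) auto

lemma rational_values_gen: "t \<in> rational_values t"
  by (rule rational_valuesI[of _ "[:0, 1:]" _ 1]) auto

lemma int_eval_closed:
  assumes "\<And>a. of_int a \<in> S" "\<And>u v. u \<in> S \<Longrightarrow> v \<in> S \<Longrightarrow> u + v \<in> S"
    "\<And>u v. u \<in> S \<Longrightarrow> v \<in> S \<Longrightarrow> u * v \<in> S" and "x \<in> S"
  shows "int_eval g x \<in> S"
  using assms by (induction g) (auto, metis of_int_0)

lemma coeff_mult_closed:
  fixes q r :: "'a::comm_ring_1 poly"
  assumes "0 \<in> S" "\<And>u v. u \<in> S \<Longrightarrow> v \<in> S \<Longrightarrow> u + v \<in> S"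
    "\<And>u v. u \<in> S \<Longrightarrow> v \<in> S \<Longrightarrow> u * v \<in> S"
    and "\<And>i. coeff q i \<in> S" "\<And>i. coeff r i \<in> S"
  shows "coeff (q * r) i \<in> S"
proof -
  have "(\<Sum>j\<in>J. coeff q j * coeff r (i - j)) \<in> S" for J
    by (induction J rule: infinite_finite_induct) (use assms in auto)
  then show ?thesis by (simp add: coeff_mult)
qed

lemma coeff_pcompose_closed:
  fixes q r :: "'a::comm_ring_1 poly"
  assumes "0 \<in> S" "\<And>u v. u \<in> S \<Longrightarrow> v \<in> S \<Longrightarrow> u + v \<in> S"
    "\<And>u v. u \<in> S \<Longrightarrow> v \<in> S \<Longrightarrow> u * v \<in> S"
    and "\<And>i. coeff q i \<in> S" "\<And>i. coeff r i \<in> S"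
  shows "coeff (pcompose q r) i \<in> S"
  using assms(4)
proof (induction q arbitrary: i)
  case 0
  then show ?case using assms(1) by simp
next
  case (pCons a q)
  have a: "a \<in> S" and q: "coeff q i \<in> S" for i
    using pCons.prems[of 0] pCons.prems[of "Suc i"] by simp_all
  have "coeff (r * pcompose q r) i \<in> S"
    by (rule coeff_mult_closed) (use assms pCons.IH q in auto)
  then show ?case using a assms(1,2) by (simp add: pcompose_pCons coeff_pCons split: nat.split)
qed

lemma not_algebraic_affine:
  fixes t :: complex
  assumes t: "\<not> algebraic t" and p: "p > 0"
  shows "\<not> algebraic ((t - of_int a) / of_nat p)"
proof
  assume "algebraic ((t - of_int a) / of_nat p)"
  then obtain q :: "complex poly" where q: "\<And>i. coeff q i \<in> \<rat>" "q \<noteq> 0" "poly q ((t - of_int a) / of_nat p) = 0"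
    by (auto simp: algebraic_altdef)
  define r :: "complex poly" where "r = [:- of_int a / of_nat p, 1 / of_nat p:]"
  have r: "coeff r i \<in> \<rat>" for i
    by (auto simp: r_def coeff_pCons split: nat.split)
  have "coeff (pcompose q r) i \<in> \<rat>" for i
    by (rule coeff_pcompose_closed) (use q(1) r in auto)
  moreover have "pcompose q r \<noteq> 0"
    using q(2) p by (auto simp: r_def dest!: pcompose_eq_0)
  moreover have "poly (pcompose q r) t = 0"
    using q(3) by (simp add: poly_pcompose r_def diff_divide_distrib)
  ultimately have "algebraic t" by (intro algebraicI') auto
  then show False using t by simp
qed

text \<open>
Denominators are cleared, and a power of \<open>x\<close> is cancelled so that the constant coefficient is nonzero.
Both extreme coefficients can then be made units at a suitable prime.
\<close>

lemma algebraic_over_integer_relation: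
  assumes t: "\<not> algebraic t" and "algebraic_over t x" and x: "x \<noteq> 0"
  obtains m g where "m > 0" "g m \<noteq> 0" "g 0 \<noteq> 0" "(\<Sum>j\<le>m. int_eval (g j) t * x ^ j) = 0"
proof -
  have "\<exists>q'. coeff q' 0 \<noteq> 0 \<and> (\<forall>i. coeff q' i \<in> rational_values t) \<and> poly q' x = 0"
    if "q \<noteq> 0" "\<forall>i. coeff q i \<in> rational_values t" "poly q x = 0" for q
    using that
  proof (induction q)
    case 0
    then show ?case by simp
  next
    case (pCons a q)
    show ?case
    proof (cases "a = 0")
      case True
      have "\<forall>i. coeff q i \<in> rational_values t"
      proof
        show "coeff q i \<in> rational_values t" for i
          using pCons.prems(2)[rule_format, of "Suc i"] by simp
      qed
      then show ?thesis using pCons x True by auto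
    next
      case False
      then show ?thesis using pCons.prems by (intro exI[of _ "pCons a q"]) auto
    qed
  qed
  then obtain q where q: "coeff q 0 \<noteq> 0" "\<And>i. coeff q i \<in> rational_values t" "poly q x = 0"
    using assms(2) unfolding algebraic_over_def by blast
  have "\<forall>i. \<exists>g h. h \<noteq> 0 \<and> coeff q i = int_eval g t / int_eval h t"
    using q(2) unfolding rational_values_def by blast
  then obtain G H where GH: "\<And>i. H i \<noteq> 0" "\<And>i. coeff q i = int_eval (G i) t / int_eval (H i) t"
    by metis
  define m where "m = degree q"
  define D where "D = (\<Prod>l\<le>m. H l)"
  define g where "g j = G j * (\<Prod>l\<in>{..m} - {j}. H l)" for j
  have D: "int_eval D t \<noteq> 0"
    using int_eval_nonzero[OF t] GH(1) by (simp add: D_def)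
  have g: "int_eval (g j) t = int_eval D t * coeff q j" if "j \<le> m" for j
  proof -
    have "D = H j * (\<Prod>l\<in>{..m} - {j}. H l)"
      unfolding D_def using that by (simp add: prod.remove)
    then show ?thesis using int_eval_nonzero[OF t GH(1)] by (simp add: g_def GH(2))
  qed
  have "m > 0"
  proof (rule ccontr)
    assume "\<not> m > 0"
    then obtain c where "q = [:c:]" unfolding m_def using degree_eq_zeroE by blast
    then show False using q by simp
  qed
  moreover have "g 0 \<noteq> 0" using g[of 0] D q(1) by auto
  moreover have "g m \<noteq> 0"
  proof -
    have "coeff q m \<noteq> 0" using q(1) unfolding m_def by (intro leading_coeff_neq_0) auto
    then show ?thesis using g[of m] D by auto
  qed
  moreover have "(\<Sum>j\<le>m. int_eval (g j) t * x ^ j) = int_eval D t * poly q x"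
    by (simp add: g poly_altdef m_def sum_distrib_left mult_ac)
  ultimately show thesis using that q(3) by simp
qed

lemma pcompose_affine_cong:
  "\<exists>q. pcompose g [:a, int p:] = [:poly g a:] + smult (int p) q"
proof (induction g)
  case 0
  show ?case by (intro exI[of _ 0]) simp
next
  case (pCons c g)
  then obtain q where q: "pcompose g [:a, int p:] = [:poly g a:] + smult (int p) q" by blast
  have "pcompose (pCons c g) [:a, int p:] =
      [:c:] + [:a, int p:] * ([:poly g a:] + smult (int p) q)"
    unfolding q[symmetric] by (rule pcompose_pCons)
  also have "\<dots> = [:poly (pCons c g) a:] + smult (int p) ([:0, poly g a:] + [:a, int p:] * q)"
    by (simp add: algebra_simps smult_add_right)
  finally show ?case by blast
qed

lemma exists_residue_prime:
  fixes g :: "int poly" assumes "g \<noteq> 0"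
  obtains a p where "prime p" "p \<ge> 3" "\<not> int p dvd poly g a"
proof -
  have "infinite (UNIV :: int set)" by (rule infinite_UNIV_int)
  then have "\<not> UNIV \<subseteq> {a. poly g a = 0}"
    using poly_roots_finite[OF assms] finite_subset by blast
  then obtain a where a: "poly g a \<noteq> 0" by blast
  obtain p where p: "prime p" "p > 3 + nat \<bar>poly g a\<bar>" using bigger_prime by blast
  have "\<not> int p dvd poly g a"
    using p(2) a dvd_imp_le_int[of "poly g a" "int p"] by auto
  then show thesis using p by (intro that[of p a]) auto
qed

text \<open>
Let $\alpha$ and $\delta$ be algebraic over $\mathbb{Q}(t)$. Choose an integer $a$ at which the leading and
constant coefficients of both equations do not vanish, a prime $p$ that divides none of these
values, and work in the Gauss valuation ring of $\tau = (t - a) / p$. There $t = a + p \tau$, so a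
polynomial in $t$ is congruent to its value at $a$: the extreme coefficients become units, and all
coefficients have integer residues. Now adjoin $\alpha$ and $\delta$ one after the other.
\<close>

lemma exists_padic_ring_algebraic:
  assumes t: "\<not> algebraic t" and "algebraic_over t \<alpha>" "algebraic_over t \<delta>"
    and "\<alpha> \<noteq> 0" "\<delta> \<noteq> 0"
  shows "\<exists>A p s. padic_ring A p \<and> s > 0 \<and> \<alpha> \<in> A \<and> \<delta> \<in> A \<and>
    (\<alpha> ^ s - 1) / of_nat p \<in> A \<and> (\<delta> ^ s - 1) / of_nat p \<in> A"
proof -
  obtain m g where g: "m > 0" "g m \<noteq> 0" "g 0 \<noteq> 0" "(\<Sum>j\<le>m. int_eval (g j) t * \<alpha> ^ j) = 0"
    using algebraic_over_integer_relation[OF t assms(2,4)] by blast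
  obtain n h where h: "n > 0" "h n \<noteq> 0" "h 0 \<noteq> 0" "(\<Sum>j\<le>n. int_eval (h j) t * \<delta> ^ j) = 0"
    using algebraic_over_integer_relation[OF t assms(3,5)] by blast
  have "g m * g 0 * h n * h 0 \<noteq> 0" using g h by simp
  then obtain a p where p: "prime p" "p \<ge> 3"
    and "\<not> int p dvd poly (g m * g 0 * h n * h 0) a"
    by (rule exists_residue_prime)
  then have ndvd: "\<not> int p dvd poly (g m) a" "\<not> int p dvd poly (g 0) a"
      "\<not> int p dvd poly (h n) a" "\<not> int p dvd poly (h 0) a"
    by auto
  define \<tau> where "\<tau> = (t - of_int a) / of_nat p"
  have \<tau>: "\<not> algebraic \<tau>" unfolding \<tau>_def using not_algebraic_affine[OF t] p by simp
  interpret A: padic_ring "gauss_valuation_ring \<tau> p" p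
    by (rule gauss_valuation_ring_padic_ring[OF \<tau> p])
  let ?A = "gauss_valuation_ring \<tau> p"
  have "\<exists>b. b \<in> ?A \<and> int_eval f t = of_int (poly f a) + of_nat p * b \<and>
      (\<not> int p dvd poly f a \<longrightarrow> 1 / int_eval f t \<in> ?A \<and> int_eval f t \<noteq> 0)" for f
  proof -
    obtain q where q: "pcompose f [:a, int p:] = [:poly f a:] + smult (int p) q"
      using pcompose_affine_cong by blast
    have "int_eval f t = int_eval (pcompose f [:a, int p:]) \<tau>"
      using p by (simp add: \<tau>_def)
    then have eq: "int_eval f t = int_eval ([:poly f a:] + smult (int p) q) \<tau>"
      unfolding q .
    have "int_eval q \<tau> = int_eval q \<tau> / int_eval 1 \<tau>" by simp
    then have "int_eval q \<tau> \<in> ?A"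
      by (rule gauss_valuation_ringI) (use p in \<open>simp add: one_pCons\<close>)
    moreover have "1 / int_eval f t \<in> ?A \<and> int_eval f t \<noteq> 0" if f: "\<not> int p dvd poly f a"
    proof -
      have nd: "\<not> [:int p:] dvd [:poly f a:] + smult (int p) q"
      proof
        assume "[:int p:] dvd [:poly f a:] + smult (int p) q"
        then have "int p dvd coeff ([:poly f a:] + smult (int p) q) 0"
          by (simp only: const_poly_dvd_iff)
        then have "int p dvd poly f a + int p * coeff q 0" by simp
        then show False using f by (simp add: dvd_add_left_iff)
      qed
      have "1 / int_eval f t \<in> ?A"
        by (rule gauss_valuation_ringI[OF _ nd, of _ 1]) (simp add: eq)
      moreover have "[:poly f a:] + smult (int p) q \<noteq> 0" using nd by (metis dvd_0_right)
      ultimately show ?thesis using int_eval_nonzero[OF \<tau>] eq by metis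
    qed
    ultimately show ?thesis using eq by (intro exI[of _ "int_eval q \<tau>"]) simp
  qed
  then obtain b where b: "\<And>f. b f \<in> ?A" "\<And>f. int_eval f t = of_int (poly f a) + of_nat p * b f"
    and unit: "\<And>f. \<not> int p dvd poly f a \<Longrightarrow> 1 / int_eval f t \<in> ?A"
      "\<And>f. \<not> int p dvd poly f a \<Longrightarrow> int_eval f t \<noteq> 0" by metis
  obtain B s where B: "padic_ring B p" "?A \<subseteq> B" "\<alpha> \<in> B" "s > 0" "(\<alpha> ^ s - 1) / of_nat p \<in> B"
    using A.adjoin_algebraic_unit[OF g(1,4) b(2) b(1)] unit ndvd by blast
  interpret B: padic_ring B p by fact
  obtain C r where C: "padic_ring C p" "B \<subseteq> C" "\<delta> \<in> C" "r > 0" "(\<delta> ^ r - 1) / of_nat p \<in> C"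
    using B.adjoin_algebraic_unit[OF h(1,4) b(2)] b(1) B(2) unit ndvd by blast
  interpret C: padic_ring C p by fact
  have "(\<alpha> ^ (s * r) - 1) / of_nat p \<in> C" "(\<delta> ^ (r * s) - 1) / of_nat p \<in> C"
    using B C by (auto intro!: C.unit_power_cong_1_mult)
  then show ?thesis using B C
    by (intro exI[of _ C], rule_tac exI[of _ p], rule_tac exI[of _ "s * r"])
       (auto simp: mult.commute)
qed

text \<open>
If $\alpha$ and $\delta$ are algebraically independent, then so are $\tau$ and $\sigma$ with $\alpha = 1 + 3 \tau$ and
$\delta = 1 + 3 \sigma$. Both bases are congruent to $1$ modulo $3$ already.
\<close>

lemma exists_padic_ring_independent:
  assumes \<alpha>: "\<not> algebraic \<alpha>" and \<delta>: "\<not> algebraic_over \<alpha> \<delta>"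
  shows "\<exists>A p s. padic_ring A p \<and> s > 0 \<and> \<alpha> \<in> A \<and> \<delta> \<in> A \<and>
    (\<alpha> ^ s - 1) / of_nat p \<in> A \<and> (\<delta> ^ s - 1) / of_nat p \<in> A"
proof -
  define \<tau> where "\<tau> = (\<alpha> - of_int 1) / of_nat 3"
  define \<sigma> where "\<sigma> = (\<delta> - 1) / 3"
  have \<tau>: "\<not> algebraic \<tau>" unfolding \<tau>_def by (rule not_algebraic_affine[OF \<alpha>]) simp
  let ?A = "gauss_valuation_ring \<tau> 3"
  interpret A: padic_ring ?A 3
    by (rule gauss_valuation_ring_padic_ring[OF \<tau>]) auto
  let ?K = "rational_values \<alpha>"
  note K = rational_values_ring[OF \<alpha>]
  have \<tau>K: "\<tau> \<in> ?K"
  proof -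
    have "\<tau> = (\<alpha> + of_int (-1)) / of_int 3" by (simp add: \<tau>_def)
    then show ?thesis
      by (simp only:) (intro K rational_values_gen rational_values_of_int)
  qed
  have AK: "x \<in> ?K" if "x \<in> ?A" for x
  proof -
    from that obtain g h where "x = int_eval g \<tau> / int_eval h \<tau>"
      unfolding gauss_valuation_ring_def by blast
    then show ?thesis
      by (simp only:) (intro K(3) int_eval_closed rational_values_of_int K(1) K(2) \<tau>K)
  qed
  have "q = 0" if q: "\<And>i. coeff q i \<in> ?A" "poly q \<sigma> = 0" for q
  proof (rule ccontr)
    assume "q \<noteq> 0"
    define r :: "complex poly" where "r = [:of_int (-1) / of_int 3, of_int 1 / of_int 3:]"
    have r: "coeff r i \<in> ?K" for i
    proof -
      have "0 \<in> ?K" using rational_values_of_int[of 0] by simp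
      moreover have "of_int (-1) / of_int 3 \<in> ?K" "of_int 1 / of_int 3 \<in> ?K"
        by (intro K rational_values_of_int)+
      ultimately show ?thesis by (auto simp: r_def coeff_pCons split: nat.split)
    qed
    have "coeff (pcompose q r) i \<in> ?K" for i
      by (rule coeff_pcompose_closed) (use q(1) AK r K rational_values_of_int[of 0] in auto)
    moreover have "pcompose q r \<noteq> 0"
      using \<open>q \<noteq> 0\<close> by (auto simp: r_def dest!: pcompose_eq_0)
    moreover have "poly (pcompose q r) \<delta> = 0"
      using q(2) by (simp add: poly_pcompose r_def \<sigma>_def diff_divide_distrib)
    ultimately show False using \<delta> unfolding algebraic_over_def by blast
  qed
  then have "padic_ring {poly q \<sigma> |q. \<forall>i. coeff q i \<in> ?A} 3"
    by (rule A.polynomial_extension_padic_ring)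
  moreover define B where "B = {poly q \<sigma> |q. \<forall>i. coeff q i \<in> ?A}"
  ultimately interpret B: padic_ring B 3 by simp
  have "\<sigma> \<in> B" unfolding B_def
    by (intro CollectI exI[of _ "[:0, 1:]"]) (auto simp: coeff_pCons A.one_mem split: nat.split)
  then have \<delta>B: "1 + of_nat 3 * \<sigma> \<in> B" by (intro B.add_mem B.one_mem B.mult_mem B.of_nat_mem)
  have "\<tau> \<in> B"
  proof -
    have "\<not> [:int 3:] dvd 1" by (simp add: one_pCons)
    then have "\<tau> \<in> ?A"
      by (rule gauss_valuation_ringI[of _ "[:0, 1:]" _ 1, rotated]) simp
    then show ?thesis unfolding B_def
      by (intro CollectI exI[of _ "[:\<tau>:]"]) (auto simp: coeff_pCons split: nat.split)
  qed
  then have \<alpha>B: "1 + of_nat 3 * \<tau> \<in> B" by (intro B.add_mem B.one_mem B.mult_mem B.of_nat_mem)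
  have eq: "\<alpha> = 1 + of_nat 3 * \<tau>" "\<delta> = 1 + of_nat 3 * \<sigma>"
    by (simp_all add: \<tau>_def \<sigma>_def)
  have "(\<alpha> ^ 1 - 1) / of_nat 3 \<in> B" "(\<delta> ^ 1 - 1) / of_nat 3 \<in> B"
    unfolding eq using \<open>\<tau> \<in> B\<close> \<open>\<sigma> \<in> B\<close> by simp_all
  moreover have "\<alpha> \<in> B" "\<delta> \<in> B" unfolding eq by (fact \<alpha>B \<delta>B)+
  ultimately show ?thesis using B.padic_ring_axioms
    by (intro exI[of _ B], rule_tac exI[of _ 3], rule_tac exI[of _ 1]) simp
qed

text \<open>
The two constructions cover everything: if $\alpha$ is algebraic, a transcendental $t$ over which both
numbers are algebraic is $\delta$ itself or an arbitrary transcendental number, and otherwise $t = \alpha$ works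
unless $\alpha$ and $\delta$ are independent.
\<close>

theorem exists_padic_ring:
  assumes "\<alpha> \<noteq> 0" "\<delta> \<noteq> 0"
  shows "\<exists>A p s. padic_ring A p \<and> s > 0 \<and> \<alpha> \<in> A \<and> \<delta> \<in> A \<and>
    (\<alpha> ^ s - 1) / of_nat p \<in> A \<and> (\<delta> ^ s - 1) / of_nat p \<in> A"
proof -
  have self: "algebraic_over t t" if "\<not> algebraic t" for t
  proof -
    have "coeff [:- t, 1:] i \<in> rational_values t" for i
      using rational_values_ring(2)[OF that rational_values_gen rational_values_of_int[of "-1"]]
        rational_values_of_int[of 0] rational_values_of_int[of 1]
      by (auto simp: coeff_pCons split: nat.split)
    then show ?thesis unfolding algebraic_over_def
      by (intro exI[of _ "[:- t, 1:]"]) auto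
  qed
  have alg: "algebraic_over t x" if "algebraic x" for t x
  proof -
    from that obtain q where q: "\<And>i. coeff q i \<in> \<int>" "q \<noteq> 0" "poly q x = 0"
      by (auto simp: algebraic_def)
    have "coeff q i \<in> rational_values t" for i
      using q(1)[of i] by (auto elim!: Ints_cases intro: rational_values_of_int)
    then show ?thesis using q unfolding algebraic_over_def by blast
  qed
  obtain t :: complex where t: "\<not> algebraic t" using exists_not_algebraic by blast
  show ?thesis
  proof (cases "algebraic \<alpha>")
    case True
    define t' where "t' = (if algebraic \<delta> then t else \<delta>)"
    have "\<not> algebraic t'" "algebraic_over t' \<alpha>" "algebraic_over t' \<delta>"
      using True t by (auto simp: t'_def intro: alg self)
    then show ?thesis using exists_padic_ring_algebraic assms by blast
  next
    case False
    then show ?thesis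
      using exists_padic_ring_algebraic[OF False self] exists_padic_ring_independent assms
      by blast
  qed
qed

section \<open>Homogeneous linear systems\<close>

lemma eliminate_unknown:
  fixes a :: "'e \<Rightarrow> 'j \<Rightarrow> complex" and c :: "'j \<Rightarrow> complex"
  assumes "finite J" "j0 \<notin> J" "a e0 j0 \<noteq> 0"
  defines "c' \<equiv> c(j0 := - (\<Sum>j\<in>J. a e0 j * c j) / a e0 j0)"
  shows "(\<Sum>j\<in>insert j0 J. a e j * c' j) = (\<Sum>j\<in>J. (a e j - a e j0 * a e0 j / a e0 j0) * c j)"
proof -
  have "(\<Sum>j\<in>insert j0 J. a e j * c' j) = a e j0 * c' j0 + (\<Sum>j\<in>J. a e j * c' j)"
    using assms by simp
  also have "(\<Sum>j\<in>J. a e j * c' j) = (\<Sum>j\<in>J. a e j * c j)"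
    using assms by (intro sum.cong) auto
  also have "a e j0 * c' j0 = - (\<Sum>j\<in>J. a e j0 * a e0 j / a e0 j0 * c j)"
    by (simp add: c'_def sum_distrib_left sum_divide_distrib mult_ac)
  finally show ?thesis by (simp add: left_diff_distrib sum_subtractf)
qed

text \<open>
Gaussian elimination never leaves the field of the coefficients. It serves to replace the complex
coefficients of an exponential polynomial by coefficients in the fraction field of a separated
ring: the values at the zeros $n$ are linear conditions on them with coefficients in that ring.
\<close>

lemma solution_in_subfield:
  fixes a :: "'e \<Rightarrow> 'j \<Rightarrow> complex"
  assumes K: "1 \<in> K" "\<And>x y. x \<in> K \<Longrightarrow> y \<in> K \<Longrightarrow> x - y \<in> K"
      "\<And>x y. x \<in> K \<Longrightarrow> y \<in> K \<Longrightarrow> x * y \<in> K" "\<And>x y. x \<in> K \<Longrightarrow> y \<in> K \<Longrightarrow> x / y \<in> K"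
    and "finite J" and "\<And>e j. a e j \<in> K"
    and "j1 \<in> J" "c j1 \<noteq> 0" and "\<And>e. e \<in> E \<Longrightarrow> (\<Sum>j\<in>J. a e j * c j) = 0"
  shows "\<exists>c'. (\<forall>j. c' j \<in> K) \<and> (\<exists>j\<in>J. c' j \<noteq> 0) \<and> (\<forall>e\<in>E. (\<Sum>j\<in>J. a e j * c' j) = 0)"
  using assms(5-)
proof (induction J arbitrary: a c j1 rule: finite_induct)
  case empty
  then show ?case by simp
next
  case (insert j0 J)
  have K0: "0 \<in> K" using K(2)[OF K(1) K(1)] by simp
  have K_sum: "sum f I \<in> K" if "\<And>i. i \<in> I \<Longrightarrow> f i \<in> K" for f and I :: "'j set"
  proof -
    have "x + y \<in> K" if "x \<in> K" "y \<in> K" for x y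
      using K(2)[OF that(1) K(2)[OF K0 that(2)]] by simp
    then show ?thesis using that
      by (induction I rule: infinite_finite_induct) (auto simp: K0)
  qed
  show ?case
  proof (cases "\<exists>e0\<in>E. a e0 j0 \<noteq> 0")
    case False
    then have "(\<Sum>j\<in>insert j0 J. a e j * (if j = j0 then 1 else 0)) = 0" if "e \<in> E" for e
      using that by (intro sum.neutral) auto
    then show ?thesis using K(1) K0 by (intro exI[of _ "\<lambda>j. if j = j0 then 1 else 0"]) auto
  next
    case True
    then obtain e0 where e0: "e0 \<in> E" "a e0 j0 \<noteq> 0" by blast
    define a' where "a' e j = a e j - a e j0 * a e0 j / a e0 j0" for e j
    have c0: "c j0 = - (\<Sum>j\<in>J. a e0 j * c j) / a e0 j0"
      using insert.prems(4)[OF e0(1)] insert.hyps e0(2) by (simp add: field_simps add_eq_0_iff)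
    then have upd: "c(j0 := - (\<Sum>j\<in>J. a e0 j * c j) / a e0 j0) = c" by auto
    have elim: "(\<Sum>j\<in>J. a' e j * c j) = (\<Sum>j\<in>insert j0 J. a e j * c j)" for e
      using eliminate_unknown[of J j0 a e0 e c] insert.hyps e0(2) unfolding upd a'_def by simp
    have "\<exists>j\<in>J. c j \<noteq> 0"
    proof (rule ccontr)
      assume "\<not> (\<exists>j\<in>J. c j \<noteq> 0)"
      then have "\<And>j. j \<in> J \<Longrightarrow> c j = 0" by blast
      moreover from this have "c j0 = 0" using c0 by simp
      ultimately show False using insert.prems(2,3) by blast
    qed
    then obtain j2 where j2: "j2 \<in> J" "c j2 \<noteq> 0" by blast
    have "\<exists>c'. (\<forall>j. c' j \<in> K) \<and> (\<exists>j\<in>J. c' j \<noteq> 0) \<and> (\<forall>e\<in>E. (\<Sum>j\<in>J. a' e j * c' j) = 0)"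
    proof (rule insert.IH)
      show "j2 \<in> J" "c j2 \<noteq> 0" by (fact j2)+
      show "a' e j \<in> K" for e j unfolding a'_def by (intro K insert.prems)
      show "(\<Sum>j\<in>J. a' e j * c j) = 0" if "e \<in> E" for e
        using insert.prems(4)[OF that] elim by simp
    qed
    then obtain c' where c': "\<And>j. c' j \<in> K" "\<exists>j\<in>J. c' j \<noteq> 0"
      "\<And>e. e \<in> E \<Longrightarrow> (\<Sum>j\<in>J. a' e j * c' j) = 0" by blast
    define d where "d = c'(j0 := - (\<Sum>j\<in>J. a e0 j * c' j) / a e0 j0)"
    have "(\<Sum>j\<in>insert j0 J. a e j * d j) = 0" if "e \<in> E" for e
      using eliminate_unknown[of J j0 a e0 e c'] insert.hyps e0(2) c'(3)[OF that]
      unfolding d_def a'_def by simp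
    moreover have "d j \<in> K" for j
      using c'(1) K(4)[OF K(2)[OF K0 K_sum], of J "\<lambda>j. a e0 j * c' j"] K(3) insert.prems(1)
      by (auto simp: d_def)
    moreover have "\<exists>j\<in>insert j0 J. d j \<noteq> 0"
      using c'(2) insert.hyps unfolding d_def by auto
    ultimately show ?thesis by blast
  qed
qed

lemma more_unknowns_than_equations:
  fixes a :: "'e \<Rightarrow> 'j \<Rightarrow> complex"
  assumes "finite E" "finite J" "card E < card J"
  shows "\<exists>c. (\<exists>j\<in>J. c j \<noteq> 0) \<and> (\<forall>e\<in>E. (\<Sum>j\<in>J. a e j * c j) = 0)"
  using assms
proof (induction E arbitrary: J a rule: finite_induct)
  case empty
  then have "J \<noteq> {}" by auto
  then show ?case by (intro exI[of _ "\<lambda>_. 1"]) auto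
next
  case (insert e0 E)
  show ?case
  proof (cases "\<exists>j0\<in>J. a e0 j0 \<noteq> 0")
    case False
    have "card E < card J" using insert by simp
    with insert.IH[of J a] insert.prems
    obtain c where c: "\<exists>j\<in>J. c j \<noteq> 0" "\<forall>e\<in>E. (\<Sum>j\<in>J. a e j * c j) = 0" by blast
    moreover have "(\<Sum>j\<in>J. a e0 j * c j) = 0" using False by (intro sum.neutral) auto
    ultimately show ?thesis by auto
  next
    case True
    then obtain j0 where j0: "j0 \<in> J" "a e0 j0 \<noteq> 0" by blast
    define J' where "J' = J - {j0}"
    have J: "J = insert j0 J'" "j0 \<notin> J'" "finite J'" using j0 insert.prems by (auto simp: J'_def)
    then have "card E < card J'" using insert.prems insert.hyps by simp
    from insert.IH[OF J(3) this, of "\<lambda>e j. a e j - a e j0 * a e0 j / a e0 j0"]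
    obtain c where c: "\<exists>j\<in>J'. c j \<noteq> 0"
      "\<And>e. e \<in> E \<Longrightarrow> (\<Sum>j\<in>J'. (a e j - a e j0 * a e0 j / a e0 j0) * c j) = 0" by blast
    define d where "d = c(j0 := - (\<Sum>j\<in>J'. a e0 j * c j) / a e0 j0)"
    have d: "(\<Sum>j\<in>J. a e j * d j) = (\<Sum>j\<in>J'. (a e j - a e j0 * a e0 j / a e0 j0) * c j)" for e
      using eliminate_unknown[of J' j0 a e0 e c] J j0 unfolding d_def by simp
    have "(\<Sum>j\<in>J. a e j * d j) = 0" if "e \<in> insert e0 E" for e
    proof (cases "e = e0")
      case True
      then show ?thesis unfolding d using j0(2) by (intro sum.neutral) auto
    next
      case False
      then show ?thesis unfolding d using that c(2) by blast
    qed
    moreover have "\<exists>j\<in>J. d j \<noteq> 0" using c(1) J unfolding d_def by auto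
    ultimately show ?thesis by blast
  qed
qed

section \<open>Zeros of exponential polynomials with two bases\<close>

lemma polynomial_zero_if_nat_zeros:
  fixes q :: "complex poly" assumes "\<And>n. poly q (of_nat n) = 0" shows "q = 0"
proof (rule ccontr)
  assume "q \<noteq> 0"
  then have "finite {x. poly q x = 0}" by (rule poly_roots_finite)
  moreover have "range (of_nat :: nat \<Rightarrow> complex) \<subseteq> {x. poly q x = 0}" using assms by auto
  ultimately have "finite (range (of_nat :: nat \<Rightarrow> complex))" by (metis finite_subset)
  then show False using finite_imageD[of "of_nat :: nat \<Rightarrow> complex" UNIV] by (simp add: inj_of_nat)
qed

text \<open>
With a base $m_k$ whose coefficient is nonzero, pass from
$S(n)$ to $S(n + 1) - m_k S(n)$: this lowers the degree of the coefficient of $m_k$ and keeps the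
degrees of the others, so induction on the total degree applies.
\<close>

lemma exponential_polynomials_independent:
  fixes m :: "'i \<Rightarrow> complex" and P :: "'i \<Rightarrow> complex poly"
  assumes "finite I" and inj: "inj_on m I" and "\<And>i. i \<in> I \<Longrightarrow> m i \<noteq> 0"
    and "\<And>n. (\<Sum>i\<in>I. poly (P i) (of_nat n) * m i ^ n) = 0"
  shows "\<forall>i\<in>I. P i = 0"
  using assms(4)
proof (induction "\<Sum>i\<in>I. if P i = 0 then 0 else Suc (degree (P i))" arbitrary: P
    rule: less_induct)
  case less
  show ?case
  proof (rule ccontr)
    assume "\<not> (\<forall>i\<in>I. P i = 0)"
    then obtain k where k: "k \<in> I" "P k \<noteq> 0" by blast
    define Q where "Q i = smult (m i) (pcompose (P i) [:1, 1:]) - smult (m k) (P i)" for i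
    have Q: "poly (Q i) (of_nat n) * m i ^ n =
        poly (P i) (of_nat (Suc n)) * m i ^ Suc n - m k * (poly (P i) (of_nat n) * m i ^ n)" for i n
      by (simp add: Q_def poly_pcompose algebra_simps)
    have Q_sum: "(\<Sum>i\<in>I. poly (Q i) (of_nat n) * m i ^ n) = 0" for n
      unfolding Q sum_subtractf sum_distrib_left[symmetric] less.prems by simp
    have deg: "degree (Q i) \<le> degree (P i)" for i
      unfolding Q_def by (intro degree_diff_le order.trans[OF degree_smult_le]) (auto simp: degree_pcompose)
    have top: "coeff (Q i) (degree (P i)) = (m i - m k) * lead_coeff (P i)" for i
    proof -
      have "coeff (pcompose (P i) [:1, 1:]) (degree (P i)) = lead_coeff (P i)"
        using lead_coeff_comp[of "[:1, 1:]" "P i"] by (simp add: degree_pcompose)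
      then show ?thesis by (simp add: Q_def algebra_simps)
    qed
    have "(\<Sum>i\<in>I. if Q i = 0 then 0 else Suc (degree (Q i))) <
        (\<Sum>i\<in>I. if P i = 0 then 0 else Suc (degree (P i)))"
    proof (rule sum_strict_mono_ex1[OF \<open>finite I\<close>])
      show "\<forall>i\<in>I. (if Q i = 0 then 0 else Suc (degree (Q i))) \<le>
          (if P i = 0 then 0 else Suc (degree (P i)))"
        using deg by (auto simp: Q_def)
      have "degree (Q k) < degree (P k)" if "Q k \<noteq> 0"
      proof -
        have "coeff (Q k) (degree (P k)) = 0" by (simp add: top)
        then have "degree (Q k) \<noteq> degree (P k)" using that by (metis leading_coeff_0_iff)
        then show ?thesis using deg[of k] by simp
      qed
      then show "\<exists>i\<in>I. (if Q i = 0 then 0 else Suc (degree (Q i))) <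
          (if P i = 0 then 0 else Suc (degree (P i)))"
        using k by (intro bexI[of _ k]) auto
    qed
    from less.hyps[OF this Q_sum] have Q0: "\<And>i. i \<in> I \<Longrightarrow> Q i = 0" by blast
    have others: "P i = 0" if "i \<in> I" "i \<noteq> k" for i
    proof -
      have "m i \<noteq> m k" using inj that k by (auto dest: inj_onD)
      then show ?thesis using top[of i] Q0[OF that(1)] by simp
    qed
    have val: "poly (P k) (of_nat n) * m k ^ n = 0" for n
    proof -
      have "(\<Sum>i\<in>I. poly (P i) (of_nat n) * m i ^ n) =
          (\<Sum>i\<in>I. if i = k then poly (P k) (of_nat n) * m k ^ n else 0)"
        by (intro sum.cong) (auto simp: others)
      then show ?thesis using less.prems[of n] k \<open>finite I\<close> by simp
    qed
    then have "poly (P k) (of_nat n) = 0" for n using val[of n] assms(3)[OF k(1)] by simp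
    then show False using k polynomial_zero_if_nat_zeros by blast
  qed
qed

lemma (in padic_ring) product_power_cong_1:
  assumes "\<alpha> \<in> A" "\<delta> \<in> A" "(\<alpha> ^ s - 1) / of_nat p \<in> A" "(\<delta> ^ s - 1) / of_nat p \<in> A"
  shows "((\<alpha> ^ i * \<delta> ^ j) ^ s - 1) / of_nat p \<in> A"
proof -
  have "((\<alpha> ^ i * \<delta> ^ j) ^ s - 1) / of_nat p =
      (\<alpha> ^ (s * i) - 1) / of_nat p * \<delta> ^ (s * j) + (\<delta> ^ (s * j) - 1) / of_nat p"
    by (simp add: power_mult_distrib power_mult[symmetric] mult.commute field_simps)
  then show ?thesis
    by (simp only:) (intro add_mem mult_mem power_mem assms unit_power_cong_1_mult)
qed

text \<open>
Suppose that no quotient of two different bases is a root of unity. By \<open>solution_in_subfield\<close> the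
coefficients can be taken in the fraction field of a ring \<open>A\<close> from \<open>exists_padic_ring\<close>, and after clearing
denominators in \<open>A\<close>. The new exponential polynomial vanishes on a progression $r + s n$, where the bases
$\mu_i^s$ are still distinct, so all its coefficients are zero: a contradiction. The bases are
indexed, and two indices with equal bases have quotient $1$, which counts as a root of unity.
\<close>

theorem skolem_two_generators:
  fixes P :: "'i \<Rightarrow> complex poly" and k l :: "'i \<Rightarrow> nat"
  assumes "\<alpha> \<noteq> 0" "\<delta> \<noteq> 0" and fin: "finite I" and "i1 \<in> I" "P i1 \<noteq> 0"
    and inf: "infinite {n. (\<Sum>i\<in>I. poly (P i) (of_nat n) * (\<alpha> ^ k i * \<delta> ^ l i) ^ n) = 0}"
  shows "\<exists>i\<in>I. \<exists>j\<in>I. i \<noteq> j \<and> root_of_unity ((\<alpha> ^ k i * \<delta> ^ l i) / (\<alpha> ^ k j * \<delta> ^ l j))"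
proof (rule ccontr)
  assume contra: "\<not> ?thesis"
  define \<mu> where "\<mu> i = \<alpha> ^ k i * \<delta> ^ l i" for i
  have \<mu>0: "\<mu> i \<noteq> 0" for i using assms by (simp add: \<mu>_def)
  obtain A p s where A: "padic_ring A p" and s: "s > 0" and mem: "\<alpha> \<in> A" "\<delta> \<in> A"
    "(\<alpha> ^ s - 1) / of_nat p \<in> A" "(\<delta> ^ s - 1) / of_nat p \<in> A"
    using exists_padic_ring[OF assms(1,2)] by blast
  interpret padic_ring A p by fact
  define K where "K = {x / y |x y. x \<in> A \<and> y \<in> A \<and> y \<noteq> 0}"
  have KI: "x / y \<in> K" if "x \<in> A" "y \<in> A" "y \<noteq> 0" for x y
    using that unfolding K_def by blast
  have A_K: "x \<in> K" if "x \<in> A" for x using KI[OF that one_mem] by simp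
  have K: "x - y \<in> K" "x * y \<in> K" "x / y \<in> K" if xy: "x \<in> K" "y \<in> K" for x y
  proof -
    from xy obtain a b c d where x: "x = a / b" "a \<in> A" "b \<in> A" "b \<noteq> 0"
      and y: "y = c / d" "c \<in> A" "d \<in> A" "d \<noteq> 0" unfolding K_def by blast
    have "(a * d - c * b) / (b * d) \<in> K" "(a * c) / (b * d) \<in> K"
      using x y by (auto intro!: KI diff_mem mult_mem)
    then show "x - y \<in> K" "x * y \<in> K" using x y by (simp_all add: diff_frac_eq)
    have "(a * d) / (b * c) \<in> K" if "c \<noteq> 0"
      using x y that by (auto intro!: KI mult_mem)
    then show "x / y \<in> K" using x y A_K[of 0] by (cases "c = 0") auto
  qed
  define L where "L = Max (degree ` P ` I)"
  have L: "degree (P i) \<le> L" if "i \<in> I" for i using fin that unfolding L_def by (intro Max_ge) auto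
  define J where "J = I \<times> {..L}"
  have J: "finite J" using fin by (simp add: J_def)
  define a where "a n = (\<lambda>(i, h). of_nat n ^ h * \<mu> i ^ n :: complex)" for n :: nat
  define c where "c = (\<lambda>(i, h). coeff (P i) h)"
  define Z where "Z = {n. (\<Sum>i\<in>I. poly (P i) (of_nat n) * \<mu> i ^ n) = 0}"
  have \<mu>A: "\<mu> i \<in> A" for i unfolding \<mu>_def by (intro mult_mem power_mem mem)
  have eq: "(\<Sum>j\<in>J. a n j * c j) = (\<Sum>i\<in>I. poly (P i) (of_nat n) * \<mu> i ^ n)" for n
  proof -
    have "(\<Sum>j\<in>J. a n j * c j) = (\<Sum>i\<in>I. \<Sum>h\<le>L. of_nat n ^ h * \<mu> i ^ n * coeff (P i) h)"
      unfolding J_def sum.cartesian_product a_def c_def by (intro sum.cong) auto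
    also have "\<dots> = (\<Sum>i\<in>I. poly (P i) (of_nat n) * \<mu> i ^ n)"
    proof (intro sum.cong refl)
      fix i assume "i \<in> I"
      have "poly (P i) (of_nat n) = (\<Sum>h\<le>L. coeff (P i) h * of_nat n ^ h)"
        unfolding poly_altdef using L[OF \<open>i \<in> I\<close>]
        by (intro sum.mono_neutral_left) (auto simp: coeff_eq_0)
      then show "(\<Sum>h\<le>L. of_nat n ^ h * \<mu> i ^ n * coeff (P i) h) = poly (P i) (of_nat n) * \<mu> i ^ n"
        by (simp add: sum_distrib_left mult_ac)
    qed
    finally show ?thesis .
  qed
  have "\<exists>c'. (\<forall>j. c' j \<in> K) \<and> (\<exists>j\<in>J. c' j \<noteq> 0) \<and> (\<forall>n\<in>Z. (\<Sum>j\<in>J. a n j * c' j) = 0)"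
  proof (rule solution_in_subfield[OF A_K[OF one_mem] K J])
    show "a n j \<in> K" for n j
      unfolding a_def by (auto split: prod.split intro!: A_K mult_mem power_mem \<mu>A)
    show "(i1, degree (P i1)) \<in> J" "c (i1, degree (P i1)) \<noteq> 0"
      using assms L by (auto simp: J_def c_def)
    show "(\<Sum>j\<in>J. a n j * c j) = 0" if "n \<in> Z" for n using that by (simp add: eq Z_def)
  qed
  then obtain c' where c': "\<And>j. c' j \<in> K" "\<exists>j\<in>J. c' j \<noteq> 0"
    "\<And>n. n \<in> Z \<Longrightarrow> (\<Sum>j\<in>J. a n j * c' j) = 0" by blast
  have "\<forall>j. \<exists>x y. c' j = x / y \<and> x \<in> A \<and> y \<in> A \<and> y \<noteq> 0"
    using c'(1) unfolding K_def by blast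
  then obtain x y where xy: "\<And>j. c' j = x j / y j" "\<And>j. x j \<in> A" "\<And>j. y j \<in> A" "\<And>j. y j \<noteq> 0"
    by metis
  define D where "D = (\<Prod>j\<in>J. y j)"
  have D: "D \<noteq> 0" using J xy by (simp add: D_def)
  have DA: "D * c' j \<in> A" if "j \<in> J" for j
  proof -
    have "D = y j * (\<Prod>i\<in>J - {j}. y i)" unfolding D_def using J that by (rule prod.remove)
    then have "D * c' j = (\<Prod>i\<in>J - {j}. y i) * x j" using xy(4)[of j] by (simp add: xy(1))
    then show ?thesis by (simp only:) (intro mult_mem prod_mem xy)
  qed
  have "infinite {n. (\<Sum>j\<in>J. D * c' j * of_nat n ^ snd j * \<mu> (fst j) ^ n) = 0}"
  proof (rule infinite_super[of Z])
    show "infinite Z" using inf by (simp add: Z_def \<mu>_def)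
    have "(\<Sum>j\<in>J. D * c' j * of_nat n ^ snd j * \<mu> (fst j) ^ n) = D * (\<Sum>j\<in>J. a n j * c' j)" for n
      unfolding sum_distrib_left by (intro sum.cong) (auto simp: a_def)
    then show "Z \<subseteq> {n. (\<Sum>j\<in>J. D * c' j * of_nat n ^ snd j * \<mu> (fst j) ^ n) = 0}"
      using c'(3) by auto
  qed
  from exponential_polynomial_zero_on_progression[OF J s DA \<mu>A _ this]
  obtain r where r: "\<And>n. (\<Sum>j\<in>J. D * c' j * of_nat (r + s * n) ^ snd j * \<mu> (fst j) ^ (r + s * n)) = 0"
    using product_power_cong_1[OF mem] unfolding \<mu>_def by blast
  define R where "R i = (\<Sum>h\<le>L. monom (D * c' (i, h)) h)" for i
  define Q where "Q i = smult (\<mu> i ^ r) (pcompose (R i) [:of_nat r, of_nat s:])" for i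
  have "\<forall>i\<in>I. Q i = 0"
  proof (rule exponential_polynomials_independent[OF fin])
    show "\<mu> i ^ s \<noteq> 0" for i using \<mu>0 by simp
    show "inj_on (\<lambda>i. \<mu> i ^ s) I"
    proof (rule inj_onI, rule ccontr)
      fix i j assume ij: "i \<in> I" "j \<in> I" "\<mu> i ^ s = \<mu> j ^ s" "i \<noteq> j"
      have "(\<mu> i / \<mu> j) ^ s = 1" using ij(3) \<mu>0[of j] by (simp add: power_divide)
      then have "root_of_unity (\<mu> i / \<mu> j)" using s unfolding root_of_unity_def by blast
      then show False using contra ij unfolding \<mu>_def by blast
    qed
    show "(\<Sum>i\<in>I. poly (Q i) (of_nat n) * (\<mu> i ^ s) ^ n) = 0" for n
    proof -
      have "(\<Sum>j\<in>J. D * c' j * of_nat (r + s * n) ^ snd j * \<mu> (fst j) ^ (r + s * n)) =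
        (\<Sum>i\<in>I. \<Sum>h\<le>L. D * c' (i, h) * of_nat (r + s * n) ^ h * \<mu> i ^ (r + s * n))"
        unfolding J_def sum.cartesian_product by (intro sum.cong) auto
      also have "\<dots> = (\<Sum>i\<in>I. poly (Q i) (of_nat n) * (\<mu> i ^ s) ^ n)"
      proof -
        have pw: "\<mu> i ^ (r + s * n) = \<mu> i ^ r * (\<mu> i ^ s) ^ n" for i
          by (simp add: power_add power_mult)
        show ?thesis unfolding pw
          by (simp add: Q_def R_def poly_pcompose poly_sum poly_monom sum_distrib_left
              sum_distrib_right mult_ac)
      qed
      finally show ?thesis using r by simp
    qed
  qed
  then have "R i = 0" if "i \<in> I" for i
    using that \<mu>0[of i] s by (auto simp: Q_def dest!: pcompose_eq_0)
  then have "coeff (R i) h = 0" if "i \<in> I" for i h using that by simp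
  moreover have "coeff (R i) h = D * c' (i, h)" if "h \<le> L" for i h
    using that by (simp add: R_def coeff_sum)
  ultimately show False using c'(2) D unfolding J_def by (metis mult_eq_0_iff mem_Sigma_iff atMost_iff surj_pair)
qed

section \<open>Powers lying on a rational curve\<close>

text \<open>
Dimension count: with the denominators cleared, the $(N + 1)^2$ products $A^i B^j$ with $i, j \le N$ are
polynomials of degree at most $N d$, where $d$ is the sum of the degrees of $A$ and $B$. They are linearly
dependent for $N = d + 1$.
\<close>

lemma rational_functions_dependent:
  fixes a1 a2 b1 b2 :: "complex poly"
  shows "\<exists>N c. (\<exists>i\<le>N. \<exists>j\<le>N. c i j \<noteq> 0) \<and>
    (\<forall>w. poly a2 w \<noteq> 0 \<longrightarrow> poly b2 w \<noteq> 0 \<longrightarrow>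
      (\<Sum>i\<le>N. \<Sum>j\<le>N. c i j * (poly a1 w / poly a2 w) ^ i * (poly b1 w / poly b2 w) ^ j) = (0::complex))"
proof -
  define d where "d = max (degree a1) (degree a2) + max (degree b1) (degree b2)"
  define N where "N = Suc d"
  define q where "q = (\<lambda>(i, j). a1 ^ i * a2 ^ (N - i) * (b1 ^ j * b2 ^ (N - j)))"
  define J where "J = {..N} \<times> {..N}"
  have deg: "degree (q (i, j)) \<le> N * d" if "i \<le> N" "j \<le> N" for i j
  proof -
    have pw: "degree (u ^ i * v ^ (N - i)) \<le> N * max (degree u) (degree v)"
      if "i \<le> N" for u v :: "complex poly" and i
    proof -
      have "degree (u ^ i * v ^ (N - i)) \<le> degree u * i + degree v * (N - i)"
        by (intro order.trans[OF degree_mult_le] add_mono degree_power_le)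
      also have "\<dots> \<le> max (degree u) (degree v) * i + max (degree u) (degree v) * (N - i)"
        by (intro add_mono mult_right_mono) auto
      also have "\<dots> = N * max (degree u) (degree v)"
        using that by (metis add_mult_distrib2 le_add_diff_inverse mult.commute)
      finally show ?thesis .
    qed
    show ?thesis unfolding q_def d_def prod.case add_mult_distrib2
      by (rule order.trans[OF degree_mult_le]) (intro add_mono pw that)
  qed
  have "card {..N * d} < card J"
    unfolding J_def by (simp add: N_def)
  from more_unknowns_than_equations[OF _ _ this, of "\<lambda>e j. coeff (q j) e"]
  obtain c where c: "\<exists>j\<in>J. c j \<noteq> 0" "\<And>e. e \<le> N * d \<Longrightarrow> (\<Sum>j\<in>J. coeff (q j) e * c j) = 0"
    by (auto simp: J_def)
  have "(\<Sum>j\<in>J. smult (c j) (q j)) = 0"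
  proof (rule poly_eqI)
    fix e
    show "coeff (\<Sum>j\<in>J. smult (c j) (q j)) e = coeff 0 e"
    proof (cases "e \<le> N * d")
      case True
      then show ?thesis using c(2)[OF True] by (simp add: coeff_sum mult.commute)
    next
      case False
      have "coeff (q j) e = 0" if "j \<in> J" for j
        using that deg[of "fst j" "snd j"] False by (intro coeff_eq_0) (auto simp: J_def)
      then show ?thesis by (simp add: coeff_sum)
    qed
  qed
  then have zero: "(\<Sum>j\<in>J. c j * poly (q j) w) = 0" for w
    using poly_0[of w] by (metis (no_types, lifting) poly_smult poly_sum sum.cong)
  show ?thesis
  proof (rule exI[of _ N], rule exI[of _ "\<lambda>i j. c (i, j)"], intro conjI allI impI)
    show "\<exists>i\<le>N. \<exists>j\<le>N. (\<lambda>i j. c (i, j)) i j \<noteq> 0" using c(1) unfolding J_def by auto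
    fix w assume nz: "poly a2 w \<noteq> 0" "poly b2 w \<noteq> 0"
    have "(\<Sum>i\<le>N. \<Sum>j\<le>N. c (i, j) * (poly a1 w / poly a2 w) ^ i * (poly b1 w / poly b2 w) ^ j) =
      (\<Sum>i\<le>N. \<Sum>j\<le>N. c (i, j) * poly (q (i, j)) w / (poly a2 w ^ N * poly b2 w ^ N))"
    proof (intro sum.cong refl)
      fix i j assume ij: "i \<in> {..N}" "j \<in> {..N}"
      have "poly a2 w ^ N = poly a2 w ^ i * poly a2 w ^ (N - i)"
        "poly b2 w ^ N = poly b2 w ^ j * poly b2 w ^ (N - j)"
        using ij by (simp_all flip: power_add)
      then show "c (i, j) * (poly a1 w / poly a2 w) ^ i * (poly b1 w / poly b2 w) ^ j =
          c (i, j) * poly (q (i, j)) w / (poly a2 w ^ N * poly b2 w ^ N)"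
        using nz by (simp add: q_def power_divide)
    qed
    also have "\<dots> = (\<Sum>j\<in>J. c j * poly (q j) w) / (poly a2 w ^ N * poly b2 w ^ N)"
      unfolding J_def sum.cartesian_product sum_divide_distrib by (intro sum.cong) auto
    finally show "(\<Sum>i\<le>N. \<Sum>j\<le>N. (\<lambda>i j. c (i, j)) i j * (poly a1 w / poly a2 w) ^ i *
        (poly b1 w / poly b2 w) ^ j) = 0"
      by (simp add: zero)
  qed
qed

corollary two_exponentials_on_rational_curve:
  fixes a1 a2 b1 b2 :: "complex poly"
  assumes "\<alpha> \<noteq> 0" "\<delta> \<noteq> 0" and inf: "infinite S"
    and curve: "\<And>n. n \<in> S \<Longrightarrow> \<exists>w. poly a2 w \<noteq> 0 \<and> poly b2 w \<noteq> 0 \<and>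
      \<alpha> ^ n = poly a1 w / poly a2 w \<and> \<delta> ^ n = poly b1 w / poly b2 w"
  shows "\<exists>a b :: int. (a, b) \<noteq> (0, 0) \<and> \<alpha> powi a * \<delta> powi b = 1"
proof -
  obtain N c i0 j0 where c0: "i0 \<le> N" "j0 \<le> N" "c i0 j0 \<noteq> 0"
    and c: "\<And>w. poly a2 w \<noteq> 0 \<Longrightarrow> poly b2 w \<noteq> 0 \<Longrightarrow>
      (\<Sum>i\<le>N. \<Sum>j\<le>N. c i j * (poly a1 w / poly a2 w) ^ i * (poly b1 w / poly b2 w) ^ j) = (0::complex)"
    using rational_functions_dependent[of a2 b2 a1 b1] by blast
  define I where "I = {..N} \<times> {..N}"
  define P where "P = (\<lambda>(i, j). [:c i j:])"
  have "\<exists>i\<in>I. \<exists>j\<in>I. i \<noteq> j \<and>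
      root_of_unity ((\<alpha> ^ fst i * \<delta> ^ snd i) / (\<alpha> ^ fst j * \<delta> ^ snd j))"
  proof (rule skolem_two_generators[OF assms(1,2), of _ "(i0, j0)" P])
    show "finite I" "(i0, j0) \<in> I" "P (i0, j0) \<noteq> 0" using c0 by (auto simp: I_def P_def)
    show "infinite {n. (\<Sum>i\<in>I. poly (P i) (of_nat n) * (\<alpha> ^ fst i * \<delta> ^ snd i) ^ n) = 0}"
    proof (rule infinite_super[OF _ inf], rule subsetI, rule CollectI)
      fix n assume "n \<in> S"
      then obtain w where w: "poly a2 w \<noteq> 0" "poly b2 w \<noteq> 0"
        "\<alpha> ^ n = poly a1 w / poly a2 w" "\<delta> ^ n = poly b1 w / poly b2 w" using curve by blast
      have "(\<Sum>i\<in>I. poly (P i) (of_nat n) * (\<alpha> ^ fst i * \<delta> ^ snd i) ^ n) =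
        (\<Sum>i\<le>N. \<Sum>j\<le>N. c i j * (\<alpha> ^ n) ^ i * (\<delta> ^ n) ^ j)"
        unfolding I_def sum.cartesian_product
        by (intro sum.cong) (auto simp: P_def power_mult_distrib mult.commute simp flip: power_mult)
      also have "\<dots> = 0" unfolding w(3,4) by (rule c[OF w(1,2)])
      finally show "(\<Sum>i\<in>I. poly (P i) (of_nat n) * (\<alpha> ^ fst i * \<delta> ^ snd i) ^ n) = 0" .
    qed
  qed
  then obtain u v m where uv: "u \<noteq> v" "m > 0"
    "((\<alpha> ^ fst u * \<delta> ^ snd u) / (\<alpha> ^ fst v * \<delta> ^ snd v)) ^ m = 1"
    unfolding root_of_unity_def by blast
  obtain i j i' j' where "u = (i, j)" "v = (i', j')" by (metis surj_pair)
  with uv have ij: "(i, j) \<noteq> (i', j')" "m > 0"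
    "((\<alpha> ^ i * \<delta> ^ j) / (\<alpha> ^ i' * \<delta> ^ j')) ^ m = 1" by simp_all
  define a b where "a = int m * (int i - int i')" and "b = int m * (int j - int j')"
  have "\<alpha> powi a * \<delta> powi b = ((\<alpha> ^ i * \<delta> ^ j) / (\<alpha> ^ i' * \<delta> ^ j')) ^ m"
  proof -
    have "x powi (int m * (int e - int e')) = (x ^ e / x ^ e') ^ m" if "x \<noteq> 0" for x :: complex and e e'
      using that by (subst mult.commute) (simp add: power_int_mult power_int_diff)
    then show ?thesis using assms(1,2) unfolding a_def b_def
      by (simp flip: power_mult_distrib)
  qed
  moreover have "(a, b) \<noteq> (0, 0)" using ij by (auto simp: a_def b_def)
  ultimately show ?thesis using ij(3) by auto
qed

corollary index_and_exponential_on_rational_curve: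
  fixes a1 a2 b1 b2 :: "complex poly"
  assumes "\<delta> \<noteq> 0" and inf: "infinite S"
    and curve: "\<And>n. n \<in> S \<Longrightarrow> \<exists>w. poly a2 w \<noteq> 0 \<and> poly b2 w \<noteq> 0 \<and>
      of_nat n = poly a1 w / poly a2 w \<and> \<delta> ^ n = poly b1 w / poly b2 w"
  shows "root_of_unity \<delta>"
proof -
  obtain N c i0 j0 where c0: "i0 \<le> N" "j0 \<le> N" "c i0 j0 \<noteq> 0"
    and c: "\<And>w. poly a2 w \<noteq> 0 \<Longrightarrow> poly b2 w \<noteq> 0 \<Longrightarrow>
      (\<Sum>i\<le>N. \<Sum>j\<le>N. c i j * (poly a1 w / poly a2 w) ^ i * (poly b1 w / poly b2 w) ^ j) = (0::complex)"
    using rational_functions_dependent[of a2 b2 a1 b1] by blast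
  define P where "P j = (\<Sum>i\<le>N. monom (c i j) i)" for j
  have "\<exists>i\<in>{..N}. \<exists>j\<in>{..N}. i \<noteq> j \<and> root_of_unity ((1 ^ 0 * \<delta> ^ i) / (1 ^ 0 * \<delta> ^ j))"
  proof (rule skolem_two_generators[OF _ \<open>\<delta> \<noteq> 0\<close>, of _ _ j0 P "\<lambda>_. 0"])
    show "finite {..N}" "j0 \<in> {..N}" using c0 by auto
    have "coeff (P j0) i0 \<noteq> 0" using c0 by (simp add: P_def coeff_sum)
    then show "P j0 \<noteq> 0" by auto
    show "infinite {n. (\<Sum>j\<le>N. poly (P j) (of_nat n) * (1 ^ 0 * \<delta> ^ j) ^ n) = 0}"
    proof (rule infinite_super[OF _ inf], rule subsetI, rule CollectI)
      fix n assume "n \<in> S"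
      then obtain w where w: "poly a2 w \<noteq> 0" "poly b2 w \<noteq> 0"
        "of_nat n = poly a1 w / poly a2 w" "\<delta> ^ n = poly b1 w / poly b2 w" using curve by blast
      have "(\<Sum>j\<le>N. poly (P j) (of_nat n) * (1 ^ 0 * \<delta> ^ j) ^ n) =
        (\<Sum>j\<le>N. \<Sum>i\<le>N. c i j * of_nat n ^ i * (\<delta> ^ n) ^ j)"
        by (simp add: P_def poly_sum poly_monom sum_distrib_left mult_ac flip: power_mult)
      also have "\<dots> = 0"
        unfolding w(3,4) by (subst sum.swap) (rule c[OF w(1,2)])
      finally show "(\<Sum>j\<le>N. poly (P j) (of_nat n) * (1 ^ 0 * \<delta> ^ j) ^ n) = 0" .
    qed
  qed simp
  then obtain i j m where ij: "i \<noteq> j" "m > 0" "(\<delta> ^ i / \<delta> ^ j) ^ m = 1"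
    unfolding root_of_unity_def by auto
  have "(\<delta> ^ u / \<delta> ^ v) ^ m = \<delta> ^ ((u - v) * m)" if "u > v" for u v
    using that assms(1) by (simp add: power_mult power_diff)
  moreover have "(\<delta> ^ j / \<delta> ^ i) ^ m = 1"
    using ij(3) assms(1) by (simp add: power_divide)
  ultimately have "\<exists>h>0. \<delta> ^ h = 1"
    using ij by (cases "i < j") (metis linorder_neqE_nat nat_0_less_mult_iff zero_less_diff)+
  then show ?thesis unfolding root_of_unity_def by blast
qed

section \<open>Polynomial identities forced by multiplicative relations\<close>

lemma coprime_shift:
  fixes p q :: "complex poly"
  assumes "coprime p q"
  shows "coprime (p - smult u q) q" "u \<noteq> v \<Longrightarrow> coprime (p - smult u q) (p - smult v q)"
proof -
  show "coprime (p - smult u q) q"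
  proof (rule coprimeI)
    fix d assume d: "d dvd p - smult u q" "d dvd q"
    then have "d dvd (p - smult u q) + smult u q" by (intro dvd_add dvd_smult)
    then show "is_unit d" using d assms by (simp add: coprime_common_divisor)
  qed
  show "coprime (p - smult u q) (p - smult v q)" if "u \<noteq> v"
  proof (rule coprimeI)
    fix d assume d: "d dvd p - smult u q" "d dvd p - smult v q"
    then have "d dvd (p - smult u q) - (p - smult v q)" by (rule dvd_diff)
    also have "(p - smult u q) - (p - smult v q) = smult (v - u) q"
      by (simp add: smult_diff_left)
    finally have "d dvd q" using that by (simp add: dvd_smult_iff)
    moreover from this have "d dvd (p - smult u q) + smult u q" using d by (intro dvd_add dvd_smult)
    ultimately show "is_unit d" using assms by (simp add: coprime_common_divisor)
  qed
qed

lemma coprime_linear: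
  fixes r :: "complex poly"
  assumes "poly r v \<noteq> 0" shows "coprime [:- v, 1:] r"
proof (rule coprimeI)
  fix d assume d: "d dvd [:- v, 1:]" "d dvd r"
  have "d dvd r - [:- v, 1:] * synthetic_div r v"
    using d by (intro dvd_diff dvd_mult2)
  also have "r - [:- v, 1:] * synthetic_div r v = [:poly r v:]"
    using synthetic_div_correct'[of v r] by (metis add_diff_cancel_left')
  finally show "is_unit d" using assms
    by (metis dvd_trans is_unit_const_poly_iff is_unit_iff_degree degree_pCons_0 pCons_eq_0_iff)
qed

lemma coprime_linears: "u \<noteq> v \<Longrightarrow> coprime [:- u, 1:] [:- v, 1 :: complex:]"
  by (rule coprime_linear) simp

lemma coprime_no_common_root:
  fixes p q :: "complex poly"
  assumes "coprime p q" "poly q x = 0" shows "poly p x \<noteq> 0"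
proof
  assume "poly p x = 0"
  then have "[:- x, 1:] dvd p" "[:- x, 1:] dvd q"
    using assms(2) by (simp_all add: poly_eq_0_iff_dvd)
  then have "is_unit [:- x, 1:]" using assms(1) coprime_common_divisor by blast
  then show False by (simp add: is_unit_iff_degree)
qed

lemma coprime_divisor_constant:
  fixes q r :: "complex poly"
  assumes "coprime r q" "q dvd r" obtains q0 where "q = [:q0:]" "q0 \<noteq> 0"
proof -
  have "is_unit q" using assms by (metis coprime_common_divisor dvd_refl)
  then show thesis using that is_unit_poly_iff by (metis not_is_unit_0 pCons_0_0)
qed

text \<open>
After cancelling common powers only one side vanishes at $u$.
\<close>

lemma linear_powers_not_swapped:
  fixes u v k k' :: complex
  assumes "u \<noteq> v" "k \<noteq> 0" "k' \<noteq> 0" "a \<noteq> b"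
  shows "smult k ([:- v, 1:] ^ a * [:- u, 1:] ^ b) \<noteq> smult k' ([:- u, 1:] ^ a * [:- v, 1:] ^ b)"
proof -
  have *: False if "u \<noteq> v" "k \<noteq> 0" "k' \<noteq> 0" "a < b"
    and eq: "smult k ([:- v, 1:] ^ a * [:- u, 1:] ^ b) = smult k' ([:- u, 1:] ^ a * [:- v, 1:] ^ b)"
    for u v k k' :: complex and a b :: nat
  proof -
    have b: "r ^ b = r ^ a * r ^ (b - a)" for r :: "complex poly"
      using that by (simp flip: power_add)
    have "([:- v, 1:] ^ a * [:- u, 1:] ^ a) * smult k ([:- u, 1:] ^ (b - a)) =
        ([:- v, 1:] ^ a * [:- u, 1:] ^ a) * smult k' ([:- v, 1:] ^ (b - a))"
      using eq unfolding b by (simp add: mult_ac)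
    then have "smult k ([:- u, 1:] ^ (b - a)) = smult k' ([:- v, 1:] ^ (b - a))"
      by (simp only: mult_cancel_left) simp
    then have "poly (smult k ([:- u, 1:] ^ (b - a))) u = poly (smult k' ([:- v, 1:] ^ (b - a))) u"
      by simp
    then show False using that by (simp add: power_0_left)
  qed
  show ?thesis
  proof
    assume eq: "smult k ([:- v, 1:] ^ a * [:- u, 1:] ^ b) = smult k' ([:- u, 1:] ^ a * [:- v, 1:] ^ b)"
    show False
    proof (cases "a < b")
      case True
      then show ?thesis using *[OF assms(1-3) True eq] by simp
    next
      case False
      then have "b < a" using assms by simp
      then show ?thesis
        using eq[symmetric] *[OF assms(1) assms(3,2)] by (simp only: mult.commute)
    qed
  qed
qed

text \<open>
Substituting the affine map for the variable preserves a product of powers with different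
exponents at $u$ and $v$. The map permutes $u$ and $v$, the exponents prevent a transposition, and an affine
map with two fixed points is the identity.
\<close>

lemma affine_permuting_two_points:
  fixes p :: "complex poly"
  assumes "u \<noteq> v" "a > 0" "b > 0" "a \<noteq> b" and p: "p = [:l, k:]" "k \<noteq> 0" and "C \<noteq> 0"
    and eq: "(p - [:u:]) ^ a * (p - [:v:]) ^ b = smult C ([:- u, 1:] ^ a * [:- v, 1:] ^ b)"
  shows "p = [:0, 1:]"
proof -
  have eval: "poly ((p - [:u:]) ^ a * (p - [:v:]) ^ b) x = (l + k * x - u) ^ a * (l + k * x - v) ^ b"
    for x by (simp add: p algebra_simps)
  have "(l + k * u - u) ^ a * (l + k * u - v) ^ b = 0" "(l + k * v - u) ^ a * (l + k * v - v) ^ b = 0"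
    unfolding eval[symmetric] eq using assms by simp_all
  then have u: "l + k * u = u \<or> l + k * u = v" and v: "l + k * v = u \<or> l + k * v = v"
    unfolding mult_eq_0_iff power_eq_0_iff right_minus_eq by blast+
  have inj: "l + k * u \<noteq> l + k * v" using assms(1) p(2) by simp
  show ?thesis
  proof (cases "l + k * u = u")
    case True
    then have v: "l + k * v = v" using v inj by auto
    have "(k - 1) * (u - v) = (l + k * u - u) - (l + k * v - v)" by (simp add: algebra_simps)
    then have "k = 1" using assms(1) True v by simp
    then show ?thesis using True p by simp
  next
    case False
    then have 1: "l + k * u = v" and 2: "l + k * v = u" using u v inj by auto
    have "p - [:u:] = smult k [:- v, 1:]" "p - [:v:] = smult k [:- u, 1:]"
      unfolding p using 1 2 by (auto simp: algebra_simps)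
    then have "smult (k ^ (a + b)) ([:- v, 1:] ^ a * [:- u, 1:] ^ b) =
        smult C ([:- u, 1:] ^ a * [:- v, 1:] ^ b)"
      using eq by (simp only: smult_power mult_smult_left mult_smult_right smult_smult power_add mult_ac)
    moreover have "k ^ (a + b) \<noteq> 0" using p by simp
    ultimately show ?thesis using linear_powers_not_swapped assms(1,4,7) by metis
  qed
qed

lemma degree_minus_const:
  fixes p q :: "complex poly"
  assumes "degree q = 0" shows "degree (p - q) = degree p"
proof -
  obtain c where "q = [:c:]" using assms by (rule degree_eq_zeroE)
  then show ?thesis by (cases p) (simp add: degree_pCons_eq_if)
qed

lemma degree_shift:
  fixes p q :: "complex poly"
  assumes "degree q = 0" shows "degree (p - smult u q) = degree p"
  using assms by (intro degree_minus_const) simp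

text \<open>
With $c = p / q$ the identity is $(c - u)^a (c - v)^b = (x - u)^a (x - v)^b$. Its right-hand side has no finite
poles, so $c$ is a polynomial, and it is affine by degree.
\<close>

lemma common_fixed_point_product_identity:
  fixes p q :: "complex poly"
  assumes "u \<noteq> v" "coprime p q" "q \<noteq> 0" "a > 0" "b > 0" "a \<noteq> b"
    and eq: "(p - smult u q) ^ a * (p - smult v q) ^ b = [:- u, 1:] ^ a * [:- v, 1:] ^ b * q ^ (a + b)"
  shows "p = [:0, 1:] * q"
proof -
  have "coprime ((p - smult u q) ^ a * (p - smult v q) ^ b) q"
    using coprime_shift(1)[OF assms(2)] by simp
  moreover have "q dvd (p - smult u q) ^ a * (p - smult v q) ^ b"
    unfolding eq using assms(4) by (simp add: dvd_power)
  ultimately obtain q0 where q0: "q = [:q0:]" "q0 \<noteq> 0" by (rule coprime_divisor_constant)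
  have nz: "p - smult u q \<noteq> 0" "p - smult v q \<noteq> 0"
  proof -
    have "[:- u, 1:] ^ a * [:- v, 1:] ^ b * q ^ (a + b) \<noteq> 0" using assms(3) by simp
    then show "p - smult u q \<noteq> 0" "p - smult v q \<noteq> 0" unfolding eq[symmetric]
      using assms by (auto simp: power_0_left)
  qed
  have "degree ((p - smult u q) ^ a * (p - smult v q) ^ b) = (a + b) * degree p"
  proof -
    have "degree (p - smult c q) = degree p" for c
      by (rule degree_shift) (simp add: q0)
    then show ?thesis using nz by (simp add: degree_mult_eq degree_power_eq add_mult_distrib)
  qed
  moreover have "degree ([:- u, 1:] ^ a * [:- v, 1:] ^ b * q ^ (a + b)) = a + b"
    using q0 by (simp add: degree_mult_eq degree_power_eq)
  ultimately have "(a + b) * degree p = a + b" by (simp only: eq)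
  then have "degree p = 1" using assms by simp
  define p' where "p' = smult (1 / q0) p"
  then have p: "p = smult q0 p'" using q0 by simp
  have "degree p' = 1" using \<open>degree p = 1\<close> q0 by (simp add: p'_def)
  then obtain l k where lk: "p' = [:l, k:]" "k \<noteq> 0" by (metis degree1_coeffs)
  have sh: "p - smult c q = smult q0 (p' - [:c:])" for c
    using q0 by (simp add: p'_def smult_diff_right mult.commute)
  have "smult (q0 ^ (a + b)) ((p' - [:u:]) ^ a * (p' - [:v:]) ^ b) =
      smult (q0 ^ (a + b)) ([:- u, 1:] ^ a * [:- v, 1:] ^ b)"
    using eq unfolding sh using q0 by (simp add: smult_power power_add mult_ac poly_const_pow)
  then have "(p' - [:u:]) ^ a * (p' - [:v:]) ^ b = smult 1 ([:- u, 1:] ^ a * [:- v, 1:] ^ b)"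
    using q0(2) by (simp add: smult_eq_iff)
  from affine_permuting_two_points[OF assms(1,4-6) lk _ this]
  have "p' = [:0, 1:]" by simp
  then have "p = smult q0 [:0, 1:]" using q0 p by simp
  then show ?thesis by (simp add: q0)
qed

text \<open>
With $c = p / q$ the identity is $((c - u) / (x - u))^a = ((c - v) / (x - v))^b$. By coprimality
$p - u q$ is a multiple of $x - u$, and $(x - v)^b$ is a constant multiple of $(p - v q)^b q^{a - b}$. One of the two coprime
factors \<open>q\<close> and $p - v q$ is then constant. A constant \<open>q\<close> gives an affine $c$ fixing $u$ and $v$; otherwise \<open>q\<close> is
linear, and the degrees give $b = a - b$.
\<close>

lemma common_fixed_point_quotient_identity:
  fixes p q :: "complex poly"
  assumes "u \<noteq> v" "coprime p q" "q \<noteq> 0" "b > 0" "b < a"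
    and eq: "(p - smult u q) ^ a * [:- v, 1:] ^ b = [:- u, 1:] ^ a * (p - smult v q) ^ b * q ^ (a - b)"
  shows "p = [:0, 1:] * q \<or> a = 2 * b"
proof -
  define P V where "P = p - smult u q" and "V = p - smult v q"
  note eq = eq[folded P_def V_def]
  have cop: "coprime P q" "coprime V q" "coprime P V"
    using coprime_shift[OF assms(2)] assms(1) unfolding P_def V_def by auto
  have nz: "P \<noteq> 0" "V \<noteq> 0"
  proof -
    have "V \<noteq> 0 \<or> P \<noteq> 0" "V = 0 \<longrightarrow> P = 0"
      using cop(3) eq assms by (auto simp: power_0_left)
    then have "V \<noteq> 0" by blast
    then have "[:- u, 1:] ^ a * V ^ b * q ^ (a - b) \<noteq> 0" using assms(3) by simp
    then show "P \<noteq> 0" "V \<noteq> 0" unfolding eq[symmetric] using assms by (auto simp: power_0_left \<open>V \<noteq> 0\<close>)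
  qed
  have "P ^ a dvd [:- u, 1:] ^ a * (V ^ b * q ^ (a - b))"
    unfolding mult.assoc[symmetric] eq[symmetric] by simp
  moreover have "coprime (P ^ a) (V ^ b * q ^ (a - b))" using cop by simp
  ultimately have "P ^ a dvd [:- u, 1:] ^ a" by (simp add: coprime_dvd_mult_left_iff)
  then have 1: "P dvd [:- u, 1:]" using assms by (simp add: pow_divides_pow_iff)
  have "[:- u, 1:] ^ a dvd P ^ a * [:- v, 1:] ^ b" unfolding eq by (simp add: mult.assoc)
  moreover have "coprime ([:- u, 1:] ^ a) ([:- v, 1:] ^ b)"
    using coprime_linears[OF assms(1)] by simp
  ultimately have "[:- u, 1:] ^ a dvd P ^ a" by (simp add: coprime_dvd_mult_left_iff)
  then have "[:- u, 1:] dvd P" using assms by (simp only: pow_divides_pow_iff)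
  then obtain r where r: "P = [:- u, 1:] * r" by (elim dvdE)
  have "degree P \<le> 1" using dvd_imp_degree_le[OF 1] by simp
  moreover have "r \<noteq> 0" using nz r by auto
  ultimately have "degree r = 0" using r by (simp add: degree_mult_eq del: mult_pCons_left)
  then obtain \<kappa> where "r = [:\<kappa>:]" by (rule degree_eq_zeroE)
  then have P: "P = smult \<kappa> [:- u, 1:]" and \<kappa>: "\<kappa> \<noteq> 0" using r \<open>r \<noteq> 0\<close> by auto
  have "[:- u, 1:] ^ a * smult (\<kappa> ^ a) ([:- v, 1:] ^ b) = [:- u, 1:] ^ a * (V ^ b * q ^ (a - b))"
    using eq by (simp only: P smult_power mult_smult_left mult_smult_right mult_ac)
  then have eq2: "smult (\<kappa> ^ a) ([:- v, 1:] ^ b) = V ^ b * q ^ (a - b)"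
    by (simp only: mult_cancel_left) simp
  have PV: "P = V + smult (v - u) q" by (simp add: P_def V_def smult_diff_left)
  show ?thesis
  proof (cases "poly q v = 0")
    case False
    have "q dvd V ^ b * q ^ (a - b)" using assms by (simp add: dvd_power)
    then have "q dvd [:- v, 1:] ^ b" unfolding eq2[symmetric] using \<kappa> by (simp add: dvd_smult_iff)
    moreover have "coprime ([:- v, 1:] ^ b) q" using coprime_linear[OF False] by simp
    ultimately obtain q0 where q0: "q = [:q0:]" "q0 \<noteq> 0"
      by (metis coprime_divisor_constant)
    have "poly (V ^ b * q ^ (a - b)) v = 0" unfolding eq2[symmetric] using assms by simp
    then have "poly V v = 0" using False by auto
    then have "poly P v = (v - u) * q0" unfolding PV by (simp add: q0)
    then have "(v - u) * \<kappa> = (v - u) * q0" unfolding P by (simp add: algebra_simps)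
    then have "\<kappa> = q0" using assms(1) by simp
    then have "p = smult q0 [:0, 1:]" using P q0 unfolding P_def by (simp add: algebra_simps)
    then show ?thesis by (simp add: q0)
  next
    case True
    have "poly V v \<noteq> 0" using coprime_no_common_root[OF cop(2) True] .
    have "V dvd V ^ b * q ^ (a - b)" using assms by (simp add: dvd_power)
    then have "V dvd [:- v, 1:] ^ b" unfolding eq2[symmetric] using \<kappa> by (simp add: dvd_smult_iff)
    moreover have "coprime ([:- v, 1:] ^ b) V" using coprime_linear[OF \<open>poly V v \<noteq> 0\<close>] by simp
    ultimately have V: "degree V = 0" by (metis coprime_divisor_constant degree_pCons_0)
    have "degree P = 1" unfolding P using \<kappa> by simp
    then have "degree (P - V) = 1" using V by (simp add: degree_minus_const)
    then have "degree (smult (v - u) q) = 1" by (simp add: PV)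
    then have "degree q = 1" using assms(1) by simp
    have "degree (smult (\<kappa> ^ a) ([:- v, 1:] ^ b)) = b" using \<kappa> by (simp add: degree_power_eq)
    moreover have "degree (V ^ b * q ^ (a - b)) = a - b"
      using nz assms(3) V \<open>degree q = 1\<close> by (simp add: degree_mult_eq degree_power_eq)
    ultimately have "a - b = b" by (simp only: eq2)
    then have "a = 2 * b" using assms(5) by linarith
    then show ?thesis ..
  qed
qed

text \<open>
With $c = p / q$ the identity says that the function $h(x) = (x - u)^a ((x - w_1) / (x - w_2))^b$ satisfies
$h(c(x)) = h(x)$. Comparing poles shows that $c$ takes the values $w_2$ and $\infty$ at no
finite point other than $w_2$. Either \<open>q\<close> is constant and $c$ is affine, or \<open>q\<close> vanishes at $w_2$ and
$p - w_2 q$ is constant; then the degrees force \<open>q\<close> to be linear and the orders $b$ and $a$ of the poles of $h$ at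
$w_2$ and $\infty$ to be equal.
\<close>

lemma no_common_fixed_point_identity:
  fixes p q :: "complex poly"
  assumes dist: "u \<noteq> w1" "u \<noteq> w2" "w1 \<noteq> w2" and "coprime p q" "q \<noteq> 0" "a > 0" "b > 0"
    and eq: "(p - smult u q) ^ a * (p - smult w1 q) ^ b * [:- w2, 1:] ^ b =
      [:- u, 1:] ^ a * [:- w1, 1:] ^ b * (p - smult w2 q) ^ b * q ^ a"
  shows "a = b \<or> p = [:0, 1:] * q"
proof -
  define P W V where "P = p - smult u q" and "W = p - smult w1 q" and "V = p - smult w2 q"
  note eq = eq[folded P_def W_def V_def]
  have cop: "coprime P q" "coprime W q" "coprime V q" "coprime P V" "coprime W V"
    using coprime_shift[OF assms(4)] dist unfolding P_def V_def W_def by auto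
  define X where "X = P ^ a * W ^ b"
  define Y where "Y = V ^ b * q ^ a"
  define L where "L = [:- u, 1:] ^ a * [:- w1, 1:] ^ b"
  define M where "M = [:- w2, 1:] ^ b"
  have eq': "X * M = L * Y" using eq by (simp add: X_def Y_def L_def M_def mult_ac)
  have XY: "coprime X Y" using cop by (simp add: X_def Y_def)
  have LM: "coprime L M" using coprime_linears dist by (simp add: L_def M_def)
  have "X dvd L * Y" "Y dvd X * M" "L dvd X * M" "M dvd L * Y"
    using eq' by (metis dvd_triv_left dvd_triv_right)+
  then have dvd: "X dvd L" "Y dvd M" "L dvd X" "M dvd Y"
    using XY LM by (simp_all add: coprime_dvd_mult_left_iff coprime_dvd_mult_right_iff coprime_commute)
  have LM0: "L \<noteq> 0" "M \<noteq> 0" by (simp_all add: L_def M_def)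
  then have XY0: "X \<noteq> 0" "Y \<noteq> 0" using dvd by auto
  then have nz: "P \<noteq> 0" "W \<noteq> 0" "V \<noteq> 0" using assms(6,7) by (auto simp: X_def Y_def)
  have degX: "degree X = a + b"
    using dvd_imp_degree_le[OF dvd(1) LM0(1)] dvd_imp_degree_le[OF dvd(3) XY0(1)]
    by (simp add: L_def degree_mult_eq degree_power_eq)
  have degY: "degree Y = b"
    using dvd_imp_degree_le[OF dvd(2) LM0(2)] dvd_imp_degree_le[OF dvd(4) XY0(2)]
    by (simp add: M_def degree_power_eq)
  show ?thesis
  proof (cases "poly q w2 = 0")
    case False
    have "q dvd Y" using assms by (simp add: Y_def dvd_power)
    then have "q dvd M" using dvd dvd_trans by blast
    moreover have "coprime M q" using coprime_linear[OF False] by (simp add: M_def)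
    ultimately obtain q0 where q0: "q = [:q0:]" "q0 \<noteq> 0"
      by (metis coprime_divisor_constant)
    define p' where "p' = smult (1 / q0) p"
    then have p: "p = smult q0 p'" using q0 by simp
    have sh: "p - smult c q = smult q0 (p' - [:c:])" for c
      using q0 by (simp add: p'_def smult_diff_right mult.commute)
    have "degree V = 1" using degY nz assms q0 by (simp add: Y_def degree_mult_eq degree_power_eq)
    then have "degree p = 1" using degree_shift[of q p w2] q0 by (simp add: V_def)
    then have "degree p' = 1" using q0 by (simp add: p'_def)
    then obtain l k where lk: "p' = [:l, k:]" "k \<noteq> 0" by (metis degree1_coeffs)
    obtain r where r: "L = X * r" using dvd(1) by (elim dvdE)
    have "r \<noteq> 0" using r LM0 by auto
    have "degree L = a + b" by (simp add: L_def degree_mult_eq degree_power_eq)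
    then have "degree r = 0" using r degX XY0 \<open>r \<noteq> 0\<close> by (simp add: degree_mult_eq)
    then obtain C where C: "r = [:C:]" by (rule degree_eq_zeroE)
    have "C \<noteq> 0" using \<open>r \<noteq> 0\<close> C by simp
    have "L = smult (q0 ^ (a + b) * C) ((p' - [:u:]) ^ a * (p' - [:w1:]) ^ b)"
      unfolding r C X_def P_def W_def sh by (simp add: smult_power power_add mult_ac)
    then have Lp: "(p' - [:u:]) ^ a * (p' - [:w1:]) ^ b = smult (1 / (q0 ^ (a + b) * C)) L"
      using q0 \<open>C \<noteq> 0\<close> by simp
    show ?thesis
    proof (cases "a = b")
      case False
      have "p' = [:0, 1:]"
        using affine_permuting_two_points[OF dist(1) assms(6,7) False lk _ Lp[unfolded L_def]]
          q0 \<open>C \<noteq> 0\<close> by simp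
      then have "p = smult q0 [:0, 1:]" using q0 p by simp
      then show ?thesis by (simp add: q0)
    qed simp
  next
    case True
    have "poly V w2 \<noteq> 0" using coprime_no_common_root[OF cop(3) True] .
    have "V dvd Y" using assms by (simp add: Y_def dvd_power)
    then have "V dvd M" using dvd dvd_trans by blast
    moreover have "coprime M V" using coprime_linear[OF \<open>poly V w2 \<noteq> 0\<close>] by (simp add: M_def)
    ultimately have V: "degree V = 0" by (metis coprime_divisor_constant degree_pCons_0)
    then have k: "a * degree q = b" using degY nz assms by (simp add: Y_def degree_mult_eq degree_power_eq)
    then have "degree q > 0" using assms by (metis mult_0_right neq0_conv)
    have deg: "degree (p - smult c q) = degree q" if "c \<noteq> w2" for c
    proof -
      have "p - smult c q = V + smult (w2 - c) q" by (simp add: V_def smult_diff_left)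
      then show ?thesis using that V \<open>degree q > 0\<close> by (simp add: degree_add_eq_right)
    qed
    have "degree X = (a + b) * degree q"
      using nz deg dist unfolding X_def P_def W_def
      by (simp add: degree_mult_eq degree_power_eq add_mult_distrib)
    then have "degree q = 1" using degX assms by simp
    then show ?thesis using k by simp
  qed
qed

section \<open>From coincidences of iterates to relations between multipliers\<close>

lemma poly_eq_if_infinite:
  fixes p q :: "complex poly"
  assumes "infinite X" "\<And>x. x \<in> X \<Longrightarrow> poly p x = poly q x" shows "p = q"
proof (rule ccontr)
  assume "p \<noteq> q"
  then have "finite {x. poly (p - q) x = 0}" by (intro poly_roots_finite) simp
  moreover have "X \<subseteq> {x. poly (p - q) x = 0}" using assms(2) by auto
  ultimately show False using assms(1) finite_subset by blast
qed

lemma power_inj_if_not_root_of_unity: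
  assumes "\<not> root_of_unity \<alpha>" "\<alpha> \<noteq> 0" "\<alpha> ^ m = \<alpha> ^ n" shows "m = n"
proof (rule ccontr)
  assume "m \<noteq> n"
  have *: False if "i < j" "\<alpha> ^ i = \<alpha> ^ j" for i j
  proof -
    have "\<alpha> ^ j = \<alpha> ^ i * \<alpha> ^ (j - i)" using that(1) by (simp flip: power_add)
    then have "\<alpha> ^ (j - i) = 1" using that(2) assms(2) by simp
    then show False using that(1) assms(1) unfolding root_of_unity_def by (meson zero_less_diff)
  qed
  show False using *[of m n] *[of n m] assms(3) \<open>m \<noteq> n\<close> by (cases "m < n") auto
qed

lemma root_of_unityI: "n > 0 \<Longrightarrow> z ^ n = 1 \<Longrightarrow> root_of_unity z"
  unfolding root_of_unity_def by blast

text \<open>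
Neither exponent can vanish, so up to inversion the relation has one of two sign patterns.
\<close>

lemma natural_multiplicative_relation:
  fixes a b :: int
  assumes nz: "\<alpha> \<noteq> 0" "\<delta> \<noteq> 0" and nr: "\<not> root_of_unity \<alpha>" "\<not> root_of_unity \<delta>"
    and ab: "(a, b) \<noteq> (0, 0)" "\<alpha> powi a * \<delta> powi b = 1"
  obtains m k :: nat where "m > 0" "k > 0" "\<alpha> ^ m * \<delta> ^ k = 1 \<or> \<alpha> ^ m = \<delta> ^ k"
proof -
  have zero: "c = 0" if "x powi c = 1" "\<not> root_of_unity x" "x \<noteq> 0" for x :: complex and c
  proof (rule ccontr)
    assume "c \<noteq> 0"
    have "x ^ nat \<bar>c\<bar> = 1"
      using that by (cases "c \<ge> 0") (auto simp: power_int_def power_inverse)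
    then show False using that(2) \<open>c \<noteq> 0\<close> root_of_unityI[of "nat \<bar>c\<bar>" x] by simp
  qed
  have "a \<noteq> 0"
  proof
    assume "a = 0"
    then have "\<delta> powi b = 1" using ab by simp
    then show False using zero nr nz ab \<open>a = 0\<close> by blast
  qed
  have "b \<noteq> 0"
  proof
    assume "b = 0"
    then have "\<alpha> powi a = 1" using ab by simp
    then show False using zero nr nz \<open>a \<noteq> 0\<close> by blast
  qed
  define m k where "m = nat \<bar>a\<bar>" and "k = nat \<bar>b\<bar>"
  have "\<alpha> ^ m * \<delta> ^ k = 1 \<or> \<alpha> ^ m = \<delta> ^ k"
    using ab(2) nz unfolding m_def k_def
    by (cases "a \<ge> 0"; cases "b \<ge> 0") (auto simp: power_int_def power_inverse field_simps)
  then show thesis using that[of m k] \<open>a \<noteq> 0\<close> \<open>b \<noteq> 0\<close> by (simp add: m_def k_def)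
qed

text \<open>
The point $w_n$ determines $\alpha^n$ and therefore $n$.
\<close>

lemma infinite_image_of_times:
  assumes inf: "infinite S" and \<alpha>: "\<alpha> \<noteq> 0" "\<not> root_of_unity \<alpha>"
    and w: "\<And>n. n \<in> S \<Longrightarrow> \<alpha> ^ n * (w n - u) + u = h (w n)" "\<And>n. n \<in> S \<Longrightarrow> w n \<noteq> u"
  shows "infinite (w ` S)"
proof
  assume "finite (w ` S)"
  moreover have "inj_on w S"
  proof (rule inj_onI)
    fix m n assume mn: "m \<in> S" "n \<in> S" "w m = w n"
    have "\<alpha> ^ m * (w n - u) + u = \<alpha> ^ n * (w n - u) + u"
      using w(1)[OF mn(1)] w(1)[OF mn(2)] unfolding mn(3) by (rule trans[OF _ sym])
    then have "\<alpha> ^ m = \<alpha> ^ n" using w(2)[OF mn(2)] by simp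
    then show "m = n" using power_inj_if_not_root_of_unity \<alpha> by blast
  qed
  ultimately show False using inf finite_imageD by blast
qed

text \<open>
The situation after normalization when both maps fix $\infty$ and have second fixed points $u \neq v$; the
quotient $p / q$ stands for $c$. The point \<open>w\<close> differs from $u$ and $v$, since a fixed point of one map
would also be fixed by an iterate of the other. Hence $\alpha^n = (c - u) / (w - u)$ and
$\delta^n = (c - v) / (w - v)$ at \<open>w\<close>. If $\alpha = \delta$, there is no such \<open>w\<close> at all, because
$(\alpha^n - 1)(u - v)$ is nonzero.
\<close>

theorem common_fixed_point_relation:
  fixes p q :: "complex poly"
  assumes uv: "u \<noteq> v" and pq: "coprime p q" "q \<noteq> 0" and nz: "\<alpha> \<noteq> 0" "\<delta> \<noteq> 0"
    and nr: "\<not> root_of_unity \<alpha>" "\<not> root_of_unity \<delta>" and inf: "infinite S"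
    and S: "\<And>n. n \<in> S \<Longrightarrow> n > 0 \<and> (\<exists>w. poly q w \<noteq> 0 \<and>
      \<alpha> ^ n * (w - u) + u = poly p w / poly q w \<and> \<delta> ^ n * (w - v) + v = poly p w / poly q w)"
  shows "root_of_unity (\<alpha> / \<delta>) \<and> \<alpha> \<noteq> \<delta> \<or> root_of_unity (\<alpha>\<^sup>2 / \<delta>) \<or> root_of_unity (\<delta>\<^sup>2 / \<alpha>) \<or>
    root_of_unity (\<alpha> * \<delta>)"
proof -
  obtain w where w: "\<And>n. n \<in> S \<Longrightarrow> poly q (w n) \<noteq> 0"
    "\<And>n. n \<in> S \<Longrightarrow> \<alpha> ^ n * (w n - u) + u = poly p (w n) / poly q (w n)"
    "\<And>n. n \<in> S \<Longrightarrow> \<delta> ^ n * (w n - v) + v = poly p (w n) / poly q (w n)"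
    using S by metis
  have ne: "\<alpha> ^ n \<noteq> 1" "\<delta> ^ n \<noteq> 1" if "n \<in> S" for n
    using S[OF that] nr root_of_unityI by blast+
  have "w n \<noteq> u" if "n \<in> S" for n
  proof
    assume "w n = u"
    then have "\<delta> ^ n * (u - v) + v = u" using w(2,3)[OF that] by simp
    then have "(\<delta> ^ n - 1) * (u - v) = 0" by (simp add: algebra_simps)
    then show False using ne[OF that] uv by simp
  qed
  moreover have "w n \<noteq> v" if "n \<in> S" for n
  proof
    assume "w n = v"
    then have "\<alpha> ^ n * (v - u) + u = v" using w(2,3)[OF that] by simp
    then have "(\<alpha> ^ n - 1) * (v - u) = 0" by (simp add: algebra_simps)
    then show False using ne[OF that] uv by simp
  qed
  ultimately have wuv: "w n \<noteq> u" "w n \<noteq> v" if "n \<in> S" for n using that by auto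
  have A: "poly (p - smult u q) (w n) = \<alpha> ^ n * (poly q (w n) * (w n - u))"
    and B: "poly (p - smult v q) (w n) = \<delta> ^ n * (poly q (w n) * (w n - v))" if "n \<in> S" for n
    using w[OF that] by (simp_all add: field_simps)
  note identity = poly_eq_if_infinite[OF infinite_image_of_times[OF inf nz(1) nr(1) w(2) wuv(1)]]
  have not_id: "p \<noteq> [:0, 1:] * q"
  proof
    assume p: "p = [:0, 1:] * q"
    obtain n where n: "n \<in> S" using inf by (metis finite.emptyI equals0I)
    have "\<alpha> ^ n * (w n - u) + u = w n" using w[OF n] by (simp add: p)
    then have "(\<alpha> ^ n - 1) * (w n - u) = 0" by (simp add: algebra_simps)
    then show False using ne[OF n] wuv[OF n] by simp
  qed
  have "\<exists>a b :: int. (a, b) \<noteq> (0, 0) \<and> \<alpha> powi a * \<delta> powi b = 1"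
  proof (rule two_exponentials_on_rational_curve[OF nz inf])
    fix n assume n: "n \<in> S"
    show "\<exists>w. poly (q * [:- u, 1:]) w \<noteq> 0 \<and> poly (q * [:- v, 1:]) w \<noteq> 0 \<and>
      \<alpha> ^ n = poly (p - smult u q) w / poly (q * [:- u, 1:]) w \<and>
      \<delta> ^ n = poly (p - smult v q) w / poly (q * [:- v, 1:]) w"
      using w(1)[OF n] wuv[OF n] by (intro exI[of _ "w n"]) (auto simp only: A[OF n] B[OF n] poly_mult, auto)
  qed
  then obtain m k where mk: "m > 0" "k > 0" "\<alpha> ^ m * \<delta> ^ k = 1 \<or> \<alpha> ^ m = \<delta> ^ k"
    using natural_multiplicative_relation[OF nz nr] by metis
  from mk(3) show ?thesis
  proof
    assume rel: "\<alpha> ^ m * \<delta> ^ k = 1"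
    have "m = k"
    proof (rule ccontr)
      assume "m \<noteq> k"
      have "(p - smult u q) ^ m * (p - smult v q) ^ k = [:- u, 1:] ^ m * [:- v, 1:] ^ k * q ^ (m + k)"
      proof (rule identity)
        fix x assume "x \<in> w ` S"
        then obtain n where n: "n \<in> S" "x = w n" by blast
        have "(\<alpha> ^ n) ^ m * (\<delta> ^ n) ^ k = (\<alpha> ^ m * \<delta> ^ k) ^ n"
          by (simp add: power_mult_distrib mult.commute flip: power_mult)
        then have "(\<alpha> ^ n) ^ m * (\<delta> ^ n) ^ k = 1" using rel by simp
        moreover have "poly ((p - smult u q) ^ m * (p - smult v q) ^ k) x =
            ((\<alpha> ^ n) ^ m * (\<delta> ^ n) ^ k) * (poly q x ^ (m + k) * (x - u) ^ m * (x - v) ^ k)"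
          unfolding n(2) poly_mult poly_power A[OF n(1)] B[OF n(1)]
          by (simp only: power_mult_distrib power_add mult_ac)
        ultimately show "poly ((p - smult u q) ^ m * (p - smult v q) ^ k) x =
          poly ([:- u, 1:] ^ m * [:- v, 1:] ^ k * q ^ (m + k)) x"
          by (simp add: mult_ac)
      qed
      then show False using common_fixed_point_product_identity[OF uv pq mk(1,2) \<open>m \<noteq> k\<close>] not_id by blast
    qed
    then have "(\<alpha> * \<delta>) ^ m = 1" using rel by (simp add: power_mult_distrib)
    then show ?thesis using mk root_of_unityI by blast
  next
    assume rel: "\<alpha> ^ m = \<delta> ^ k"
    have rel': "(\<alpha> ^ n) ^ m = (\<delta> ^ n) ^ k" for n
      using rel by (metis power_mult mult.commute)
    \<comment> \<open>stated for arbitrary parameters so that it serves both for $k < m$ and, with the two maps exchanged, for $m < k$\<close>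
    have double: "m' = 2 * k'"
      if uv': "u' \<noteq> v'" and k': "0 < k'" "k' < m'"
        and A': "\<And>n. n \<in> S \<Longrightarrow> poly (p - smult u' q) (w n) = \<alpha>' ^ n * (poly q (w n) * (w n - u'))"
        and B': "\<And>n. n \<in> S \<Longrightarrow> poly (p - smult v' q) (w n) = \<delta>' ^ n * (poly q (w n) * (w n - v'))"
        and rel': "\<And>n. (\<alpha>' ^ n) ^ m' = (\<delta>' ^ n) ^ k'"
      for u' v' \<alpha>' \<delta>' :: complex and m' k' :: nat
    proof -
      have "(p - smult u' q) ^ m' * [:- v', 1:] ^ k' =
        [:- u', 1:] ^ m' * (p - smult v' q) ^ k' * q ^ (m' - k')"
      proof (rule identity)
        fix x assume "x \<in> w ` S"
        then obtain n where n: "n \<in> S" "x = w n" by blast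
        have q: "poly q x ^ m' = poly q x ^ k' * poly q x ^ (m' - k')"
          using k'(2) by (simp flip: power_add)
        have "poly ((p - smult u' q) ^ m' * [:- v', 1:] ^ k') x =
            (\<alpha>' ^ n) ^ m' * (poly q x ^ m' * (x - u') ^ m' * (x - v') ^ k')"
          unfolding n(2) poly_mult poly_power A'[OF n(1)] by (simp add: power_mult_distrib)
        also have "\<dots> = poly ([:- u', 1:] ^ m' * (p - smult v' q) ^ k' * q ^ (m' - k')) x"
          unfolding poly_mult poly_power rel' q unfolding n(2) B'[OF n(1)]
          by (simp add: power_mult_distrib mult_ac)
        finally show "poly ((p - smult u' q) ^ m' * [:- v', 1:] ^ k') x =
          poly ([:- u', 1:] ^ m' * (p - smult v' q) ^ k' * q ^ (m' - k')) x" .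
      qed
      then show ?thesis
        using common_fixed_point_quotient_identity[OF uv' pq k'] not_id by blast
    qed
    consider "m = k" | "k < m" | "m < k" by linarith
    then show ?thesis
    proof cases
      case 1
      have "\<alpha> \<noteq> \<delta>"
      proof
        assume "\<alpha> = \<delta>"
        obtain n where n: "n \<in> S" using inf by (metis finite.emptyI equals0I)
        have "\<alpha> ^ n * (w n - u) + u = \<alpha> ^ n * (w n - v) + v"
          using w[OF n] \<open>\<alpha> = \<delta>\<close> by simp
        then have "(\<alpha> ^ n - 1) * (u - v) = 0" by (simp add: algebra_simps)
        then show False using ne[OF n] uv by simp
      qed
      moreover have "(\<alpha> / \<delta>) ^ m = 1" using rel 1 nz by (simp add: power_divide)
      ultimately show ?thesis using mk root_of_unityI by blast
    next
      case 2
      then have "m = 2 * k" using double[OF uv mk(2) _ A B rel'] by blast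
      then have "(\<alpha>\<^sup>2 / \<delta>) ^ k = 1" using rel nz by (simp add: power_divide flip: power_mult)
      then show ?thesis using mk root_of_unityI by blast
    next
      case 3
      then have "k = 2 * m" using double[OF uv[symmetric] mk(1) _ B A rel'[symmetric]] by blast
      then have "(\<delta>\<^sup>2 / \<alpha>) ^ m = 1" using rel nz by (simp add: power_divide flip: power_mult)
      then show ?thesis using mk root_of_unityI by blast
    qed
  qed
qed

text \<open>
Here the first map fixes $u$ and $\infty$, the second $w_1$ and $w_2$. The second coincidence condition is
$\delta^n = ((c - w_1) / (w - w_1)) \cdot ((w - w_2) / (c - w_2))$ without denominators. Exchanging $w_1$ and $w_2$ replaces
$\delta$ by its inverse, which reduces the relation $\alpha^m = \delta^k$ to the same identity as $\alpha^m \delta^k = 1$.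
\<close>

theorem no_common_fixed_point_relation:
  fixes p q :: "complex poly"
  assumes dist: "u \<noteq> w1" "u \<noteq> w2" "w1 \<noteq> w2" and pq: "coprime p q" "q \<noteq> 0"
    and nz: "\<alpha> \<noteq> 0" "\<delta> \<noteq> 0"
    and nr: "\<not> root_of_unity \<alpha>" "\<not> root_of_unity \<delta>" and inf: "infinite S"
    and S: "\<And>n. n \<in> S \<Longrightarrow> n > 0 \<and> (\<exists>w. poly q w \<noteq> 0 \<and>
      \<alpha> ^ n * (w - u) + u = poly p w / poly q w \<and>
      \<delta> ^ n * (w - w1) * (poly p w / poly q w - w2) = (poly p w / poly q w - w1) * (w - w2))"
  shows "root_of_unity (\<alpha> / \<delta>) \<or> root_of_unity (\<alpha> * \<delta>)"
proof -
  obtain w where w: "\<And>n. n \<in> S \<Longrightarrow> poly q (w n) \<noteq> 0"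
    "\<And>n. n \<in> S \<Longrightarrow> \<alpha> ^ n * (w n - u) + u = poly p (w n) / poly q (w n)"
    "\<And>n. n \<in> S \<Longrightarrow> \<delta> ^ n * (w n - w1) * (poly p (w n) / poly q (w n) - w2) =
      (poly p (w n) / poly q (w n) - w1) * (w n - w2)"
    using S by metis
  define c where "c n = poly p (w n) / poly q (w n)" for n
  note w = w[folded c_def]
  have ne: "\<alpha> ^ n \<noteq> 1" "\<delta> ^ n \<noteq> 1" if "n \<in> S" for n
    using S[OF that] nr root_of_unityI by blast+
  have wu: "w n \<noteq> u" if n: "n \<in> S" for n
  proof
    assume u: "w n = u"
    then have "c n = u" using w(2)[OF n] by simp
    then have "(\<delta> ^ n - 1) * ((u - w1) * (u - w2)) = 0"
      using w(3)[OF n] u by (simp add: algebra_simps)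
    then show False using ne[OF n] dist by simp
  qed
  have fix_imp: "c n \<noteq> w n" if n: "n \<in> S" for n
  proof
    assume "c n = w n"
    then have "(\<alpha> ^ n - 1) * (w n - u) = 0" using w(2)[OF n] by (simp add: algebra_simps)
    then show False using ne[OF n] wu[OF n] by simp
  qed
  have w1: "w n \<noteq> w1" if n: "n \<in> S" for n
    using w(3)[OF n] fix_imp[OF n] dist by auto
  have w2: "w n \<noteq> w2" if n: "n \<in> S" for n
    using w(3)[OF n] fix_imp[OF n] dist nz by auto
  have c2: "c n \<noteq> w2" if n: "n \<in> S" for n
    using w(3)[OF n] w2[OF n] dist by auto
  have cq: "poly (p - smult x q) (w n) = poly q (w n) * (c n - x)" if "n \<in> S" for n x
    using w(1)[OF that] by (simp add: c_def field_simps)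
  have "infinite (w ` S)"
    by (rule infinite_image_of_times[OF inf nz(1) nr(1), where h = "\<lambda>x. poly p x / poly q x"])
       (use w(2) wu in \<open>auto simp: c_def\<close>)
  note identity = poly_eq_if_infinite[OF this]
  have not_id: "p \<noteq> [:0, 1:] * q"
  proof
    assume p: "p = [:0, 1:] * q"
    obtain n where n: "n \<in> S" using inf by (metis finite.emptyI equals0I)
    then have "c n = w n" using w(1)[OF n] by (simp add: p c_def)
    then show False using fix_imp n by blast
  qed
  have "\<exists>a b :: int. (a, b) \<noteq> (0, 0) \<and> \<alpha> powi a * \<delta> powi b = 1"
  proof (rule two_exponentials_on_rational_curve[OF nz inf])
    fix n assume n: "n \<in> S"
    have "c n - u = \<alpha> ^ n * (w n - u)" using w(2)[OF n] by (simp add: algebra_simps)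
    then have "\<alpha> ^ n = poly (p - smult u q) (w n) / poly (q * [:- u, 1:]) (w n)"
      unfolding poly_mult cq[OF n] using w(1)[OF n] wu[OF n] by simp
    moreover have "poly (q * [:- u, 1:]) (w n) \<noteq> 0" using w(1)[OF n] wu[OF n] by simp
    moreover have nz2: "poly ((p - smult w2 q) * [:- w1, 1:]) (w n) \<noteq> 0"
      unfolding poly_mult cq[OF n] using w(1)[OF n] c2[OF n] w1[OF n] by simp
    moreover have "\<delta> ^ n = poly ((p - smult w1 q) * [:- w2, 1:]) (w n) /
        poly ((p - smult w2 q) * [:- w1, 1:]) (w n)"
    proof -
      have "poly ((p - smult w1 q) * [:- w2, 1:]) (w n) =
          poly q (w n) * ((c n - w1) * (w n - w2))"
        unfolding poly_mult cq[OF n] by (simp add: mult_ac)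
      also have "\<dots> = \<delta> ^ n * poly ((p - smult w2 q) * [:- w1, 1:]) (w n)"
        unfolding poly_mult cq[OF n] w(3)[OF n, symmetric] by (simp add: mult_ac)
      finally show ?thesis using nz2 by simp
    qed
    ultimately show "\<exists>w. poly (q * [:- u, 1:]) w \<noteq> 0 \<and> poly ((p - smult w2 q) * [:- w1, 1:]) w \<noteq> 0 \<and>
      \<alpha> ^ n = poly (p - smult u q) w / poly (q * [:- u, 1:]) w \<and>
      \<delta> ^ n = poly ((p - smult w1 q) * [:- w2, 1:]) w / poly ((p - smult w2 q) * [:- w1, 1:]) w"
      by blast
  qed
  then obtain m k where mk: "m > 0" "k > 0" "\<alpha> ^ m * \<delta> ^ k = 1 \<or> \<alpha> ^ m = \<delta> ^ k"
    using natural_multiplicative_relation[OF nz nr] by metis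
  have au: "c n - u = \<alpha> ^ n * (w n - u)" if "n \<in> S" for n
    using w(2)[OF that] by (simp add: algebra_simps)
  from mk(3) show ?thesis
  proof
    assume rel: "\<alpha> ^ m * \<delta> ^ k = 1"
    have "(p - smult u q) ^ m * (p - smult w1 q) ^ k * [:- w2, 1:] ^ k =
      [:- u, 1:] ^ m * [:- w1, 1:] ^ k * (p - smult w2 q) ^ k * q ^ m"
    proof (rule identity)
      fix x assume "x \<in> w ` S"
      then obtain n where n: "n \<in> S" "x = w n" by blast
      have "(\<alpha> ^ n) ^ m * (\<delta> ^ n) ^ k = (\<alpha> ^ m * \<delta> ^ k) ^ n"
        by (simp add: power_mult_distrib mult.commute flip: power_mult)
      then have rel': "(\<alpha> ^ n) ^ m * (\<delta> ^ n) ^ k = 1" using rel by simp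
      have "poly ((p - smult u q) ^ m * (p - smult w1 q) ^ k * [:- w2, 1:] ^ k) x =
        (poly q x) ^ (m + k) * (c n - u) ^ m * ((c n - w1) * (w n - w2)) ^ k"
        unfolding n(2) poly_mult poly_power cq[OF n(1)] by (simp add: power_mult_distrib power_add)
      also have "\<dots> = ((\<alpha> ^ n) ^ m * (\<delta> ^ n) ^ k) *
          ((poly q x) ^ (m + k) * (w n - u) ^ m * ((w n - w1) * (c n - w2)) ^ k)"
        unfolding au[OF n(1)] w(3)[OF n(1), symmetric] by (simp only: power_mult_distrib mult_ac)
      also have "\<dots> = poly ([:- u, 1:] ^ m * [:- w1, 1:] ^ k * (p - smult w2 q) ^ k * q ^ m) x"
        unfolding rel' n(2) poly_mult poly_power cq[OF n(1)] by (simp add: power_mult_distrib power_add)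
      finally show "poly ((p - smult u q) ^ m * (p - smult w1 q) ^ k * [:- w2, 1:] ^ k) x =
        poly ([:- u, 1:] ^ m * [:- w1, 1:] ^ k * (p - smult w2 q) ^ k * q ^ m) x" .
    qed
    then have "m = k" using no_common_fixed_point_identity[OF dist pq mk(1,2)] not_id by blast
    then have "(\<alpha> * \<delta>) ^ m = 1" using rel by (simp add: power_mult_distrib)
    then show ?thesis using mk root_of_unityI by blast
  next
    assume rel: "\<alpha> ^ m = \<delta> ^ k"
    have rel': "(\<alpha> ^ n) ^ m = (\<delta> ^ n) ^ k" for n
      using rel by (metis power_mult mult.commute)
    have "(p - smult u q) ^ m * (p - smult w2 q) ^ k * [:- w1, 1:] ^ k =
      [:- u, 1:] ^ m * [:- w2, 1:] ^ k * (p - smult w1 q) ^ k * q ^ m"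
    proof (rule identity)
      fix x assume "x \<in> w ` S"
      then obtain n where n: "n \<in> S" "x = w n" by blast
      have "poly ((p - smult u q) ^ m * (p - smult w2 q) ^ k * [:- w1, 1:] ^ k) x =
        (poly q x) ^ (m + k) * (c n - u) ^ m * ((c n - w2) * (w n - w1)) ^ k"
        unfolding n(2) poly_mult poly_power cq[OF n(1)] by (simp add: power_mult_distrib power_add)
      also have "\<dots> = (\<alpha> ^ n) ^ m *
          ((poly q x) ^ (m + k) * (w n - u) ^ m * ((c n - w2) * (w n - w1)) ^ k)"
        unfolding au[OF n(1)] by (simp only: power_mult_distrib mult_ac)
      also have "\<dots> = (poly q x) ^ (m + k) * (w n - u) ^ m * (\<delta> ^ n * (w n - w1) * (c n - w2)) ^ k"
        unfolding rel' by (simp only: power_mult_distrib mult_ac)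
      also have "\<dots> = poly ([:- u, 1:] ^ m * [:- w2, 1:] ^ k * (p - smult w1 q) ^ k * q ^ m) x"
        unfolding w(3)[OF n(1)] n(2) poly_mult poly_power cq[OF n(1)]
        by (simp add: power_mult_distrib power_add)
      finally show "poly ((p - smult u q) ^ m * (p - smult w2 q) ^ k * [:- w1, 1:] ^ k) x =
        poly ([:- u, 1:] ^ m * [:- w2, 1:] ^ k * (p - smult w1 q) ^ k * q ^ m) x" .
    qed
    then have "m = k"
      using no_common_fixed_point_identity[OF dist(2,1) dist(3)[symmetric] pq mk(1,2)] not_id by blast
    then have "(\<alpha> / \<delta>) ^ m = 1" using rel nz by (simp add: power_divide)
    then show ?thesis using mk root_of_unityI by blast
  qed
qed

section \<open>Free semigroups of maps\<close>

lemma word_map_append: "word_map F G (u @ v) = word_map F G u \<circ> word_map F G v"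
  by (induction u) (auto simp: comp_assoc)

lemma word_map_replicate:
  "word_map F G (replicate n True) = F ^^ n" "word_map F G (replicate n False) = G ^^ n"
  by (induction n) auto

lemma word_map_concat_replicate:
  "word_map F G (concat (replicate n w)) = word_map F G w ^^ n"
  by (induction n) (auto simp: word_map_append)

lemma free_word_eq:
  assumes "generate_free_semigroup F G" "u \<noteq> []" "v \<noteq> []" "word_map F G u = word_map F G v"
  shows "u = v"
  using assms unfolding generate_free_semigroup_def inj_on_def by blast

lemma free_swap:
  fixes F G :: "'a \<Rightarrow> 'a"
  assumes "generate_free_semigroup F G" shows "generate_free_semigroup G F"
proof -
  have w: "word_map G F w = word_map F G (map Not w)" for w
    by (induction w) auto
  have inj: "inj (map Not)" by (simp add: inj_def)
  show ?thesis
    unfolding generate_free_semigroup_def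
  proof (rule inj_onI)
    fix u v assume "u \<in> {w. w \<noteq> []}" "v \<in> {w. w \<noteq> []}" "word_map G F u = word_map G F v"
    then have "map Not u = map Not v"
      by (intro free_word_eq[OF assms]) (auto simp: w)
    then show "u = v" using inj by (simp add: inj_eq)
  qed
qed

lemma free_power_neq_id:
  assumes "generate_free_semigroup F G" "m > 0" shows "F ^^ m \<noteq> id"
proof
  assume "F ^^ m = id"
  then have "word_map F G (replicate (Suc m) True) = word_map F G [True]"
    by (simp add: word_map_replicate)
  from free_word_eq[OF assms(1) _ _ this] show False using assms(2) by simp
qed

lemma free_powers_neq:
  assumes "generate_free_semigroup F G" "n > 0" shows "F ^^ n \<noteq> G ^^ n"
proof
  assume "F ^^ n = G ^^ n"
  then have "word_map F G (replicate n True) = word_map F G (replicate n False)"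
    by (simp add: word_map_replicate)
  from free_word_eq[OF assms(1) _ _ this] show False using assms(2) by simp
qed

text \<open>
Both sides are words of length $4m$, and they start with different letters.
\<close>

lemma free_products_not_commute:
  assumes "generate_free_semigroup F G" "m > 0"
  shows "(F \<circ> G) ^^ m \<circ> (G \<circ> F) ^^ m \<noteq> (G \<circ> F) ^^ m \<circ> (F \<circ> G) ^^ m"
proof
  let ?u = "concat (replicate m [True, False])" and ?v = "concat (replicate m [False, True])"
  assume "(F \<circ> G) ^^ m \<circ> (G \<circ> F) ^^ m = (G \<circ> F) ^^ m \<circ> (F \<circ> G) ^^ m"
  then have eq: "word_map F G (?u @ ?v) = word_map F G (?v @ ?u)"
    by (simp add: word_map_append word_map_concat_replicate)
  obtain k where "m = Suc k" using assms(2) by (cases m) auto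
  then show False using free_word_eq[OF assms(1) _ _ eq] by simp
qed

lemma free_not_commute:
  assumes "generate_free_semigroup F G" shows "F \<circ> G \<noteq> G \<circ> F"
  using free_products_not_commute[OF assms, of 1] by auto

lemma funpow_conjugate:
  assumes "bij \<phi>" shows "(inv \<phi> \<circ> F \<circ> \<phi>) ^^ n = inv \<phi> \<circ> F ^^ n \<circ> \<phi>"
proof (induction n)
  case 0
  show ?case using assms by (simp add: bij_is_inj)
next
  case (Suc n)
  have "\<phi> (inv \<phi> z) = z" for z using assms by (simp add: bij_is_surj surj_f_inv_f)
  then show ?case using Suc by (simp add: fun_eq_iff)
qed

lemma word_map_conjugate:
  assumes "bij \<phi>"
  shows "word_map (inv \<phi> \<circ> F \<circ> \<phi>) (inv \<phi> \<circ> G \<circ> \<phi>) w = inv \<phi> \<circ> word_map F G w \<circ> \<phi>"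
proof (induction w)
  case Nil
  show ?case using assms by (simp add: bij_is_inj)
next
  case (Cons b w)
  have "\<phi> (inv \<phi> z) = z" for z using assms by (simp add: bij_is_surj surj_f_inv_f)
  then show ?case using Cons by (simp add: fun_eq_iff)
qed

lemma free_conjugate:
  assumes "generate_free_semigroup F G" and bij: "bij \<phi>"
  shows "generate_free_semigroup (inv \<phi> \<circ> F \<circ> \<phi>) (inv \<phi> \<circ> G \<circ> \<phi>)"
  unfolding generate_free_semigroup_def
proof (rule inj_onI)
  fix u v :: "bool list"
  assume uv: "u \<in> {w. w \<noteq> []}" "v \<in> {w. w \<noteq> []}"
    "word_map (inv \<phi> \<circ> F \<circ> \<phi>) (inv \<phi> \<circ> G \<circ> \<phi>) u = word_map (inv \<phi> \<circ> F \<circ> \<phi>) (inv \<phi> \<circ> G \<circ> \<phi>) v"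
  have "word_map F G w = \<phi> \<circ> (inv \<phi> \<circ> word_map F G w \<circ> \<phi>) \<circ> inv \<phi>" for w
    using bij by (simp add: fun_eq_iff bij_is_surj surj_f_inv_f)
  then have "word_map F G u = word_map F G v"
    using uv(3) unfolding word_map_conjugate[OF bij] by metis
  then show "u = v" using free_word_eq[OF assms(1)] uv by blast
qed

section \<open>Moebius transformations of the projective line\<close>

text \<open>
The Moebius map of the matrix with rows $(a, b)$ and $(c, d)$. Its values make sense for every matrix, and
\<open>moebius\<close> adds invertibility.
\<close>

definition mob :: "complex \<Rightarrow> complex \<Rightarrow> complex \<Rightarrow> complex \<Rightarrow> P1 \<Rightarrow> P1" where
  "mob a b c d z = (case z of
      Point x \<Rightarrow> if c * x + d = 0 then Infty else Point ((a * x + b) / (c * x + d))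
    | Infty \<Rightarrow> if c = 0 then Infty else Point (a / c))"

lemma mob_Point: "mob a b c d (Point x) =
    (if c * x + d = 0 then Infty else Point ((a * x + b) / (c * x + d)))"
  and mob_Infty: "mob a b c d Infty = (if c = 0 then Infty else Point (a / c))"
  by (simp_all add: mob_def)

lemma mob_comp:
  assumes "a * d - b * c \<noteq> 0" "a' * d' - b' * c' \<noteq> 0"
  shows "mob a b c d \<circ> mob a' b' c' d' =
    mob (a * a' + b * c') (a * b' + b * d') (c * a' + d * c') (c * b' + d * d')"
proof
  fix z
  have frac: "k * (A / Y) + l = (k * A + l * Y) / Y" if "Y \<noteq> 0" for k l A Y :: complex
    using that by (simp add: add_divide_distrib)
  have cancel: "(if D / Y = 0 then Infty else Point (N / Y / (D / Y))) =
      (if D = 0 then Infty else Point (N / D))" if "Y \<noteq> 0" for D N Y :: complex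
    using that by simp
  show "(mob a b c d \<circ> mob a' b' c' d') z =
    mob (a * a' + b * c') (a * b' + b * d') (c * a' + d * c') (c * b' + d * d') z"
  proof (cases z)
    case (Point x)
    have den: "(c * a' + d * c') * x + (c * b' + d * d') = c * (a' * x + b') + d * (c' * x + d')"
      and num: "(a * a' + b * c') * x + (a * b' + b * d') = a * (a' * x + b') + b * (c' * x + d')"
      by (simp_all add: algebra_simps)
    show ?thesis
    proof (cases "c' * x + d' = 0")
      case True
      have "a' * x + b' \<noteq> 0"
      proof
        assume "a' * x + b' = 0"
        then have "b' = - a' * x" "d' = - c' * x" using True by (simp_all add: add_eq_0_iff)
        then show False using assms(2) by simp
      qed
      then show ?thesis using True unfolding Point comp_apply
        by (simp only: mob_Point den num if_True) (simp add: mob_Infty)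
    next
      case False
      show ?thesis unfolding Point comp_apply
        by (simp only: mob_Point den num if_False False frac[OF False] cancel[OF False])
    qed
  next
    case Infty
    show ?thesis
    proof (cases "c' = 0")
      case True
      then have "a' \<noteq> 0" using assms(2) by auto
      then show ?thesis using True by (simp add: Infty mob_Infty)
    next
      case False
      show ?thesis unfolding Infty comp_apply
        by (simp only: mob_Point mob_Infty if_False False frac[OF False] cancel[OF False])
    qed
  qed
qed

lemma mob_scale: "k \<noteq> 0 \<Longrightarrow> mob (k * a) (k * b) (k * c) (k * d) = mob a b c d"
proof
  fix z assume k: "k \<noteq> 0"
  have eq: "k * c * x + k * d = k * (c * x + d)" "k * a * x + k * b = k * (a * x + b)" for x
    by (simp_all add: algebra_simps)
  show "mob (k * a) (k * b) (k * c) (k * d) z = mob a b c d z"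
    using k by (cases z) (simp_all add: mob_Point mob_Infty eq)
qed

lemma mob_id: "mob 1 0 0 1 = id"
proof
  fix z show "mob 1 0 0 1 z = id z" by (cases z) (simp_all add: mob_def)
qed

definition moebius :: "(P1 \<Rightarrow> P1) \<Rightarrow> bool" where
  "moebius F \<longleftrightarrow> (\<exists>a b c d. a * d - b * c \<noteq> 0 \<and> F = mob a b c d)"

lemma moebius_mob: "a * d - b * c \<noteq> 0 \<Longrightarrow> moebius (mob a b c d)"
  unfolding moebius_def by blast

lemma moebiusE:
  assumes "moebius F" obtains a b c d where "F = mob a b c d" "a * d - b * c \<noteq> 0"
  using assms unfolding moebius_def by blast

lemma moebius_id: "moebius id"
  using moebius_mob[of 1 1 0 0] by (simp add: mob_id)

lemma moebius_comp: "moebius F \<Longrightarrow> moebius G \<Longrightarrow> moebius (F \<circ> G)"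
proof -
  assume "moebius F" "moebius G"
  then obtain a b c d a' b' c' d' where F: "F = mob a b c d" "a * d - b * c \<noteq> 0"
    and G: "G = mob a' b' c' d'" "a' * d' - b' * c' \<noteq> 0" unfolding moebius_def by blast
  have "(a * a' + b * c') * (c * b' + d * d') - (a * b' + b * d') * (c * a' + d * c') =
      (a * d - b * c) * (a' * d' - b' * c')" by (simp add: algebra_simps)
  then show "moebius (F \<circ> G)"
    unfolding F(1) G(1) mob_comp[OF F(2) G(2)] using F(2) G(2) by (intro moebius_mob) simp
qed

lemma moebius_funpow: "moebius F \<Longrightarrow> moebius (F ^^ n)"
  by (induction n) (simp_all add: moebius_id moebius_comp)

lemma mob_inverse:
  assumes "a * d - b * c \<noteq> 0"
  shows "mob a b c d \<circ> mob d (- b) (- c) a = id" "mob d (- b) (- c) a \<circ> mob a b c d = id"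
proof -
  have "mob (a * d - b * c) 0 0 (a * d - b * c) = id"
    using mob_scale[OF assms, of 1 0 0 1] by (simp add: mob_id)
  then show "mob a b c d \<circ> mob d (- b) (- c) a = id" "mob d (- b) (- c) a \<circ> mob a b c d = id"
    using assms mob_comp[of a d b c d a "- b" "- c"] mob_comp[of d a "- b" "- c" a d b c]
    by (simp_all add: mult.commute)
qed

lemma moebius_bij:
  assumes "moebius F" shows "bij F" "moebius (inv F)"
proof -
  obtain a b c d where F: "F = mob a b c d" "a * d - b * c \<noteq> 0"
    using assms by (auto elim: moebiusE)
  note i = mob_inverse[OF F(2), folded F(1)]
  show "bij F" using o_bij[OF i(2,1)] .
  have "inv F = mob d (- b) (- c) a" using inv_unique_comp[OF i] .
  then show "moebius (inv F)" using F(2) by (simp add: moebius_mob mult.commute)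
qed

lemma moebius_eq_id:
  assumes "moebius F" and inf: "infinite {x. F (Point x) = Point x}"
  shows "F = id"
proof -
  obtain a b c d where F: "F = mob a b c d" "a * d - b * c \<noteq> 0"
    using assms by (auto elim: moebiusE)
  have "[:- b, d - a, c:] = 0"
  proof (rule poly_eq_if_infinite[OF inf])
    fix x assume "x \<in> {x. F (Point x) = Point x}"
    then have "c * x + d \<noteq> 0" "(a * x + b) / (c * x + d) = x"
      unfolding F(1) mob_Point by (auto split: if_splits)
    then have "a * x + b = x * (c * x + d)" by (simp add: divide_eq_eq)
    then show "poly [:- b, d - a, c:] x = poly 0 x" by (simp add: algebra_simps)
  qed
  then have "b = 0" "d = a" "c = 0" by auto
  then show ?thesis using F mob_scale[of a 1 0 0 1] by (simp add: mob_id)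
qed

text \<open>
Composing with the inverse of one map turns points of agreement into fixed points, and a quadratic
polynomial with infinitely many roots is zero.
\<close>

lemma moebius_eq_finite:
  assumes "moebius F" "moebius G" "F \<noteq> G" shows "finite {x. F (Point x) = G (Point x)}"
proof (rule ccontr)
  assume inf: "infinite {x. F (Point x) = G (Point x)}"
  note G = moebius_bij[OF assms(2)]
  have "{x. F (Point x) = G (Point x)} \<subseteq> {x. (inv G \<circ> F) (Point x) = Point x}"
    using G(1) by (auto simp: bij_is_inj)
  then have "infinite {x. (inv G \<circ> F) (Point x) = Point x}" using inf infinite_super by blast
  then have "inv G \<circ> F = id" using moebius_comp[OF G(2) assms(1)] by (intro moebius_eq_id)
  then have "G (inv G (F z)) = G z" for z by (simp add: fun_eq_iff)
  then have "F z = G z" for z using G(1) by (simp add: bij_is_surj surj_f_inv_f)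
  then show False using assms(3) by blast
qed

lemma moebius_fixed_point:
  assumes "moebius F" shows "\<exists>z. F z = z"
proof -
  obtain a b c d where F: "F = mob a b c d" "a * d - b * c \<noteq> 0"
    using assms by (auto elim: moebiusE)
  show ?thesis
  proof (cases "c = 0")
    case True
    then show ?thesis by (intro exI[of _ Infty]) (simp add: F mob_Infty)
  next
    case False
    then have "\<not> constant (poly [:- b, d - a, c:])" by (simp add: constant_degree)
    then obtain x where "poly [:- b, d - a, c:] x = 0" using fundamental_theorem_of_algebra by blast
    then have x: "x * (c * x + d) = a * x + b" by (simp add: algebra_simps)
    have "c * x + d \<noteq> 0"
    proof
      assume 0: "c * x + d = 0"
      then have "a * x + b = 0" using x by simp
      then have "b = - a * x" "d = - c * x" using 0 by (simp_all add: add_eq_0_iff)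
      then show False using F(2) by simp
    qed
    then show ?thesis using x by (intro exI[of _ "Point x"]) (simp add: F mob_Point divide_eq_eq)
  qed
qed

lemma exists_moebius_two_points:
  assumes "z1 \<noteq> z2" obtains \<phi> where "moebius \<phi>" "\<phi> Infty = z1" "\<phi> (Point 0) = z2"
proof (cases z1)
  case Infty
  then obtain x where "z2 = Point x" using assms by (cases z2) auto
  then show thesis using that[of "mob 1 x 0 1"] Infty by (simp add: moebius_mob mob_Point mob_Infty)
next
  case (Point x)
  note x = this
  show thesis
  proof (cases z2)
    case Infty
    then show thesis using that[of "mob x 1 1 0"] x by (simp add: moebius_mob mob_Point mob_Infty)
  next
    case (Point y)
    then show thesis using that[of "mob x y 1 1"] x assms by (simp add: moebius_mob mob_Point mob_Infty)
  qed
qed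

lemma moebius_fixing_Infty:
  assumes "moebius F" "F Infty = Infty" obtains \<alpha> \<beta> where "\<alpha> \<noteq> 0" "F = mob \<alpha> \<beta> 0 1"
proof -
  obtain a b c d where F: "F = mob a b c d" "a * d - b * c \<noteq> 0"
    using assms by (auto elim: moebiusE)
  have "c = 0" using assms(2) by (auto simp: F mob_Infty split: if_splits)
  then have "a \<noteq> 0" "d \<noteq> 0" using F by auto
  then have "F = mob (a / d) (b / d) 0 1"
    using mob_scale[of d "a / d" "b / d" 0 1] \<open>c = 0\<close> by (simp add: F)
  then show thesis using that[of "a / d"] \<open>a \<noteq> 0\<close> \<open>d \<noteq> 0\<close> by simp
qed

lemma moebius_fixing_0:
  assumes "moebius F" "F (Point 0) = Point 0" obtains \<gamma> \<delta> where "\<delta> \<noteq> 0" "F = mob 1 0 \<gamma> \<delta>"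
proof -
  obtain a b c d where F: "F = mob a b c d" "a * d - b * c \<noteq> 0"
    using assms by (auto elim: moebiusE)
  have "b = 0" using assms(2) by (auto simp: F mob_Point split: if_splits)
  then have "a \<noteq> 0" "d \<noteq> 0" using F by auto
  then have "F = mob 1 0 (c / a) (d / a)"
    using mob_scale[of a 1 0 "c / a" "d / a"] \<open>b = 0\<close> by (simp add: F)
  then show thesis using that[of "d / a"] \<open>a \<noteq> 0\<close> \<open>d \<noteq> 0\<close> by simp
qed

section \<open>Rational functions of degree one\<close>

text \<open>
The representation of a fraction by \<open>quot_of_fract\<close> is one coprime pair; any other coprime pair differs
from it by a constant factor, which does not change the values.
\<close>

lemma rat_map_Fract:
  assumes "coprime p q" "q \<noteq> 0"
  shows "rat_map (Fract p q) z = (case z of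
      Point x \<Rightarrow> if poly q x = 0 then Infty else Point (poly p x / poly q x)
    | Infty \<Rightarrow> if degree p > degree q then Infty else Point (coeff p (degree q) / lead_coeff q))"
proof -
  obtain P Q where PQ: "quot_of_fract (Fract p q) = (P, Q)" by (cases "quot_of_fract (Fract p q)")
  have "Q \<noteq> 0" using snd_quot_of_fract_nonzero[of "Fract p q"] PQ by simp
  have cop: "coprime P Q" using coprime_quot_of_fract[of "Fract p q"] PQ by simp
  have "Fract P Q = Fract p q" using Fract_quot_of_fract[of "Fract p q"] PQ by simp
  then have eq: "P * q = p * Q" using \<open>Q \<noteq> 0\<close> assms(2) by (simp add: eq_fract)
  have "q dvd p * Q" "Q dvd P * q" using eq by (metis dvd_triv_right)+
  then have dvd: "q dvd Q" "Q dvd q"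
    using assms(1) cop by (simp_all add: coprime_dvd_mult_right_iff coprime_commute)
  then obtain k where k: "Q = q * k" by (elim dvdE)
  have "k \<noteq> 0" using k \<open>Q \<noteq> 0\<close> by auto
  have "degree Q = degree q"
    using dvd_imp_degree_le[OF dvd(1) \<open>Q \<noteq> 0\<close>] dvd_imp_degree_le[OF dvd(2) assms(2)] by simp
  then have "degree k = 0" using k \<open>k \<noteq> 0\<close> assms(2) by (simp add: degree_mult_eq)
  then obtain l where l: "k = [:l:]" by (rule degree_eq_zeroE)
  then have Q: "Q = smult l q" and "l \<noteq> 0" using k \<open>k \<noteq> 0\<close> by auto
  have "q * P = q * smult l p" using eq by (simp add: Q mult.commute)
  then have P: "P = smult l p" using assms(2) by (simp only: mult_cancel_left) simp
  show ?thesis using \<open>l \<noteq> 0\<close> unfolding rat_map_def PQ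
    by (simp add: P Q split: P1.split)
qed

lemma rat_map_linear_fractional:
  assumes "a * d - b * c \<noteq> 0"
  shows "rat_map (Fract [:b, a:] [:d, c:]) = mob a b c d"
proof
  fix z
  have q: "[:d, c:] \<noteq> 0" using assms by auto
  have "coprime [:b, a:] [:d, c:]"
  proof (rule coprimeI)
    fix e assume "e dvd [:b, a:]" "e dvd [:d, c:]"
    then have "e dvd smult a [:d, c:] - smult c [:b, a:]" by (intro dvd_diff dvd_smult)
    also have "smult a [:d, c:] - smult c [:b, a:] = [:a * d - b * c:]" by (simp add: mult.commute)
    finally show "is_unit e" using assms
      by (metis dvd_trans is_unit_const_poly_iff is_unit_iff_degree degree_pCons_0 pCons_eq_0_iff)
  qed
  note rm = rat_map_Fract[OF this q]
  show "rat_map (Fract [:b, a:] [:d, c:]) z = mob a b c d z"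
  proof (cases z)
    case (Point x)
    then show ?thesis unfolding rm by (simp add: mob_Point algebra_simps)
  next
    case Infty
    show ?thesis
    proof (cases "c = 0")
      case True
      then have "a \<noteq> 0" "d \<noteq> 0" using assms by auto
      then show ?thesis using True unfolding rm Infty by (simp add: mob_Infty)
    next
      case False
      then show ?thesis unfolding rm Infty by (simp add: mob_Infty)
    qed
  qed
qed

lemma linear_fractional_is_automorphism:
  assumes "a * d - b * c \<noteq> 0"
  shows "is_automorphism (Fract [:b, a:] [:d, c:])"
proof -
  have "d * a - (- b) * (- c) \<noteq> 0" using assms by (simp add: mult.commute)
  then show ?thesis unfolding is_automorphism_def
    using mob_inverse[OF assms] rat_map_linear_fractional[OF assms]
      rat_map_linear_fractional[of d a "- b" "- c"]
    by (intro exI[of _ "Fract [:- b, d:] [:a, - c:]"]) simp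
qed

lemma rational_function_quotient:
  fixes r :: rational_function
  obtains P Q where "r = Fract P Q" "coprime P Q" "Q \<noteq> 0"
  using that[of "fst (quot_of_fract r)" "snd (quot_of_fract r)"]
    snd_quot_of_fract_nonzero[of r] coprime_quot_of_fract[of r] by simp

text \<open>
Let $f = P / Q$ be injective and suppose that the larger degree is at least $2$. For all but at most one
value $w$, the polynomial $P - w Q$ has degree at least $2$, and by injectivity it has a single root, which is
therefore multiple. So the numerator $P' Q - P Q'$ of the derivative of $f$ vanishes at infinitely many points;
it is zero, and $f$ is constant, which contradicts the assumption on the degrees.
\<close>

theorem automorphism_moebius:
  assumes "is_automorphism f" shows "moebius (rat_map f)"
proof -
  obtain P Q where f: "f = Fract P Q" and cop: "coprime P Q" and Q0: "Q \<noteq> 0"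
    by (rule rational_function_quotient)
  obtain h where "rat_map h \<circ> rat_map f = id" using assms unfolding is_automorphism_def by blast
  then have "inj (rat_map f)" by (metis inj_on_id inj_on_imageI2)
  then have inj: "x = y" if "rat_map f (Point x) = rat_map f (Point y)" for x y
    using that by (metis P1.inject injD)
  have val: "rat_map f (Point x) = Point (poly P x / poly Q x)" if "poly Q x \<noteq> 0" for x
    using that unfolding f rat_map_Fract[OF cop Q0] by simp
  note common = coprime_no_common_root[OF cop]
  define m where "m = max (degree P) (degree Q)"
  have "m \<le> 1"
  proof (rule ccontr)
    assume "\<not> m \<le> 1"
    \<comment> \<open>the values \<open>w\<close> for which no preimage of \<open>w\<close> lies at infinity\<close>
    define B where "B = {w. coeff (P - smult w Q) m \<noteq> 0}"
    have "infinite B"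
    proof
      assume "finite B"
      moreover have "UNIV - B \<subseteq> {coeff P m / coeff Q m}"
      proof
        fix w assume "w \<in> UNIV - B"
        then have e: "coeff P m = w * coeff Q m" by (simp add: B_def)
        have "coeff P m \<noteq> 0 \<or> coeff Q m \<noteq> 0"
          using \<open>\<not> m \<le> 1\<close> unfolding m_def by (auto simp: max_def split: if_splits)
        then show "w \<in> {coeff P m / coeff Q m}" using e by auto
      qed
      ultimately have "finite (UNIV :: complex set)" by (metis Diff_UNIV Diff_infinite_finite finite.emptyI finite.insertI finite_subset)
      then show False using infinite_UNIV_char_0 by blast
    qed
    have root: "\<exists>r. poly (pderiv P * Q - P * pderiv Q) r = 0 \<and> poly Q r \<noteq> 0 \<and> poly P r / poly Q r = w"
      if "w \<in> B" for w
    proof -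
      define R where "R = P - smult w Q"
      have "degree R \<ge> m" using that by (intro le_degree) (simp add: B_def R_def)
      then have degR: "degree R \<ge> 2" using \<open>\<not> m \<le> 1\<close> by simp
      have at_root: "poly Q x \<noteq> 0 \<and> poly P x / poly Q x = w" if "poly R x = 0" for x
        using that common[of x] unfolding R_def by (auto simp: divide_eq_eq)
      have "\<not> constant (poly R)" using degR by (simp add: constant_degree)
      then obtain r where r: "poly R r = 0" using fundamental_theorem_of_algebra by blast
      then obtain s where s: "R = [:- r, 1:] * s" by (auto simp: poly_eq_0_iff_dvd elim: dvdE)
      have "s \<noteq> 0" using s degR by auto
      then have "degree R = Suc (degree s)" unfolding s by (subst degree_mult_eq) auto
      then have "\<not> constant (poly s)" using degR by (simp add: constant_degree)
      then obtain r' where r': "poly s r' = 0" using fundamental_theorem_of_algebra by blast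
      then have "poly R r' = 0" by (simp add: s)
      then have "r' = r" using at_root[of r'] at_root[OF r] by (intro inj) (simp add: val)
      then have "poly (pderiv R) r = 0" using r' unfolding s
        by (simp add: pderiv_mult pderiv_pCons del: mult_pCons_left)
      then have "poly (pderiv P) r = w * poly (pderiv Q) r"
        by (simp add: R_def pderiv_diff pderiv_smult)
      moreover have "poly P r = w * poly Q r" using r by (simp add: R_def)
      ultimately show ?thesis using at_root[OF r] by (intro exI[of _ r]) simp
    qed
    then obtain r where r: "\<And>w. w \<in> B \<Longrightarrow> poly (pderiv P * Q - P * pderiv Q) (r w) = 0"
      "\<And>w. w \<in> B \<Longrightarrow> poly P (r w) / poly Q (r w) = w" by metis
    have "inj_on r B" using r(2) by (metis inj_onI)
    then have "infinite (r ` B)" using \<open>infinite B\<close> finite_imageD by blast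
    then have "pderiv P * Q - P * pderiv Q = 0"
      by (rule poly_eq_if_infinite) (use r(1) in auto)
    then have eq: "pderiv P * Q = P * pderiv Q" by simp
    then have "Q dvd P * pderiv Q" by (metis dvd_triv_right)
    then have "Q dvd pderiv Q" using cop by (simp add: coprime_dvd_mult_right_iff coprime_commute)
    then have "degree Q = 0"
      by (metis degree_pderiv diff_less dvd_imp_degree_le less_one linorder_not_less neq0_conv pderiv_eq_0_iff)
    then have "pderiv Q = 0" by (simp add: pderiv_eq_0_iff)
    then have "pderiv P = 0" using eq Q0 by simp
    then have "degree P = 0" by (simp add: pderiv_eq_0_iff)
    then show False using \<open>degree Q = 0\<close> \<open>\<not> m \<le> 1\<close> by (simp add: m_def)
  qed
  then have "degree P \<le> 1" "degree Q \<le> 1" by (simp_all add: m_def)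
  then obtain a b c d where P: "P = [:b, a:]" and Q: "Q = [:d, c:]"
    by (metis degree1_coeffs degree_eq_zeroE le_less less_one pCons_0_0 one_neq_zero)
  have "a * d - b * c \<noteq> 0"
  proof
    assume det: "a * d - b * c = 0"
    have "infinite (UNIV - {x. poly Q x = 0})"
      using poly_roots_finite[OF Q0] infinite_UNIV_char_0[where 'a = complex] by (rule Diff_infinite_finite)
    then obtain S where "S \<subseteq> UNIV - {x. poly Q x = 0}" "card S = 2"
      using infinite_arbitrarily_large by blast
    then obtain x y where xy: "poly Q x \<noteq> 0" "poly Q y \<noteq> 0" "x \<noteq> y"
      by (auto simp: card_2_iff)
    have "poly P x * poly Q y - poly P y * poly Q x = (a * d - b * c) * (x - y)"
      by (simp add: P Q algebra_simps)
    then have "poly P x / poly Q x = poly P y / poly Q y"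
      using det xy by (simp add: frac_eq_eq)
    then show False using inj[of x y] val xy by simp
  qed
  then show ?thesis unfolding f P Q by (simp add: rat_map_linear_fractional moebius_mob)
qed

lemma moebius_as_automorphism:
  assumes "moebius \<phi>" obtains r where "is_automorphism r" "rat_map r = \<phi>"
proof -
  obtain a b c d where \<phi>: "\<phi> = mob a b c d" "a * d - b * c \<noteq> 0"
    using assms by (auto elim: moebiusE)
  show thesis using that linear_fractional_is_automorphism[OF \<phi>(2)] rat_map_linear_fractional[OF \<phi>(2)] \<phi>(1)
    by metis
qed

text \<open>
Binary forms are the way to substitute a Moebius map into a polynomial.
\<close>

lemma homogenized_substitution:
  fixes P :: "complex poly"
  assumes "degree P \<le> N"
  shows "\<exists>P'. \<forall>x. c * x + d \<noteq> 0 \<longrightarrow> poly P' x = (c * x + d) ^ N * poly P ((a * x + b) / (c * x + d))"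
proof (intro exI allI impI)
  fix x assume x: "c * x + d \<noteq> 0"
  have "poly (\<Sum>i\<le>N. smult (coeff P i) ([:b, a:] ^ i * [:d, c:] ^ (N - i))) x =
    (\<Sum>i\<le>N. coeff P i * ((a * x + b) ^ i * (c * x + d) ^ (N - i)))"
    by (simp add: poly_sum mult.commute add.commute)
  also have "\<dots> = (\<Sum>i\<le>N. (c * x + d) ^ N * (coeff P i * ((a * x + b) / (c * x + d)) ^ i))"
  proof (intro sum.cong refl)
    fix i assume "i \<in> {..N}"
    then have "(c * x + d) ^ N = (c * x + d) ^ i * (c * x + d) ^ (N - i)" by (simp flip: power_add)
    then show "coeff P i * ((a * x + b) ^ i * (c * x + d) ^ (N - i)) =
        (c * x + d) ^ N * (coeff P i * ((a * x + b) / (c * x + d)) ^ i)"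
      using x by (simp add: power_divide)
  qed
  also have "\<dots> = (c * x + d) ^ N * poly P ((a * x + b) / (c * x + d))"
  proof -
    have "poly P y = (\<Sum>i\<le>N. coeff P i * y ^ i)" for y
      unfolding poly_altdef using assms by (intro sum.mono_neutral_left) (auto simp: coeff_eq_0)
    then show ?thesis by (simp add: sum_distrib_left)
  qed
  finally show "poly (\<Sum>i\<le>N. smult (coeff P i) ([:b, a:] ^ i * [:d, c:] ^ (N - i))) x =
    (c * x + d) ^ N * poly P ((a * x + b) / (c * x + d))" .
qed

text \<open>
A conjugate of a rational function is again rational. The finite set \<open>T\<close> absorbs the pole of the inner
Moebius map and the common roots that are cancelled; \<open>q\<close> may be zero, for a function that is
constantly $\infty$ after conjugation.
\<close>

lemma conjugate_rational_map:
  assumes "moebius \<phi>" "moebius \<psi>"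
  shows "\<exists>p q T. coprime p q \<and> finite T \<and> (\<forall>w. w \<notin> T \<longrightarrow>
    \<psi> (rat_map r (\<phi> (Point w))) = (if poly q w = 0 then Infty else Point (poly p w / poly q w)))"
proof -
  obtain a b c d where \<phi>: "\<phi> = mob a b c d" "a * d - b * c \<noteq> 0"
    using assms by (auto elim: moebiusE)
  obtain a' b' c' d' where \<psi>: "\<psi> = mob a' b' c' d'" "a' * d' - b' * c' \<noteq> 0"
    using assms unfolding moebius_def by blast
  obtain P Q where r: "r = Fract P Q" and cop: "coprime P Q" and Q0: "Q \<noteq> 0"
    by (rule rational_function_quotient)
  define p1 q1 where "p1 = smult a' P + smult b' Q" and "q1 = smult c' P + smult d' Q"
  note common = coprime_no_common_root[OF cop]
  have 1: "\<psi> (rat_map r (Point z)) = (if poly q1 z = 0 then Infty else Point (poly p1 z / poly q1 z))"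
    for z
  proof (cases "poly Q z = 0")
    case True
    then show ?thesis using common[OF True]
      unfolding r rat_map_Fract[OF cop Q0] \<psi>(1) by (simp add: mob_Infty p1_def q1_def)
  next
    case False
    have "c' * (poly P z / poly Q z) + d' = poly q1 z / poly Q z"
      "a' * (poly P z / poly Q z) + b' = poly p1 z / poly Q z"
      using False by (simp_all add: p1_def q1_def add_divide_distrib)
    then show ?thesis using False
      unfolding r rat_map_Fract[OF cop Q0] \<psi>(1) by (simp add: mob_Point)
  qed
  \<comment> \<open>the matrix of \<open>\<psi>\<close> is invertible, so it preserves the absence of common roots\<close>
  have 2: "poly p1 z \<noteq> 0 \<or> poly q1 z \<noteq> 0" for z
  proof (rule ccontr)
    assume "\<not> ?thesis"
    then have e: "a' * poly P z + b' * poly Q z = 0" "c' * poly P z + d' * poly Q z = 0"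
      by (simp_all add: p1_def q1_def)
    have "(a' * d' - b' * c') * poly P z = d' * (a' * poly P z + b' * poly Q z) - b' * (c' * poly P z + d' * poly Q z)"
      "(a' * d' - b' * c') * poly Q z = a' * (c' * poly P z + d' * poly Q z) - c' * (a' * poly P z + b' * poly Q z)"
      by (simp_all add: algebra_simps)
    then have "poly P z = 0" "poly Q z = 0" using e \<psi>(2) by simp_all
    then show False using common by blast
  qed
  define N where "N = max (degree p1) (degree q1)"
  obtain p2 where p2: "\<And>x. c * x + d \<noteq> 0 \<Longrightarrow> poly p2 x = (c * x + d) ^ N * poly p1 ((a * x + b) / (c * x + d))"
    using homogenized_substitution[of p1 N c d a b] by (auto simp: N_def)
  obtain q2 where q2: "\<And>x. c * x + d \<noteq> 0 \<Longrightarrow> poly q2 x = (c * x + d) ^ N * poly q1 ((a * x + b) / (c * x + d))"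
    using homogenized_substitution[of q1 N c d a b] by (auto simp: N_def)
  have lin: "[:d, c:] \<noteq> 0" using \<phi>(2) by auto
  have "\<not> UNIV \<subseteq> {x. poly [:d, c:] x = 0}"
    using poly_roots_finite[OF lin] infinite_UNIV_char_0[where 'a = complex] finite_subset by blast
  then obtain x0 where "poly [:d, c:] x0 \<noteq> 0" by blast
  then have "c * x0 + d \<noteq> 0" by (simp add: algebra_simps)
  then have "poly p2 x0 \<noteq> 0 \<or> poly q2 x0 \<noteq> 0" using p2 q2 2 by simp
  then have nz: "p2 \<noteq> 0 \<or> q2 \<noteq> 0" by auto
  define g where "g = gcd p2 q2"
  have "g \<noteq> 0" using nz by (simp add: g_def)
  define p q where "p = p2 div g" and "q = q2 div g"
  have pq: "coprime p q" unfolding p_def q_def g_def using nz by (intro div_gcd_coprime)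
  have p: "p2 = p * g" and q: "q2 = q * g" by (simp_all add: p_def q_def g_def)
  define T where "T = {x. poly [:d, c:] x = 0} \<union> {x. poly g x = 0}"
  have "finite T" unfolding T_def using poly_roots_finite[OF lin] poly_roots_finite[OF \<open>g \<noteq> 0\<close>]
    by (rule finite_UnI)
  moreover have "\<psi> (rat_map r (\<phi> (Point w))) = (if poly q w = 0 then Infty else Point (poly p w / poly q w))"
    if "w \<notin> T" for w
  proof -
    have w: "c * w + d \<noteq> 0" "poly g w \<noteq> 0" using that by (auto simp: T_def algebra_simps)
    have "\<phi> (Point w) = Point ((a * w + b) / (c * w + d))" using w by (simp add: \<phi> mob_Point)
    moreover have "poly g w * poly p w = (c * w + d) ^ N * poly p1 ((a * w + b) / (c * w + d))"
      "poly g w * poly q w = (c * w + d) ^ N * poly q1 ((a * w + b) / (c * w + d))"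
      using p2[OF w(1)] q2[OF w(1)] by (simp_all add: p q mult.commute)
    then have "poly p1 ((a * w + b) / (c * w + d)) = poly g w / (c * w + d) ^ N * poly p w"
      "poly q1 ((a * w + b) / (c * w + d)) = poly g w / (c * w + d) ^ N * poly q w"
      using w by (simp_all add: field_simps)
    ultimately show ?thesis using w by (simp add: 1)
  qed
  ultimately show ?thesis using pq by blast
qed

section \<open>Iterates in normal form\<close>

lemma affine_iterate_fixed_point:
  assumes "\<alpha> \<noteq> 1"
  shows "(mob \<alpha> \<beta> 0 1 ^^ n) (Point w) = Point (\<alpha> ^ n * (w - \<beta> / (1 - \<alpha>)) + \<beta> / (1 - \<alpha>))"
proof (induction n)
  case 0
  show ?case by simp
next
  case (Suc n)
  have "\<alpha> * (\<beta> / (1 - \<alpha>)) + \<beta> = \<beta> / (1 - \<alpha>)" using assms by (simp add: field_simps)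
  then have "\<alpha> * (\<alpha> ^ n * (w - \<beta> / (1 - \<alpha>)) + \<beta> / (1 - \<alpha>)) + \<beta> =
      \<alpha> ^ Suc n * (w - \<beta> / (1 - \<alpha>)) + \<beta> / (1 - \<alpha>)"
    by (simp only: distrib_left power_Suc mult.assoc add.assoc)
  then show ?case using Suc by (simp add: mob_Point)
qed

lemma translation_iterate: "(mob 1 \<beta> 0 1 ^^ n) (Point w) = Point (w + of_nat n * \<beta>)"
  by (induction n) (simp_all add: mob_Point algebra_simps)

lemma affine_iterate_at_Point: "\<exists>y. (mob \<alpha> \<beta> 0 1 ^^ n) (Point w) = Point y"
  by (induction n) (auto simp: mob_Point)

lemma fixing_0_iterate:
  assumes "\<delta> \<noteq> 0"
  shows "mob 1 0 \<gamma> \<delta> ^^ n = mob 1 0 (\<gamma> * (\<Sum>i<n. \<delta> ^ i)) (\<delta> ^ n)"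
proof (induction n)
  case 0
  show ?case by (simp add: mob_id)
next
  case (Suc n)
  have "mob 1 0 \<gamma> \<delta> \<circ> mob 1 0 (\<gamma> * (\<Sum>i<n. \<delta> ^ i)) (\<delta> ^ n) =
      mob 1 0 (\<gamma> + \<delta> * (\<gamma> * (\<Sum>i<n. \<delta> ^ i))) (\<delta> ^ Suc n)"
    using assms by (subst mob_comp) simp_all
  also have "\<gamma> + \<delta> * (\<gamma> * (\<Sum>i<n. \<delta> ^ i)) = \<gamma> * (\<Sum>i<Suc n. \<delta> ^ i)"
    unfolding sum.lessThan_Suc_shift by (simp add: sum_distrib_left algebra_simps)
  finally show ?case using Suc by simp
qed

lemma affine_root_of_unity_translation:
  assumes "generate_free_semigroup (mob \<alpha> \<beta> 0 1) G" "\<alpha> \<noteq> 0" "root_of_unity \<alpha>"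
  shows "\<alpha> = 1 \<and> \<beta> \<noteq> 0"
proof -
  obtain m where m: "m > 0" "\<alpha> ^ m = 1" using assms(3) unfolding root_of_unity_def by blast
  have "\<alpha> = 1"
  proof (rule ccontr)
    assume "\<alpha> \<noteq> 1"
    have "mob \<alpha> \<beta> 0 1 ^^ m = id"
    proof (rule moebius_eq_id)
      show "moebius (mob \<alpha> \<beta> 0 1 ^^ m)" using assms(2) by (intro moebius_funpow moebius_mob) simp
      have "{x. (mob \<alpha> \<beta> 0 1 ^^ m) (Point x) = Point x} = UNIV"
        using affine_iterate_fixed_point[OF \<open>\<alpha> \<noteq> 1\<close>] m by auto
      then show "infinite {x. (mob \<alpha> \<beta> 0 1 ^^ m) (Point x) = Point x}"
        using infinite_UNIV_char_0[where 'a = complex] by simp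
    qed
    then show False using free_power_neq_id[OF assms(1) m(1)] by blast
  qed
  moreover have "\<beta> \<noteq> 0"
  proof
    assume "\<beta> = 0"
    then show False using free_power_neq_id[OF assms(1), of 1] \<open>\<alpha> = 1\<close> by (simp add: mob_id)
  qed
  ultimately show ?thesis by blast
qed

text \<open>
If $\delta^m = 1 \neq \delta$, the geometric sum $1 + \dots + \delta^{m-1}$ vanishes and the map has order dividing $m$.
\<close>

lemma fixing_0_root_of_unity:
  assumes "generate_free_semigroup F (mob 1 0 \<gamma> \<delta>)" "\<delta> \<noteq> 0" "root_of_unity \<delta>"
  shows "\<delta> = 1"
proof (rule ccontr)
  assume "\<delta> \<noteq> 1"
  obtain m where m: "m > 0" "\<delta> ^ m = 1" using assms(3) unfolding root_of_unity_def by blast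
  then have "(\<Sum>i<m. \<delta> ^ i) = 0" using \<open>\<delta> \<noteq> 1\<close> by (simp add: geometric_sum)
  then have "mob 1 0 \<gamma> \<delta> ^^ m = id" using m by (simp add: fixing_0_iterate[OF assms(2)] mob_id)
  then show False using free_power_neq_id[OF free_swap[OF assms(1)] m(1)] by blast
qed

text \<open>
Asking for a finite common value loses nothing: in normal form, $F$ maps finite points to finite
points.
\<close>

definition coincidence :: "(P1 \<Rightarrow> P1) \<Rightarrow> (P1 \<Rightarrow> P1) \<Rightarrow> complex poly \<Rightarrow> complex poly \<Rightarrow> nat \<Rightarrow> bool" where
  "coincidence F G p q n \<longleftrightarrow> n > 0 \<and> (\<exists>w. poly q w \<noteq> 0 \<and>
    (F ^^ n) (Point w) = Point (poly p w / poly q w) \<and>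
    (G ^^ n) (Point w) = Point (poly p w / poly q w))"

lemma coincidence_swap: "coincidence F G p q n = coincidence G F p q n"
  unfolding coincidence_def by blast

text \<open>
Here $n = (c(w) - w) / \beta$ and $\delta^n = (c(w) - v) / (w - v)$.
\<close>

lemma common_fixed_point_translation_finite:
  assumes free: "generate_free_semigroup (mob 1 \<beta> 0 1) (mob \<delta> \<gamma> 0 1)" and "\<delta> \<noteq> 0"
  shows "finite {n. coincidence (mob 1 \<beta> 0 1) (mob \<delta> \<gamma> 0 1) p q n}"
proof (rule ccontr)
  assume inf: "infinite {n. coincidence (mob 1 \<beta> 0 1) (mob \<delta> \<gamma> 0 1) p q n}"
  have "root_of_unity 1" by (rule root_of_unityI[of 1]) auto
  then have \<beta>: "\<beta> \<noteq> 0" using affine_root_of_unity_translation[OF free] by simp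
  have "\<delta> \<noteq> 1"
  proof
    assume "\<delta> = 1"
    then have "mob 1 \<beta> 0 1 \<circ> mob \<delta> \<gamma> 0 1 = mob \<delta> \<gamma> 0 1 \<circ> mob 1 \<beta> 0 1"
      by (simp add: mob_comp add.commute)
    then show False using free_not_commute[OF free] by blast
  qed
  then have nr: "\<not> root_of_unity \<delta>"
    using affine_root_of_unity_translation[OF free_swap[OF free] \<open>\<delta> \<noteq> 0\<close>] by blast
  define v where "v = \<gamma> / (1 - \<delta>)"
  have "root_of_unity \<delta>"
  proof (rule index_and_exponential_on_rational_curve[OF \<open>\<delta> \<noteq> 0\<close> inf])
    fix n assume "n \<in> {n. coincidence (mob 1 \<beta> 0 1) (mob \<delta> \<gamma> 0 1) p q n}"
    then obtain w where n: "n > 0" and w: "poly q w \<noteq> 0" "w + of_nat n * \<beta> = poly p w / poly q w"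
      "\<delta> ^ n * (w - v) + v = poly p w / poly q w"
      unfolding coincidence_def translation_iterate affine_iterate_fixed_point[OF \<open>\<delta> \<noteq> 1\<close>] v_def
      by blast
    have "w \<noteq> v"
    proof
      assume "w = v"
      then have "of_nat n * \<beta> = 0" using w(2,3) by simp
      then show False using n \<beta> by simp
    qed
    then show "\<exists>w. poly (smult \<beta> q) w \<noteq> 0 \<and> poly (q * [:- v, 1:]) w \<noteq> 0 \<and>
      of_nat n = poly (p - [:0, 1:] * q) w / poly (smult \<beta> q) w \<and>
      \<delta> ^ n = poly (p - smult v q) w / poly (q * [:- v, 1:]) w"
      using w \<beta> by (intro exI[of _ w]) (auto simp: field_simps)
  qed
  then show False using nr by blast
qed

text \<open>
Freeness enters four times: multipliers that are roots of unity would give maps of finite order, equal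
second fixed points would make the maps commute, the translation case leads to two commuting
translations or to a finite order, and if $\alpha \delta$ is a root of unity of order dividing $m$, the translations
$(F \circ G)^m$ and $(G \circ F)^m$ commute.
\<close>

lemma infinite_coincidences_common_fixed_point:
  assumes free: "generate_free_semigroup (mob \<alpha> \<beta> 0 1) (mob \<delta> \<gamma> 0 1)"
    and nz: "\<alpha> \<noteq> 0" "\<delta> \<noteq> 0" and pq: "coprime p q"
    and inf: "infinite {n. coincidence (mob \<alpha> \<beta> 0 1) (mob \<delta> \<gamma> 0 1) p q n}"
  shows "\<not> root_of_unity \<alpha> \<and> \<not> root_of_unity \<delta> \<and> \<not> (\<gamma> = 0 \<and> \<beta> = 0) \<and>
    ((root_of_unity (\<alpha> / \<delta>) \<and> \<alpha> / \<delta> \<noteq> 1) \<or> root_of_unity (\<alpha>\<^sup>2 / \<delta>) \<or> root_of_unity (\<delta>\<^sup>2 / \<alpha>))"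
proof -
  have "\<alpha> \<noteq> 1"
  proof
    assume "\<alpha> = 1"
    then show False using common_fixed_point_translation_finite[of \<beta> \<delta> \<gamma> p q] free nz inf by blast
  qed
  have "\<delta> \<noteq> 1"
  proof
    assume "\<delta> = 1"
    then show False
      using common_fixed_point_translation_finite[of \<gamma> \<alpha> \<beta> p q] free_swap[OF free] nz inf
      by (simp add: coincidence_swap[of "mob 1 \<gamma> 0 1"])
  qed
  have nr: "\<not> root_of_unity \<alpha>" "\<not> root_of_unity \<delta>"
    using affine_root_of_unity_translation[OF free nz(1)]
      affine_root_of_unity_translation[OF free_swap[OF free] nz(2)] \<open>\<alpha> \<noteq> 1\<close> \<open>\<delta> \<noteq> 1\<close> by blast+
  define u v where "u = \<beta> / (1 - \<alpha>)" and "v = \<gamma> / (1 - \<delta>)"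
  have u: "\<beta> = u * (1 - \<alpha>)" and v: "\<gamma> = v * (1 - \<delta>)"
    using \<open>\<alpha> \<noteq> 1\<close> \<open>\<delta> \<noteq> 1\<close> by (simp_all add: u_def v_def)
  have "u \<noteq> v"
  proof
    assume "u = v"
    then have "\<alpha> * \<gamma> + \<beta> = \<delta> * \<beta> + \<gamma>" unfolding u v by (simp add: algebra_simps)
    then have "mob \<alpha> \<beta> 0 1 \<circ> mob \<delta> \<gamma> 0 1 = mob \<delta> \<gamma> 0 1 \<circ> mob \<alpha> \<beta> 0 1"
      using nz by (simp add: mob_comp mult.commute)
    then show False using free_not_commute[OF free] by blast
  qed
  have "q \<noteq> 0"
  proof
    assume "q = 0"
    then show False using inf unfolding coincidence_def by simp
  qed
  have "root_of_unity (\<alpha> / \<delta>) \<and> \<alpha> \<noteq> \<delta> \<or> root_of_unity (\<alpha>\<^sup>2 / \<delta>) \<or> root_of_unity (\<delta>\<^sup>2 / \<alpha>) \<or>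
      root_of_unity (\<alpha> * \<delta>)"
  proof (rule common_fixed_point_relation[OF \<open>u \<noteq> v\<close> pq \<open>q \<noteq> 0\<close> nz nr inf])
    fix n assume "n \<in> {n. coincidence (mob \<alpha> \<beta> 0 1) (mob \<delta> \<gamma> 0 1) p q n}"
    then show "n > 0 \<and> (\<exists>w. poly q w \<noteq> 0 \<and> \<alpha> ^ n * (w - u) + u = poly p w / poly q w \<and>
        \<delta> ^ n * (w - v) + v = poly p w / poly q w)"
      unfolding coincidence_def affine_iterate_fixed_point[OF \<open>\<alpha> \<noteq> 1\<close>]
        affine_iterate_fixed_point[OF \<open>\<delta> \<noteq> 1\<close>] u_def v_def by blast
  qed
  moreover have "\<not> root_of_unity (\<alpha> * \<delta>)"
  proof
    assume "root_of_unity (\<alpha> * \<delta>)"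
    then obtain m where m: "m > 0" "(\<alpha> * \<delta>) ^ m = 1" unfolding root_of_unity_def by blast
    have iter: "\<exists>b. mob a b' 0 1 ^^ k = mob (a ^ k) b 0 1" if "a \<noteq> 0" for a b' k
    proof (induction k)
      case 0
      show ?case by (intro exI[of _ 0]) (simp add: mob_id)
    next
      case (Suc k)
      then obtain b where "mob a b' 0 1 ^^ k = mob (a ^ k) b 0 1" by blast
      then have "mob a b' 0 1 ^^ Suc k = mob (a ^ Suc k) (a * b + b') 0 1"
        using that by (simp add: mob_comp)
      then show ?case by blast
    qed
    have FG: "mob \<alpha> \<beta> 0 1 \<circ> mob \<delta> \<gamma> 0 1 = mob (\<alpha> * \<delta>) (\<alpha> * \<gamma> + \<beta>) 0 1"
      "mob \<delta> \<gamma> 0 1 \<circ> mob \<alpha> \<beta> 0 1 = mob (\<alpha> * \<delta>) (\<delta> * \<beta> + \<gamma>) 0 1"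
      using nz by (simp_all add: mob_comp mult.commute)
    have "\<alpha> * \<delta> \<noteq> 0" using nz by simp
    from iter[OF this] m obtain b b' where
      "(mob \<alpha> \<beta> 0 1 \<circ> mob \<delta> \<gamma> 0 1) ^^ m = mob 1 b 0 1"
      "(mob \<delta> \<gamma> 0 1 \<circ> mob \<alpha> \<beta> 0 1) ^^ m = mob 1 b' 0 1"
      unfolding FG by metis
    then show False using free_products_not_commute[OF free m(1)]
      by (simp add: mob_comp add.commute)
  qed
  moreover have "\<not> (\<gamma> = 0 \<and> \<beta> = 0)" using \<open>u \<noteq> v\<close> unfolding u_def v_def by auto
  ultimately show ?thesis using nr nz by auto
qed

text \<open>
The second fixed point of $X / (\gamma X + \delta)$ is $v = (1 - \delta) / \gamma$, and in the coordinate $1 / X$ this map is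
affine: $1 / G^n(w) = \gamma (1 + \dots + \delta^{n-1}) + \delta^n / w$. If both maps are parabolic, then
$\alpha = \delta = 1$ and the conclusion holds trivially; if exactly one is, the multiplier of the other one
would have to be a root of unity.
\<close>

lemma infinite_coincidences_no_common_fixed_point:
  assumes free: "generate_free_semigroup (mob \<alpha> \<beta> 0 1) (mob 1 0 \<gamma> \<delta>)"
    and nz: "\<alpha> \<noteq> 0" "\<beta> \<noteq> 0" "\<gamma> \<noteq> 0" "\<delta> \<noteq> 0"
    and no_common: "\<And>z. mob \<alpha> \<beta> 0 1 z = z \<Longrightarrow> mob 1 0 \<gamma> \<delta> z \<noteq> z" and pq: "coprime p q"
    and inf: "infinite {n. coincidence (mob \<alpha> \<beta> 0 1) (mob 1 0 \<gamma> \<delta>) p q n}" (is "infinite ?S")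
  shows "root_of_unity (\<alpha> / \<delta>) \<or> root_of_unity (\<alpha> * \<delta>)"
proof (rule ccontr)
  assume contra: "\<not> ?thesis"
  have "q \<noteq> 0"
  proof
    assume "q = 0"
    then show False using inf unfolding coincidence_def by simp
  qed
  have r\<alpha>: "\<alpha> = 1" if "root_of_unity \<alpha>" using affine_root_of_unity_translation[OF free nz(1) that] by simp
  have r\<delta>: "\<delta> = 1" if "root_of_unity \<delta>" using fixing_0_root_of_unity[OF free nz(4) that] .
  have one: "root_of_unity 1" by (rule root_of_unityI[of 1]) auto
  define u v where "u = \<beta> / (1 - \<alpha>)" and "v = (1 - \<delta>) / \<gamma>"
  have u0: "u \<noteq> 0" if "\<alpha> \<noteq> 1" using that nz by (simp add: u_def)
  have v0: "v \<noteq> 0" if "\<delta> \<noteq> 1" using that nz by (simp add: v_def)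
  have G: "c * (\<gamma> * (\<Sum>i<n. \<delta> ^ i) * w + \<delta> ^ n) = w"
    if "(mob 1 0 \<gamma> \<delta> ^^ n) (Point w) = Point c" for n w c
    using that unfolding fixing_0_iterate[OF nz(4)] mob_Point by (auto split: if_splits simp: field_simps)
  have G\<delta>: "\<delta> ^ n * (w - v) * c = (c - v) * w"
    if "(mob 1 0 \<gamma> \<delta> ^^ n) (Point w) = Point c" "\<delta> \<noteq> 1" for n w c
  proof -
    have "v * (\<gamma> * (\<Sum>i<n. \<delta> ^ i)) = 1 - \<delta> ^ n"
      using that(2) nz by (simp add: v_def geometric_sum field_simps)
    moreover have "v * w = c * (v * (\<gamma> * (\<Sum>i<n. \<delta> ^ i)) * w + v * \<delta> ^ n)"
    proof -
      have "v * (c * (\<gamma> * (\<Sum>i<n. \<delta> ^ i) * w + \<delta> ^ n)) = v * w"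
        by (simp only: G[OF that(1)])
      then show ?thesis by (simp only: distrib_left mult_ac)
    qed
    ultimately have "v * w = c * ((1 - \<delta> ^ n) * w + v * \<delta> ^ n)" by (simp only:)
    then show ?thesis by (simp add: algebra_simps)
  qed
  show False
  proof (cases "\<alpha> = 1")
    case \<alpha>: True
    then have "\<delta> \<noteq> 1" using contra one by auto
    then have nr: "\<not> root_of_unity \<delta>" using r\<delta> by blast
    have "root_of_unity \<delta>"
    proof (rule index_and_exponential_on_rational_curve[OF nz(4) inf])
      fix n assume "n \<in> ?S"
      then obtain w where n: "n > 0" and w: "poly q w \<noteq> 0" "w + of_nat n * \<beta> = poly p w / poly q w"
        "(mob 1 0 \<gamma> \<delta> ^^ n) (Point w) = Point (poly p w / poly q w)"
        unfolding coincidence_def \<alpha> translation_iterate by blast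
      define c where "c = poly p w / poly q w"
      have c: "c \<noteq> w" using w(2) n nz by (auto simp: c_def)
      have rel: "\<delta> ^ n * (w - v) * c = (c - v) * w" using G\<delta>[OF w(3) \<open>\<delta> \<noteq> 1\<close>] by (simp add: c_def)
      have "w \<noteq> 0" using G[OF w(3)] c nz by (auto simp: c_def)
      then have "w \<noteq> v" "c \<noteq> 0" using rel c v0[OF \<open>\<delta> \<noteq> 1\<close>] by auto
      have pc: "poly p w = c * poly q w" using w(1) by (simp add: c_def)
      have "of_nat n = poly (p - [:0, 1:] * q) w / poly (smult \<beta> q) w"
        using w(1,2) nz by (simp add: field_simps)
      moreover have "poly ((p - smult v q) * [:0, 1:]) w = \<delta> ^ n * poly ([:- v, 1:] * p) w"
      proof -
        have "poly ((p - smult v q) * [:0, 1:]) w = poly q w * ((c - v) * w)"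
          by (simp add: pc algebra_simps)
        also have "\<dots> = \<delta> ^ n * poly ([:- v, 1:] * p) w"
          unfolding rel[symmetric] by (simp add: pc algebra_simps)
        finally show ?thesis .
      qed
      moreover have "poly ([:- v, 1:] * p) w \<noteq> 0" using \<open>w \<noteq> v\<close> \<open>c \<noteq> 0\<close> w(1) pc by simp
      moreover have "poly (smult \<beta> q) w \<noteq> 0" using w(1) nz by simp
      ultimately show "\<exists>w. poly (smult \<beta> q) w \<noteq> 0 \<and> poly ([:- v, 1:] * p) w \<noteq> 0 \<and>
        of_nat n = poly (p - [:0, 1:] * q) w / poly (smult \<beta> q) w \<and>
        \<delta> ^ n = poly ((p - smult v q) * [:0, 1:]) w / poly ([:- v, 1:] * p) w"
        by (intro exI[of _ w] conjI) (simp_all only: eq_divide_eq if_False if_True not_False_eq_True simp_thms)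
    qed
    then show False using nr by blast
  next
    case \<alpha>: False
    then have nr\<alpha>: "\<not> root_of_unity \<alpha>" using r\<alpha> by blast
    have F: "\<alpha> ^ n * (w - u) + u = c" if "(mob \<alpha> \<beta> 0 1 ^^ n) (Point w) = Point c" for n w c
      using that unfolding affine_iterate_fixed_point[OF \<alpha>] u_def by simp
    have ne: "\<alpha> ^ n \<noteq> 1" if "n > 0" for n using nr\<alpha> root_of_unityI that by blast
    show False
    proof (cases "\<delta> = 1")
      case \<delta>: True
      have "root_of_unity \<alpha>"
      proof (rule index_and_exponential_on_rational_curve[OF nz(1) inf])
        fix n assume "n \<in> ?S"
        then obtain w where n: "n > 0" and w: "poly q w \<noteq> 0"
          "(mob \<alpha> \<beta> 0 1 ^^ n) (Point w) = Point (poly p w / poly q w)"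
          "(mob 1 0 \<gamma> \<delta> ^^ n) (Point w) = Point (poly p w / poly q w)"
          unfolding coincidence_def by blast
        define c where "c = poly p w / poly q w"
        have pc: "poly p w = c * poly q w" using w(1) by (simp add: c_def)
        have c\<alpha>: "\<alpha> ^ n * (w - u) = c - u" using F[OF w(2)] by (simp add: c_def algebra_simps)
        have c\<gamma>: "c * (\<gamma> * of_nat n * w + 1) = w" using G[OF w(3)] by (simp add: c_def \<delta>)
        have "w \<noteq> 0"
        proof
          assume "w = 0"
          then have "c = 0" using c\<gamma> by simp
          then have "\<alpha> ^ n = 1" using c\<alpha> \<open>w = 0\<close> u0[OF \<alpha>] by simp
          then show False using ne n by blast
        qed
        then have "c \<noteq> 0" using c\<gamma> by auto
        have "w \<noteq> u"
        proof
          assume "w = u"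
          then have "c = w" using c\<alpha> by simp
          then show False using c\<gamma> \<open>w \<noteq> 0\<close> n nz by simp
        qed
        have "of_nat n * poly (smult \<gamma> ([:0, 1:] * p)) w = poly ([:0, 1:] * q - p) w"
        proof -
          have "c * (\<gamma> * of_nat n * w) = w - c" using c\<gamma> by (simp add: algebra_simps)
          then have "poly q w * (c * (\<gamma> * of_nat n * w)) = poly q w * (w - c)" by simp
          then show ?thesis by (simp add: pc algebra_simps)
        qed
        moreover have "\<alpha> ^ n * poly (q * [:- u, 1:]) w = poly (p - smult u q) w"
        proof -
          have "poly q w * (\<alpha> ^ n * (w - u)) = poly q w * (c - u)" by (simp add: c\<alpha>)
          then show ?thesis by (simp add: pc algebra_simps)
        qed
        moreover have "poly (smult \<gamma> ([:0, 1:] * p)) w \<noteq> 0"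
          using nz \<open>w \<noteq> 0\<close> \<open>c \<noteq> 0\<close> w(1) by (simp add: pc)
        moreover have "poly (q * [:- u, 1:]) w \<noteq> 0" using w(1) \<open>w \<noteq> u\<close> by simp
        ultimately show "\<exists>w. poly (smult \<gamma> ([:0, 1:] * p)) w \<noteq> 0 \<and> poly (q * [:- u, 1:]) w \<noteq> 0 \<and>
          of_nat n = poly ([:0, 1:] * q - p) w / poly (smult \<gamma> ([:0, 1:] * p)) w \<and>
          \<alpha> ^ n = poly (p - smult u q) w / poly (q * [:- u, 1:]) w"
          by (intro exI[of _ w] conjI) (simp_all only: eq_divide_eq if_False if_True not_False_eq_True simp_thms)
      qed
      then show False using nr\<alpha> by blast
    next
      case \<delta>: False
      then have nr\<delta>: "\<not> root_of_unity \<delta>" using r\<delta> by blast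
      have "u \<noteq> v"
      proof
        assume "u = v"
        have "mob \<alpha> \<beta> 0 1 (Point u) = Point u" using \<alpha> by (simp add: mob_Point u_def field_simps)
        moreover have "\<gamma> * v + \<delta> = 1" using nz by (simp add: v_def)
        then have "mob 1 0 \<gamma> \<delta> (Point u) = Point u" by (simp add: mob_Point \<open>u = v\<close>)
        ultimately show False using no_common by blast
      qed
      have "root_of_unity (\<alpha> / \<delta>) \<or> root_of_unity (\<alpha> * \<delta>)"
      proof (rule no_common_fixed_point_relation[OF \<open>u \<noteq> v\<close> u0[OF \<alpha>] v0[OF \<delta>] pq \<open>q \<noteq> 0\<close>
            nz(1,4) nr\<alpha> nr\<delta> inf])
        fix n assume "n \<in> ?S"
        then obtain w where w: "n > 0" "poly q w \<noteq> 0"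
          "(mob \<alpha> \<beta> 0 1 ^^ n) (Point w) = Point (poly p w / poly q w)"
          "(mob 1 0 \<gamma> \<delta> ^^ n) (Point w) = Point (poly p w / poly q w)"
          unfolding coincidence_def by blast
        show "n > 0 \<and> (\<exists>w. poly q w \<noteq> 0 \<and> \<alpha> ^ n * (w - u) + u = poly p w / poly q w \<and>
            \<delta> ^ n * (w - v) * (poly p w / poly q w - 0) = (poly p w / poly q w - v) * (w - 0))"
          unfolding diff_zero using w F[OF w(3)] G\<delta>[OF w(4) \<delta>] by blast
      qed
      then show False using contra by blast
    qed
  qed
qed

section \<open>The finiteness theorem\<close>

text \<open>
A common fixed point, if there is one, is moved to $\infty$. Otherwise a fixed point of \<open>F\<close> is moved to
$\infty$ and one of \<open>G\<close> to $0$; as neither is shared, $F(0) \neq 0$ and $G(\infty) \neq \infty$, which means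
$\beta \neq 0$ and $\gamma \neq 0$.
\<close>

lemma moebius_pair_normal_form:
  assumes "moebius F" "moebius G"
  obtains \<phi> where "moebius \<phi>"
    "(\<exists>\<alpha> \<beta> \<delta> \<gamma>. \<alpha> \<noteq> 0 \<and> \<delta> \<noteq> 0 \<and> inv \<phi> \<circ> F \<circ> \<phi> = mob \<alpha> \<beta> 0 1 \<and> inv \<phi> \<circ> G \<circ> \<phi> = mob \<delta> \<gamma> 0 1) \<or>
     (\<exists>\<alpha> \<beta> \<gamma> \<delta>. \<alpha> \<noteq> 0 \<and> \<beta> \<noteq> 0 \<and> \<gamma> \<noteq> 0 \<and> \<delta> \<noteq> 0 \<and>
        inv \<phi> \<circ> F \<circ> \<phi> = mob \<alpha> \<beta> 0 1 \<and> inv \<phi> \<circ> G \<circ> \<phi> = mob 1 0 \<gamma> \<delta> \<and>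
        (\<forall>z. mob \<alpha> \<beta> 0 1 z = z \<longrightarrow> mob 1 0 \<gamma> \<delta> z \<noteq> z))"
proof -
  have conj: "(inv \<phi> \<circ> H \<circ> \<phi>) z = z \<longleftrightarrow> H (\<phi> z) = \<phi> z" if "moebius \<phi>" for \<phi> H z
    using moebius_bij(1)[OF that] by (metis bij_inv_eq_iff comp_apply)
  have conj_moebius: "moebius (inv \<phi> \<circ> H \<circ> \<phi>)" if "moebius \<phi>" "moebius H" for \<phi> H
    by (intro moebius_comp moebius_bij(2) that)
  show thesis
  proof (cases "\<exists>z. F z = z \<and> G z = z")
    case True
    then obtain z where z: "F z = z" "G z = z" by blast
    obtain z' where "z' \<noteq> z" by (metis P1.distinct(1))
    then obtain \<phi> where \<phi>: "moebius \<phi>" "\<phi> Infty = z" using exists_moebius_two_points[of z z'] by metis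
    have "(inv \<phi> \<circ> F \<circ> \<phi>) Infty = Infty" "(inv \<phi> \<circ> G \<circ> \<phi>) Infty = Infty"
      unfolding conj[OF \<phi>(1)] \<phi>(2) by (fact z)+
    then show thesis
      using that[OF \<phi>(1)] moebius_fixing_Infty[OF conj_moebius[OF \<phi>(1) assms(1)]]
        moebius_fixing_Infty[OF conj_moebius[OF \<phi>(1) assms(2)]] by metis
  next
    case False
    obtain z1 where z1: "F z1 = z1" using moebius_fixed_point assms by blast
    obtain z2 where z2: "G z2 = z2" using moebius_fixed_point assms by blast
    have "z1 \<noteq> z2" using False z1 z2 by blast
    then obtain \<phi> where \<phi>: "moebius \<phi>" "\<phi> Infty = z1" "\<phi> (Point 0) = z2"
      using exists_moebius_two_points by blast
    have F: "(inv \<phi> \<circ> F \<circ> \<phi>) Infty = Infty" unfolding conj[OF \<phi>(1)] \<phi>(2) by (fact z1)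
    have G: "(inv \<phi> \<circ> G \<circ> \<phi>) (Point 0) = Point 0" unfolding conj[OF \<phi>(1)] \<phi>(3) by (fact z2)
    obtain \<alpha> \<beta> where \<alpha>: "\<alpha> \<noteq> 0" "inv \<phi> \<circ> F \<circ> \<phi> = mob \<alpha> \<beta> 0 1"
      using moebius_fixing_Infty[OF conj_moebius[OF \<phi>(1) assms(1)] F] by blast
    obtain \<gamma> \<delta> where \<delta>: "\<delta> \<noteq> 0" "inv \<phi> \<circ> G \<circ> \<phi> = mob 1 0 \<gamma> \<delta>"
      using moebius_fixing_0[OF conj_moebius[OF \<phi>(1) assms(2)] G] by blast
    have none: "mob \<alpha> \<beta> 0 1 z = z \<longrightarrow> mob 1 0 \<gamma> \<delta> z \<noteq> z" for z
      using conj[OF \<phi>(1)] False unfolding \<alpha>(2)[symmetric] \<delta>(2)[symmetric] by blast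
    have "\<beta> \<noteq> 0" using none[of "Point 0"] \<delta>(1) by (auto simp: mob_Point)
    moreover have "\<gamma> \<noteq> 0" using none[of Infty] by (auto simp: mob_Infty)
    ultimately show thesis using that[OF \<phi>(1)] \<alpha> \<delta> none by blast
  qed
qed

text \<open>
An infinite set of exceptional points stays infinite after the change of coordinate, and each index
$n$ accounts for finitely many of them. Hence infinitely many indices occur, and the results for the
two normal forms put $f$ and $g$ into one of the exceptional families.
\<close>

theorem theorem1p3:
  fixes f g c :: rational_function
  assumes "is_automorphism f" and "is_automorphism g"
    and "generate_free_semigroup (rat_map f) (rat_map g)"
    and "\<not> exceptional_1 f g" and "\<not> exceptional_2 f g"
  shows "finite {z::complex. \<exists>n::nat. n > 0 \<and>
    (rat_map f ^^ n) (Point z) = (rat_map g ^^ n) (Point z) \<and>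
    (rat_map g ^^ n) (Point z) = rat_map c (Point z)}"
proof (rule ccontr)
  define \<Lambda> where "\<Lambda> = {z::complex. \<exists>n::nat. n > 0 \<and>
    (rat_map f ^^ n) (Point z) = (rat_map g ^^ n) (Point z) \<and>
    (rat_map g ^^ n) (Point z) = rat_map c (Point z)}"
  assume "\<not> ?thesis"
  then have inf: "infinite \<Lambda>" by (simp add: \<Lambda>_def)
  have mo: "moebius (rat_map f)" "moebius (rat_map g)" using assms automorphism_moebius by auto
  obtain \<phi> where \<phi>: "moebius \<phi>" and normal:
    "(\<exists>\<alpha> \<beta> \<delta> \<gamma>. \<alpha> \<noteq> 0 \<and> \<delta> \<noteq> 0 \<and> inv \<phi> \<circ> rat_map f \<circ> \<phi> = mob \<alpha> \<beta> 0 1 \<and>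
        inv \<phi> \<circ> rat_map g \<circ> \<phi> = mob \<delta> \<gamma> 0 1) \<or>
     (\<exists>\<alpha> \<beta> \<gamma> \<delta>. \<alpha> \<noteq> 0 \<and> \<beta> \<noteq> 0 \<and> \<gamma> \<noteq> 0 \<and> \<delta> \<noteq> 0 \<and>
        inv \<phi> \<circ> rat_map f \<circ> \<phi> = mob \<alpha> \<beta> 0 1 \<and> inv \<phi> \<circ> rat_map g \<circ> \<phi> = mob 1 0 \<gamma> \<delta> \<and>
        (\<forall>z. mob \<alpha> \<beta> 0 1 z = z \<longrightarrow> mob 1 0 \<gamma> \<delta> z \<noteq> z))"
    using moebius_pair_normal_form[OF mo] by blast
  note bij = moebius_bij(1)[OF \<phi>]
  define F G where "F = inv \<phi> \<circ> rat_map f \<circ> \<phi>" and "G = inv \<phi> \<circ> rat_map g \<circ> \<phi>"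
  note normal = normal[folded F_def G_def]
  have free: "generate_free_semigroup F G" unfolding F_def G_def by (rule free_conjugate[OF assms(3) bij])
  have moFG: "moebius F" "moebius G"
    unfolding F_def G_def by (intro moebius_comp moebius_bij(2) mo \<phi>)+
  obtain p q T where pq: "coprime p q" and T: "finite T" and c: "\<And>w. w \<notin> T \<Longrightarrow>
    inv \<phi> (rat_map c (\<phi> (Point w))) = (if poly q w = 0 then Infty else Point (poly p w / poly q w))"
    using conjugate_rational_map[OF \<phi> moebius_bij(2)[OF \<phi>]] by blast
  \<comment> \<open>the exceptional points in the new coordinate; at most the image of $\infty$ is lost\<close>
  define W where "W = {w. \<exists>z\<in>\<Lambda>. \<phi> (Point w) = Point z}"
  have "infinite W"
  proof
    assume "finite W"
    then have "finite ((\<lambda>w. \<phi> (Point w)) ` W \<union> {\<phi> Infty})" by simp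
    moreover have "Point ` \<Lambda> \<subseteq> (\<lambda>w. \<phi> (Point w)) ` W \<union> {\<phi> Infty}"
    proof
      fix y assume "y \<in> Point ` \<Lambda>"
      then obtain z where z: "z \<in> \<Lambda>" "y = Point z" by blast
      obtain x where x: "\<phi> x = Point z" using bij by (metis bij_pointE)
      show "y \<in> (\<lambda>w. \<phi> (Point w)) ` W \<union> {\<phi> Infty}"
      proof (cases x)
        case (Point w)
        then have "w \<in> W" using x z unfolding W_def by blast
        then show ?thesis using Point x z by force
      next
        case Infty
        then show ?thesis using x z by simp
      qed
    qed
    ultimately have "finite (Point ` \<Lambda>)" by (rule finite_subset[rotated])
    moreover have "inj_on Point \<Lambda>" by (simp add: inj_on_def)
    ultimately show False using inf finite_imageD by blast
  qed
  have affine: "\<exists>y. (F ^^ n) (Point w) = Point y" for n w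
    using normal affine_iterate_at_Point by metis
  have "infinite {n. coincidence F G p q n}"
  proof
    assume fin: "finite {n. coincidence F G p q n}"
    have "W - T \<subseteq> (\<Union>n\<in>{n. coincidence F G p q n}. {w. (F ^^ n) (Point w) = (G ^^ n) (Point w)})"
    proof
      fix w assume w: "w \<in> W - T"
      then obtain z n where z: "\<phi> (Point w) = Point z" and n: "n > 0"
        "(rat_map f ^^ n) (Point z) = (rat_map g ^^ n) (Point z)"
        "(rat_map g ^^ n) (Point z) = rat_map c (Point z)"
        unfolding W_def \<Lambda>_def by blast
      have FG: "(F ^^ n) (Point w) = inv \<phi> (rat_map c (\<phi> (Point w)))"
        "(G ^^ n) (Point w) = inv \<phi> (rat_map c (\<phi> (Point w)))"
        unfolding F_def G_def funpow_conjugate[OF bij] using z n by simp_all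
      have "poly q w \<noteq> 0" using affine[of n w] FG(1) c w by auto
      then have "coincidence F G p q n"
        unfolding coincidence_def FG c[of w] using n w FG c[of w] by auto
      then show "w \<in> (\<Union>n\<in>{n. coincidence F G p q n}. {w. (F ^^ n) (Point w) = (G ^^ n) (Point w)})"
        using FG by auto
    qed
    moreover have "finite {w. (F ^^ n) (Point w) = (G ^^ n) (Point w)}"
      if "coincidence F G p q n" for n
      using that free_powers_neq[OF free] moebius_funpow moFG
      by (intro moebius_eq_finite) (auto simp: coincidence_def)
    ultimately have "finite (W - T)" using fin by (elim finite_subset) auto
    then show False using \<open>infinite W\<close> T by (simp add: Diff_infinite_finite)
  qed
  note inf = this
  obtain r where r: "is_automorphism r" "rat_map r = \<phi>" using moebius_as_automorphism[OF \<phi>] by blast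
  have conj: "simultaneously_conjugate f g f' g'" if "rat_map f' = F" "rat_map g' = G" for f' g'
    unfolding simultaneously_conjugate_def using r that by (auto simp: F_def G_def)
  have affine_map: "rat_map (Fract [:b, a:] 1) = mob a b 0 1" if "a \<noteq> 0" for a b
    using rat_map_linear_fractional[of a 1 b 0] that by (simp add: one_pCons)
  from normal show False
  proof (elim disjE exE conjE)
    fix \<alpha> \<beta> \<delta> \<gamma> assume nz: "\<alpha> \<noteq> 0" "\<delta> \<noteq> 0" and F: "F = mob \<alpha> \<beta> 0 1" and G: "G = mob \<delta> \<gamma> 0 1"
    have "simultaneously_conjugate f g (Fract [:\<beta>, \<alpha>:] 1) (Fract [:\<gamma>, \<delta>:] 1)"
      using nz by (intro conj) (simp_all add: affine_map F G)
    then have "exceptional_2 f g"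
      using infinite_coincidences_common_fixed_point[OF free[unfolded F G] nz pq inf[unfolded F G]] nz
      unfolding exceptional_2_def by blast
    then show False using assms(5) by blast
  next
    fix \<alpha> \<beta> \<gamma> \<delta> assume nz: "\<alpha> \<noteq> 0" "\<beta> \<noteq> 0" "\<gamma> \<noteq> 0" "\<delta> \<noteq> 0"
      and F: "F = mob \<alpha> \<beta> 0 1" and G: "G = mob 1 0 \<gamma> \<delta>"
      and none: "\<forall>z. mob \<alpha> \<beta> 0 1 z = z \<longrightarrow> mob 1 0 \<gamma> \<delta> z \<noteq> z"
    have "simultaneously_conjugate f g (Fract [:\<beta>, \<alpha>:] 1) (Fract [:0, 1:] [:\<delta>, \<gamma>:])"
      using nz rat_map_linear_fractional[of 1 \<delta> 0 \<gamma>] by (intro conj) (simp_all add: affine_map F G)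
    then have "exceptional_1 f g"
      using infinite_coincidences_no_common_fixed_point[OF free[unfolded F G] nz _ pq inf[unfolded F G]]
        none nz unfolding exceptional_1_def by blast
    then show False using assms(4) by blast
  qed
qed

end
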